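(* Let $L,d>0$, $E_1>E_2>0$, $0<\nu<\frac12$, let $\mathcal K$ and $\kappa$ be as in the context, and assume $E=(\kappa+1-\nu^2)\mathcal K$. For $\ell>0$ put $\Omega=(0,L)\times(-\ell,\ell)$. Let $f\in L^2(\Omega)$ be a function depending only on the $x$ variable, let $u_\ell$ be the corresponding solution of the plate problem $$\begin{cases} \frac{d^3\mathcal K}{12}\left(\Delta^2u+\kappa\frac{\partial^4u}{\partial x^4}\right)=f & \text{in }\Omega,\\ u(0,y)=u_{xx}(0,y)=u(L,y)=u_{xx}(L,y)=0 & \text{for }y\in(-\ell,\ell),\\ u_{yy}(x,\pm\ell)+\nu u_{xx}(x,\pm\ell)=0 & \text{for }x\in(0,L),\\ u_{yyy}(x,\pm\ell)+(2-\nu)u_{xxy}(x,\pm\ell)=0 & \text{for }x\in(0,L), \end{cases}$$ and let $\psi$ be the unique solution of the beam problem $$\begin{cases} EI\,\psi''''=2\ell f & \text{in }(0,L),\\ \psi(0)=\psi(L)=\psi''(0)=\psi''(L)=0, \end{cases}\qquad I=\frac{d^3\ell}{6}$$ (equivalently, $\frac{Ed^3}{12}\psi''''=f$ in $(0,L)$ with the same boundary conditions, so that $\psi$ does not depend on $\ell$). Then $$\sup_{(x,y)\in\Omega}|u_\ell(x,y)-\psi(x)|\to0\qquad\text{as }\ell\to0.$$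
   Context: The parameters $L,d,E_1,E_2,\nu$ and the function $f=f(x)$ (i.e. $f\in L^2(0,L)$) are fixed, independent of $\ell$. With $\nu=\nu_{12}$ and $\nu_{21}=\nu_{12}E_2/E_1$, $$\mathcal K=\frac{E_2}{1-\nu_{12}\nu_{21}},\qquad\kappa=\frac{E_1-E_2}{E_2}>0.$$ The solution $u_\ell$ of the plate problem is the unique weak solution: $u_\ell\in H^2_*(\Omega)=\{w\in H^2(\Omega):w=0\text{ on }\{0,L\}\times(-\ell,\ell)\}$ with $$\frac{d^3\mathcal K}{12}\int_\Omega\left[\nu\Delta u_\ell\Delta v+(1-\nu)D^2u_\ell:D^2v+\kappa\,(u_\ell)_{xx}v_{xx}\right]dx\,dy=\int_\Omega fv\,dx\,dy\quad\text{for all }v\in H^2_*(\Omega),$$ where $D^2u:D^2v=u_{xx}v_{xx}+2u_{xy}v_{xy}+u_{yy}v_{yy}$. *)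

theory Defs
  imports "HOL-Analysis.Analysis"
begin

section \<open>Sobolev spaces of integer order on a subset of a Euclidean space\<close>

definition L2 :: "'a::euclidean_space set \<Rightarrow> ('a \<Rightarrow> real) set" where
  "L2 S = {g. g \<in> borel_measurable (lebesgue_on S) \<and> integrable (lebesgue_on S) (\<lambda>x. (g x)\<^sup>2)}"

text \<open>A multi-index is a list of basis vectors: \<open>partials [i\<^sub>1, \<dots>, i\<^sub>k] g\<close> is the iterated
  partial derivative of \<open>g\<close>, the innermost one being in direction \<open>i\<^sub>k\<close>. On smooth functions the
  order is irrelevant.\<close>

definition partials :: "'a::euclidean_space list \<Rightarrow> ('a \<Rightarrow> real) \<Rightarrow> 'a \<Rightarrow> real" where
  "partials is g = foldr (\<lambda>i h x. frechet_derivative h (at x) i) is g"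

definition smooth :: "('a::euclidean_space \<Rightarrow> real) \<Rightarrow> bool" where
  "smooth g \<longleftrightarrow> (\<forall>is. set is \<subseteq> Basis \<longrightarrow> partials is g differentiable_on UNIV)"

text \<open>The space of test functions on \<open>S\<close>, extended by zero to the whole space.\<close>

definition test_functions :: "'a::euclidean_space set \<Rightarrow> ('a \<Rightarrow> real) set" where
  "test_functions S = {g. smooth g \<and> (\<exists>C. compact C \<and> C \<subseteq> S \<and> (\<forall>x. x \<notin> C \<longrightarrow> g x = 0))}"

definition has_L2_weak_deriv ::
  "'a::euclidean_space set \<Rightarrow> 'a list \<Rightarrow> ('a \<Rightarrow> real) \<Rightarrow> ('a \<Rightarrow> real) \<Rightarrow> bool" where
  "has_L2_weak_deriv S is w g \<longleftrightarrow> g \<in> L2 S \<and>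
     (\<forall>\<phi>\<in>test_functions S.
        (\<integral>x. w x * partials is \<phi> x \<partial>lebesgue_on S) =
        (- 1) ^ length is * (\<integral>x. g x * \<phi> x \<partial>lebesgue_on S))"

definition sobolev :: "nat \<Rightarrow> 'a::euclidean_space set \<Rightarrow> ('a \<Rightarrow> real) set" where
  "sobolev k S = {w \<in> L2 S. \<forall>is. set is \<subseteq> Basis \<and> length is \<le> k \<longrightarrow>
                     (\<exists>g. has_L2_weak_deriv S is w g)}"

section \<open>The plate\<close>

definition plate :: "real \<Rightarrow> real \<Rightarrow> (real \<times> real) set" where
  "plate L \<l> = {0<..<L} \<times> {- \<l><..<\<l>}"

text \<open>In the plane, \<open>H\<^sup>2\<close> embeds into the continuous functions on the closed rectangle. Elements of
  \<open>H\<^sup>2\<^sub>*\<close> are therefore represented by their continuous representative, and the condition \<open>w = 0\<close>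
  on the hinged edges is a pointwise one.\<close>

definition H2_star :: "real \<Rightarrow> real \<Rightarrow> (real \<times> real \<Rightarrow> real) set" where
  "H2_star L \<l> = {w \<in> sobolev 2 (plate L \<l>).
     continuous_on (closure (plate L \<l>)) w \<and> (\<forall>p \<in> {0, L} \<times> {- \<l><..<\<l>}. w p = 0)}"

text \<open>The second weak derivatives are unique only up to null sets, hence a relation.\<close>

definition weak_hessian :: "(real \<times> real) set \<Rightarrow> (real \<times> real \<Rightarrow> real) \<Rightarrow>
    (real \<times> real \<Rightarrow> real) \<Rightarrow> (real \<times> real \<Rightarrow> real) \<Rightarrow> (real \<times> real \<Rightarrow> real) \<Rightarrow> bool" where
  "weak_hessian S w wxx wxy wyy \<longleftrightarrow>
     has_L2_weak_deriv S [(1, 0), (1, 0)] w wxx \<and>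
     has_L2_weak_deriv S [(1, 0), (0, 1)] w wxy \<and>
     has_L2_weak_deriv S [(0, 1), (0, 1)] w wyy"

text \<open>Weak solutions of the plate problem with load \<open>F\<close>; the conditions on the hinged edges for
  \<open>u\<^sub>x\<^sub>x\<close> and on the free edges are the natural boundary conditions of the variational equation.\<close>

definition plate_solution :: "real \<Rightarrow> real \<Rightarrow> real \<Rightarrow> real \<Rightarrow> real \<Rightarrow> real \<Rightarrow>
    (real \<times> real \<Rightarrow> real) \<Rightarrow> (real \<times> real \<Rightarrow> real) \<Rightarrow> bool" where
  "plate_solution L \<l> d K \<kappa> \<nu> F u \<longleftrightarrow> u \<in> H2_star L \<l> \<and>
     (\<exists>uxx uxy uyy. weak_hessian (plate L \<l>) u uxx uxy uyy \<and>
       (\<forall>v \<in> H2_star L \<l>. \<forall>vxx vxy vyy. weak_hessian (plate L \<l>) v vxx vxy vyy \<longrightarrow>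
          d ^ 3 * K / 12 *
            (\<integral>p. \<nu> * ((uxx p + uyy p) * (vxx p + vyy p))
                + (1 - \<nu>) * (uxx p * vxx p + 2 * (uxy p * vxy p) + uyy p * vyy p)
                + \<kappa> * (uxx p * vxx p) \<partial>lebesgue_on (plate L \<l>))
          = (\<integral>p. F p * v p \<partial>lebesgue_on (plate L \<l>))))"

section \<open>The beam\<close>

text \<open>Solutions in \<open>H\<^sup>4(0, L)\<close> of \<open>B \<psi>'''' = q\<close> for \<open>q\<close> in \<open>L\<^sup>2(0, L)\<close>, with hinged ends: \<open>\<psi>\<close> is
  \<open>C\<^sup>3\<close> on the closed interval, and \<open>\<psi>'''\<close> is the indefinite integral of an \<open>L\<^sup>2\<close> function, its
  derivative \<open>\<psi>''''\<close>, which satisfies the equation almost everywhere.\<close>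

definition beam_solution :: "real \<Rightarrow> real \<Rightarrow> (real \<Rightarrow> real) \<Rightarrow> (real \<Rightarrow> real) \<Rightarrow> bool" where
  "beam_solution L B q \<psi> \<longleftrightarrow>
     (\<exists>\<psi>1 \<psi>2 \<psi>3 \<psi>4.
        (\<forall>x\<in>{0..L}. (\<psi> has_real_derivative \<psi>1 x) (at x within {0..L})) \<and>
        (\<forall>x\<in>{0..L}. (\<psi>1 has_real_derivative \<psi>2 x) (at x within {0..L})) \<and>
        (\<forall>x\<in>{0..L}. (\<psi>2 has_real_derivative \<psi>3 x) (at x within {0..L})) \<and>
        \<psi>4 \<in> L2 {0<..<L} \<and>
        (\<forall>x\<in>{0..L}. \<psi>3 x = \<psi>3 0 + (\<integral>t. \<psi>4 t \<partial>lebesgue_on {0<..<x})) \<and>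
        (AE x in lebesgue_on {0<..<L}. B * \<psi>4 x = q x) \<and>
        \<psi> 0 = 0 \<and> \<psi> L = 0 \<and> \<psi>2 0 = 0 \<and> \<psi>2 L = 0)"

end

theory Submission
  imports Defs
begin

text \<open>A narrow plate with free long edges bends like a beam, except that its cross-sections curve too: where the
beam has curvature \<open>\<psi>''\<close>, the free edges impose the opposite curvature \<open>- \<nu> \<psi>''\<close> across the plate
(Poisson's effect, anticlastic bending). The plate deflection is therefore compared not with \<open>\<psi>\<close> but
with the corrected beam \<open>z(x, y) = \<psi>(x) - \<nu>/2 y\<^sup>2 \<psi>''(x)\<close>. It lies in the energy space because
\<open>\<psi>\<close> is in \<open>H\<^sup>4\<close> and \<open>\<psi>''\<close> vanishes at the ends (\<open>corrected_beam_H2_star\<close>), and it differs from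
\<open>\<psi>\<close> by at most a multiple of \<open>\<l>\<^sup>2\<close>.

Insert \<open>z\<close> and a test function \<open>v\<close> into the bilinear form. The transverse curvature
\<open>- \<nu> \<psi>''\<close> turns the coefficient \<open>1 + \<kappa>\<close> of \<open>\<psi>'' v\<^sub>x\<^sub>x\<close> into \<open>1 + \<kappa> - \<nu>\<^sup>2\<close>, which is the stiffness
\<open>E / K\<close> of the beam, and it removes \<open>\<psi>''\<close> from the coefficient of \<open>v\<^sub>y\<^sub>y\<close>. By the beam equation and two
integrations by parts in \<open>x\<close> (\<open>bending_duality\<close>) what is left is the load, plus terms that contain a
factor \<open>y\<close> and hence are of order \<open>\<l>\<close>. So \<open>w = u - z\<close> solves the plate equation with a load of order \<open>\<l>\<close>; with
\<open>v = w\<close> and Young's inequality, \<open>\<integral> |D\<^sup>2 w|\<^sup>2\<close> is at most a constant times \<open>\<l>\<^sup>3\<close>: two powers from the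
residual and one from the area of the plate (\<open>plate_beam_energy\<close>).

To pass to the supremum the constant of the embedding of \<open>H\<^sup>2\<close> into the continuous functions must be
known as a function of \<open>\<l>\<close>. Since \<open>w\<close> vanishes on the hinged edges, its variation across the plate is
bounded by \<open>\<integral> |w\<^sub>x\<^sub>y|\<close> (\<open>transverse_oscillation\<close>), and its mean over a cross-section by
\<open>L / (2 \<l>) \<integral> |w\<^sub>x\<^sub>x|\<close> through the Green function of the interval (\<open>transverse_bound\<close>). Both \<open>L\<^sup>1\<close>
norms are of order \<open>\<l>\<^sup>2\<close> by the energy estimate, so \<open>w\<close> and with it \<open>u - \<psi>\<close> is uniformly of order
\<open>\<l>\<close>.\<close>

section \<open>Square-integrable functions and their Borel representatives\<close>

lemma L2_D:
  assumes "g \<in> L2 S"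
  shows "g \<in> borel_measurable (lebesgue_on S)" "integrable (lebesgue_on S) (\<lambda>x. (g x)\<^sup>2)"
  using assms by (auto simp: L2_def)

lemma L2_prod_integrable:
  assumes "g \<in> L2 S" "h \<in> L2 S"
  shows "integrable (lebesgue_on S) (\<lambda>x. g x * h x)"
proof (rule Bochner_Integration.integrable_bound)
  show "integrable (lebesgue_on S) (\<lambda>x. (g x)\<^sup>2 + (h x)\<^sup>2)"
    using assms by (intro Bochner_Integration.integrable_add L2_D)
  show "(\<lambda>x. g x * h x) \<in> borel_measurable (lebesgue_on S)"
    using assms by (intro borel_measurable_times L2_D)
  show "AE x in lebesgue_on S. norm (g x * h x) \<le> norm ((g x)\<^sup>2 + (h x)\<^sup>2)"
  proof (rule AE_I2)
    fix x
    have "2 * (\<bar>g x\<bar> * \<bar>h x\<bar>) \<le> (g x)\<^sup>2 + (h x)\<^sup>2"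
      using sum_squares_bound[of "\<bar>g x\<bar>" "\<bar>h x\<bar>"] by (simp add: mult.assoc)
    moreover have "0 \<le> \<bar>g x\<bar> * \<bar>h x\<bar>" by simp
    ultimately have "\<bar>g x\<bar> * \<bar>h x\<bar> \<le> (g x)\<^sup>2 + (h x)\<^sup>2" by linarith
    then show "norm (g x * h x) \<le> norm ((g x)\<^sup>2 + (h x)\<^sup>2)"
      by (simp add: abs_mult)
  qed
qed

lemma L2_scale: "g \<in> L2 S \<Longrightarrow> (\<lambda>x. c * g x) \<in> L2 S"
  by (auto simp: L2_def power_mult_distrib)

lemma L2_add:
  assumes "g \<in> L2 S" "h \<in> L2 S"
  shows "(\<lambda>x. g x + h x) \<in> L2 S"
proof -
  have "integrable (lebesgue_on S) (\<lambda>x. (g x)\<^sup>2 + 2 * (g x * h x) + (h x)\<^sup>2)"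
    using assms
    by (intro Bochner_Integration.integrable_add integrable_mult_right L2_prod_integrable L2_D)
  then have "integrable (lebesgue_on S) (\<lambda>x. (g x + h x)\<^sup>2)"
    by (simp add: power2_sum algebra_simps)
  moreover have "(\<lambda>x. g x + h x) \<in> borel_measurable (lebesgue_on S)"
    using assms by (intro borel_measurable_add L2_D)
  ultimately show ?thesis by (simp add: L2_def)
qed

text \<open>Lebesgue measure on the plane is the completion of the product measure and not the product itself, so
Fubini's theorem is applied to Borel functions. Representatives are extended by zero: an integral
over \<open>S\<close> then becomes an integral over the whole space.\<close>

definition borel_rep :: "'a::euclidean_space set \<Rightarrow> ('a \<Rightarrow> real) \<Rightarrow> ('a \<Rightarrow> real) \<Rightarrow> bool" where
  "borel_rep S g g' \<longleftrightarrow> g' \<in> borel_measurable borel \<and> (\<forall>x. x \<notin> S \<longrightarrow> g' x = 0) \<and>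
     (AE x in lebesgue_on S. g x = g' x)"

lemma borel_rep_exists:
  assumes "g \<in> borel_measurable (lebesgue_on S)" "S \<in> sets borel"
  obtains g' where "borel_rep S g g'"
proof -
  have S: "S \<in> sets lebesgue" using assms(2) by simp
  have "(\<lambda>x. if x \<in> S then g x else 0) \<in> borel_measurable lebesgue"
    using borel_measurable_if[OF S] assms(1) by blast
  from completion_ex_borel_measurable_real[OF this]
  obtain h where h: "h \<in> borel_measurable lborel"
    "AE x in lborel. (if x \<in> S then g x else 0) = h x" by blast
  have "borel_rep S g (\<lambda>x. indicator S x * h x)"
    unfolding borel_rep_def
  proof (intro conjI)
    show "(\<lambda>x. indicator S x * h x) \<in> borel_measurable borel"
      using h(1) assms(2) by (intro borel_measurable_times borel_measurable_indicator) simp_all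
    have "AE x in lebesgue. (if x \<in> S then g x else 0) = h x"
      using h(2) by (rule AE_completion)
    then show "AE x in lebesgue_on S. g x = indicator S x * h x"
      using S by (subst AE_restrict_space_iff) (auto elim!: AE_mp)
  qed auto
  then show ?thesis using that by blast
qed

lemma borel_rep_integral:
  assumes r: "borel_rep S g g'" and S: "S \<in> sets borel"
  shows "g \<in> borel_measurable (lebesgue_on S)"
    and "(\<integral>x. g x \<partial>lebesgue_on S) = (\<integral>x. g' x \<partial>lborel)"
    and "integrable (lebesgue_on S) g \<longleftrightarrow> integrable lborel g'"
proof -
  have g': "g' \<in> borel_measurable lborel" "\<And>x. x \<notin> S \<Longrightarrow> g' x = 0"
    and ae: "AE x in lebesgue_on S. g x = g' x" using r by (auto simp: borel_rep_def)
  have Sl: "S \<in> sets lebesgue" using S by simp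
  have m': "g' \<in> borel_measurable lebesgue" using g'(1) by (rule measurable_completion)
  have ae2: "AE x in lebesgue. (if x \<in> S then g x else 0) = g' x"
    using ae Sl g'(2) by (subst (asm) AE_restrict_space_iff) (auto elim!: AE_mp)
  have m: "(\<lambda>x. if x \<in> S then g x else 0) \<in> borel_measurable lebesgue"
    by (rule borel_measurable_AE[OF m']) (use ae2 in \<open>auto elim!: AE_mp\<close>)
  show gm: "g \<in> borel_measurable (lebesgue_on S)"
    using m borel_measurable_if[OF Sl] by blast
  have eq: "(\<lambda>x. indicator S x *\<^sub>R g x) = (\<lambda>x. if x \<in> S then g x else 0)"
    by (auto simp: indicator_def)
  have "(\<integral>x. g x \<partial>lebesgue_on S) = (\<integral>x. (if x \<in> S then g x else 0) \<partial>lebesgue)"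
    using Sl by (subst integral_restrict_space) (simp, simp only: eq)
  also have "\<dots> = (\<integral>x. g' x \<partial>lebesgue)"
    by (rule integral_cong_AE[OF m m' ae2])
  also have "\<dots> = (\<integral>x. g' x \<partial>lborel)"
    using g'(1) by (rule integral_completion)
  finally show "(\<integral>x. g x \<partial>lebesgue_on S) = (\<integral>x. g' x \<partial>lborel)" .
  have "integrable (lebesgue_on S) g \<longleftrightarrow> integrable lebesgue (\<lambda>x. (if x \<in> S then g x else 0))"
    using Sl by (subst integrable_restrict_space) (simp, simp only: eq)
  also have "\<dots> \<longleftrightarrow> integrable lebesgue g'"
    by (rule integrable_cong_AE[OF m m' ae2])
  also have "\<dots> \<longleftrightarrow> integrable lborel g'"
    using g'(1) by (rule integrable_completion)
  finally show "integrable (lebesgue_on S) g \<longleftrightarrow> integrable lborel g'" .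
qed

lemma borel_rep_mult:
  assumes "borel_rep S g g'" "borel_rep S h h'"
  shows "borel_rep S (\<lambda>x. g x * h x) (\<lambda>x. g' x * h' x)"
  using assms unfolding borel_rep_def by (auto elim!: AE_mp)

lemma borel_rep_self:
  assumes "S \<in> sets borel" "(\<lambda>x. indicator S x * h x) \<in> borel_measurable borel"
  shows "borel_rep S h (\<lambda>x. indicator S x * h x)"
  using assms unfolding borel_rep_def
  by (auto simp: AE_restrict_space_iff)

lemma borel_rep_mult_borel:
  assumes "borel_rep S g g'" "h \<in> borel_measurable borel"
  shows "borel_rep S (\<lambda>x. g x * h x) (\<lambda>x. g' x * h x)"
  using assms unfolding borel_rep_def by (auto elim!: AE_mp)

lemma borel_rep_L2:
  assumes r: "borel_rep S g g'" and S: "S \<in> sets borel"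
  shows "g \<in> L2 S \<longleftrightarrow> integrable lborel (\<lambda>x. (g' x)\<^sup>2)"
proof -
  have "borel_rep S (\<lambda>x. (g x)\<^sup>2) (\<lambda>x. (g' x)\<^sup>2)"
    using borel_rep_mult[OF r r] by (simp add: power2_eq_square)
  from borel_rep_integral(3)[OF this S] borel_rep_integral(1)[OF r S]
  show ?thesis by (simp add: L2_def)
qed

text \<open>On a set of finite measure, \<open>|g| \<le> g\<^sup>2 + 1\<close>.\<close>

lemma integrable_of_square:
  assumes g: "g \<in> borel_measurable borel" "\<And>x. x \<notin> S \<Longrightarrow> g x = (0::real)"
    and S: "S \<in> sets borel" "emeasure lborel S < \<infinity>"
    and sq: "integrable lborel (\<lambda>x. (g x)\<^sup>2)"
  shows "integrable lborel g"
proof (rule Bochner_Integration.integrable_bound)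
  show "integrable lborel (\<lambda>x. (g x)\<^sup>2 + indicator S x)"
    using S sq by (intro Bochner_Integration.integrable_add integrable_real_indicator) auto
  show "AE x in lborel. norm (g x) \<le> norm ((g x)\<^sup>2 + indicator S x)"
  proof (rule AE_I2)
    fix x show "norm (g x) \<le> norm ((g x)\<^sup>2 + indicator S x)"
    proof (cases "x \<in> S")
      case True
      have "2 * (\<bar>g x\<bar> * 1) \<le> (g x)\<^sup>2 + 1"
        using sum_squares_bound[of "\<bar>g x\<bar>" 1] by simp
      then show ?thesis using True by (simp add: abs_if split: if_splits)
    qed (use g(2) in auto)
  qed
qed (use g in simp)

abbreviation tensor :: "(real \<Rightarrow> real) \<Rightarrow> (real \<Rightarrow> real) \<Rightarrow> real \<times> real \<Rightarrow> real" where
  "tensor f g \<equiv> \<lambda>(x, y). f x * g y"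

lemma product_integrable:
  assumes "integrable lborel (f::real\<Rightarrow>real)" "integrable lborel (g::real\<Rightarrow>real)"
  shows "integrable lborel (\<lambda>(x,y). f x * g y)"
proof -
  have "integrable (lborel \<Otimes>\<^sub>M lborel) (\<lambda>(x,y). f x * g y)"
  proof (rule lborel_pair.Fubini_integrable)
    show "(\<lambda>(x,y). f x * g y) \<in> borel_measurable (lborel \<Otimes>\<^sub>M lborel)"
      using assms[THEN borel_measurable_integrable] by measurable
    show "integrable lborel (\<lambda>x. \<integral>y. norm (case (x, y) of (x, y) \<Rightarrow> f x * g y) \<partial>lborel)"
      using assms by (simp add: abs_mult)
    show "AE x in lborel. integrable lborel (\<lambda>y. case (x, y) of (x, y) \<Rightarrow> f x * g y)"
      using assms by simp
  qed
  then show ?thesis by (simp add: lborel_prod)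
qed

section \<open>Smooth functions of one variable\<close>

text \<open>Counting the derivatives, instead of requiring all of them at once, makes closure under products an
induction: the product rule expresses \<open>(f g)'\<close> by products with one derivative less.\<close>

primrec times_differentiable :: "nat \<Rightarrow> (real \<Rightarrow> real) \<Rightarrow> bool" where
  "times_differentiable 0 f = True"
| "times_differentiable (Suc k) f =
     (\<exists>f'. (\<forall>x. (f has_real_derivative f' x) (at x)) \<and> times_differentiable k f')"

definition smooth_real :: "(real \<Rightarrow> real) \<Rightarrow> bool" where
  "smooth_real f \<longleftrightarrow> (\<forall>k. times_differentiable k f)"

lemma times_differentiable_Suc_D: "times_differentiable (Suc k) f \<Longrightarrow> times_differentiable k f"
  by (induction k arbitrary: f) (simp, metis times_differentiable.simps(2))

lemma times_differentiable_const: "times_differentiable k (\<lambda>x. c)"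
proof (induction k arbitrary: c)
  case (Suc k)
  then show ?case by (auto intro!: exI[of _ "\<lambda>x. 0"])
qed simp

lemma times_differentiable_add:
  "times_differentiable k f \<Longrightarrow> times_differentiable k g \<Longrightarrow> times_differentiable k (\<lambda>x. f x + g x)"
proof (induction k arbitrary: f g)
  case (Suc k)
  then obtain f' g' where "\<And>x. (f has_real_derivative f' x) (at x)" "times_differentiable k f'"
    "\<And>x. (g has_real_derivative g' x) (at x)" "times_differentiable k g'" by auto
  then show ?case using Suc.IH
    by (auto intro!: exI[of _ "\<lambda>x. f' x + g' x"] DERIV_add)
qed simp

lemma times_differentiable_mult:
  "times_differentiable k f \<Longrightarrow> times_differentiable k g \<Longrightarrow> times_differentiable k (\<lambda>x. f x * g x)"
proof (induction k arbitrary: f g)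
  case (Suc k)
  then obtain f' g' where *: "\<And>x. (f has_real_derivative f' x) (at x)" "times_differentiable k f'"
    "\<And>x. (g has_real_derivative g' x) (at x)" "times_differentiable k g'" by auto
  have "times_differentiable k f" "times_differentiable k g"
    using Suc.prems times_differentiable_Suc_D by blast+
  then have "times_differentiable k (\<lambda>x. f' x * g x + g' x * f x)"
    using Suc.IH * by (intro times_differentiable_add) auto
  moreover have "((\<lambda>x. f x * g x) has_real_derivative f' x * g x + g' x * f x) (at x)" for x
    using * by (auto intro!: DERIV_mult)
  ultimately show ?case
    by (auto intro!: exI[of _ "\<lambda>x. f' x * g x + g' x * f x"])
qed simp

lemma times_differentiable_affine:
  "times_differentiable k f \<Longrightarrow> times_differentiable k (\<lambda>x. f (a * x + b))"
proof (induction k arbitrary: f)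
  case (Suc k)
  then obtain f' where *: "\<And>x. (f has_real_derivative f' x) (at x)" "times_differentiable k f'" by auto
  have "times_differentiable k (\<lambda>x. a * f' (a * x + b))"
    using Suc.IH * by (intro times_differentiable_mult times_differentiable_const) auto
  moreover have "((\<lambda>x. f (a * x + b)) has_real_derivative a * f' (a * x + b)) (at x)" for x
  proof -
    have "((\<lambda>x. a * x + b) has_real_derivative a) (at x)" by (auto intro!: derivative_eq_intros)
    from DERIV_chain2[OF *(1) this] show ?thesis by (simp add: mult.commute)
  qed
  ultimately show ?case
    by (auto intro!: exI[of _ "\<lambda>x. a * f' (a * x + b)"])
qed simp

lemma smooth_real_const: "smooth_real (\<lambda>x. c)"
  by (simp add: smooth_real_def times_differentiable_const)

lemma smooth_real_add: "smooth_real f \<Longrightarrow> smooth_real g \<Longrightarrow> smooth_real (\<lambda>x. f x + g x)"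
  by (simp add: smooth_real_def times_differentiable_add)

lemma smooth_real_mult: "smooth_real f \<Longrightarrow> smooth_real g \<Longrightarrow> smooth_real (\<lambda>x. f x * g x)"
  by (simp add: smooth_real_def times_differentiable_mult)

lemma smooth_real_affine: "smooth_real f \<Longrightarrow> smooth_real (\<lambda>x. f (a * x + b))"
  by (simp add: smooth_real_def times_differentiable_affine)

lemma smooth_real_cmult: "smooth_real f \<Longrightarrow> smooth_real (\<lambda>x. c * f x)"
  by (intro smooth_real_mult smooth_real_const)

lemma smooth_real_diff: "smooth_real f \<Longrightarrow> smooth_real g \<Longrightarrow> smooth_real (\<lambda>x. f x - g x)"
  using smooth_real_add[of f "\<lambda>x. (-1) * g x"] smooth_real_cmult[of g "-1"] by simp

lemma smooth_real_antiderivative: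
  assumes "smooth_real f'" "\<And>x. (f has_real_derivative f' x) (at x)"
  shows "smooth_real f"
  unfolding smooth_real_def
proof
  fix k show "times_differentiable k f"
    using assms by (cases k) (auto simp: smooth_real_def)
qed

lemma smooth_real_derivative:
  assumes "smooth_real f"
  obtains f' where "smooth_real f'" "\<And>x. (f has_real_derivative f' x) (at x)"
proof -
  have "times_differentiable 1 f" using assms by (simp add: smooth_real_def)
  then obtain f' where f': "\<And>x. (f has_real_derivative f' x) (at x)" by auto
  have "times_differentiable k f'" for k
  proof -
    have "times_differentiable (Suc k) f" using assms by (simp add: smooth_real_def)
    then obtain g where g: "\<And>x. (f has_real_derivative g x) (at x)" "times_differentiable k g" by auto
    have "g = f'" using g f' DERIV_unique by blast
    then show ?thesis using g by simp
  qed
  then show ?thesis using that f' by (auto simp: smooth_real_def)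
qed

lemma smooth_real_derivative_smooth:
  assumes "smooth_real f" "\<And>x. (f has_real_derivative f' x) (at x)"
  shows "smooth_real f'"
proof -
  obtain g where g: "smooth_real g" "\<And>x. (f has_real_derivative g x) (at x)"
    using smooth_real_derivative[OF assms(1)] by blast
  have "g = f'" using g(2) assms(2) DERIV_unique by blast
  then show ?thesis using g(1) by simp
qed

lemma smooth_real_continuous: "smooth_real f \<Longrightarrow> continuous_on S f"
  by (metis smooth_real_derivative DERIV_continuous_on DERIV_subset subset_UNIV)

text \<open>The polynomial is a parameter because differentiation preserves functions of this form; the case
\<open>p = 1\<close> is the classical flat function \<open>exp (- 1 / x)\<close>.\<close>

definition flat_exp :: "real poly \<Rightarrow> real \<Rightarrow> real" where
  "flat_exp p x = (if x > 0 then poly p (1 / x) * exp (- 1 / x) else 0)"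

lemma poly_exp_tendsto_0: "((\<lambda>t. poly p t * exp (- t)) \<longlongrightarrow> (0::real)) at_top"
proof -
  have "((\<lambda>t. \<Sum>i\<le>degree p. coeff p i * (t ^ i / exp t)) \<longlongrightarrow> (\<Sum>i\<le>degree p. coeff p i * 0)) at_top"
    by (intro tendsto_sum tendsto_mult tendsto_const tendsto_power_div_exp_0)
  then show ?thesis
    by (simp add: poly_altdef sum_divide_distrib exp_minus field_simps)
qed

lemma flat_exp_derivative:
  "(flat_exp p has_real_derivative flat_exp ([:0, 0, 1:] * (p - pderiv p)) x) (at x)"
proof (cases x "0::real" rule: linorder_cases)
  case less
  have "((\<lambda>x. 0) has_real_derivative 0) (at x)" by simp
  then have "(flat_exp p has_real_derivative 0) (at x)"
    by (rule has_field_derivative_transform_within_open[of _ _ _ "{..<0}"])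
      (use less in \<open>auto simp: flat_exp_def\<close>)
  then show ?thesis using less by (simp add: flat_exp_def)
next
  case greater
  have "((\<lambda>x. poly p (1 / x) * exp (- 1 / x)) has_real_derivative
      flat_exp ([:0, 0, 1:] * (p - pderiv p)) x) (at x)"
    using greater
    by (auto intro!: derivative_eq_intros DERIV_chain2[OF poly_DERIV]
        simp: flat_exp_def field_simps power2_eq_square)
  then show ?thesis
    by (rule has_field_derivative_transform_within_open[of _ _ _ "{0<..}"])
      (use greater in \<open>auto simp: flat_exp_def\<close>)
next
  case equal
  have "((\<lambda>h. poly (pCons 0 p) (1 / h) * exp (- (1 / h))) \<longlongrightarrow> 0) (at_right 0)"
    using filterlim_compose[OF poly_exp_tendsto_0 filterlim_inverse_at_top_right, of "pCons 0 p"]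
    by (simp add: inverse_eq_divide)
  then have "((\<lambda>h. flat_exp p h / h) \<longlongrightarrow> 0) (at_right 0)"
    by (rule Lim_transform_eventually)
      (auto simp: eventually_at_filter flat_exp_def field_simps)
  moreover have "((\<lambda>h. flat_exp p h / h) \<longlongrightarrow> 0) (at_left 0)"
    by (rule Lim_transform_eventually[OF tendsto_const])
      (auto simp: eventually_at_filter flat_exp_def)
  ultimately have "((\<lambda>h. flat_exp p h / h) \<longlongrightarrow> 0) (at 0)"
    by (simp add: filterlim_split_at)
  then show ?thesis using equal
    by (simp add: has_field_derivative_iff flat_exp_def)
qed

lemma smooth_real_flat_exp: "smooth_real (flat_exp p)"
  unfolding smooth_real_def
proof
  fix k show "times_differentiable k (flat_exp p)"
    by (induction k arbitrary: p) (use flat_exp_derivative in auto)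
qed

lemma continuous_antiderivative:
  fixes f :: "real \<Rightarrow> real"
  assumes "continuous_on UNIV f"
  obtains F where "\<And>x. (F has_real_derivative f x) (at x)" "F 0 = 0"
proof -
  have "\<exists>F. \<forall>x::real. -\<infinity> < ereal x \<longrightarrow> ereal x < \<infinity> \<longrightarrow> (F has_vector_derivative f x) (at x)"
    using assms by (intro einterval_antiderivative) (auto simp: continuous_on_eq_continuous_at)
  then obtain F where F: "\<And>x. (F has_real_derivative f x) (at x)"
    by (auto simp: has_real_derivative_iff_has_vector_derivative)
  show ?thesis
    by (rule that[of "\<lambda>x. F x - F 0"]) (auto intro!: derivative_eq_intros F)
qed

lemma deriv_zero_const_on:
  fixes F :: "real \<Rightarrow> real"
  assumes "\<And>t. (F has_real_derivative f t) (at t)" "\<And>t. a < t \<Longrightarrow> t < b \<Longrightarrow> f t = 0" "a \<le> b"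
  shows "F a = F b"
proof (cases "a = b")
  case False
  then have "a < b" using assms by simp
  then obtain z where "z > a" "z < b" "F b - F a = (b - a) * f z"
    using MVT2[of a b F f] assms(1) by blast
  then show ?thesis using assms(2) by simp
qed simp

text \<open>Bumps of mass one with their first and second antiderivatives, which are smooth versions of the
Heaviside step and of the ramp \<open>max 0 (t - p)\<close>; \<open>e\<close> is the width and \<open>p\<close> the left end. Differences of
steps are test functions whose derivative approximates a difference of point masses; suitable
combinations of ramps are test functions whose second derivative approximates point masses. The ramps lag behind \<open>max 0 (t - p)\<close> by
\<open>e * c\<close>, with the same constant for all \<open>p\<close>, so that their affine parts can cancel.\<close>

definition smoothed_step_family ::
  "(real \<Rightarrow> real \<Rightarrow> real \<Rightarrow> real) \<Rightarrow> (real \<Rightarrow> real \<Rightarrow> real \<Rightarrow> real) \<Rightarrow> (real \<Rightarrow> real \<Rightarrow> real \<Rightarrow> real) \<Rightarrow> real \<Rightarrow> bool"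
  where "smoothed_step_family K S R c \<longleftrightarrow> (\<forall>e>0. \<forall>p.
    smooth_real (K e p) \<and> smooth_real (S e p) \<and> smooth_real (R e p) \<and>
    (\<forall>t. (S e p has_real_derivative K e p t) (at t)) \<and> (\<forall>t. (R e p has_real_derivative S e p t) (at t)) \<and>
    (\<forall>t. 0 \<le> K e p t) \<and> (\<forall>t. K e p t \<noteq> 0 \<longrightarrow> p < t \<and> t < p + e) \<and>
    (\<forall>t. 0 \<le> S e p t) \<and> (\<forall>t. S e p t \<le> 1) \<and> (\<forall>t\<le>p. S e p t = 0) \<and> (\<forall>t\<ge>p + e. S e p t = 1) \<and>
    (\<forall>t\<le>p. R e p t = 0) \<and> (\<forall>t\<ge>p + e. R e p t = t - p - e * c) \<and> (\<forall>t. \<bar>R e p t - max 0 (t - p)\<bar> \<le> e))"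

lemma smoothed_step_family_D:
  assumes "smoothed_step_family K S R c" "e > 0"
  shows "smooth_real (K e p)" "smooth_real (S e p)" "smooth_real (R e p)"
    "(S e p has_real_derivative K e p t) (at t)" "(R e p has_real_derivative S e p t) (at t)"
    "0 \<le> K e p t" "K e p t \<noteq> 0 \<Longrightarrow> p < t \<and> t < p + e"
    "0 \<le> S e p t" "S e p t \<le> 1" "t \<le> p \<Longrightarrow> S e p t = 0" "p + e \<le> t \<Longrightarrow> S e p t = 1"
    "t \<le> p \<Longrightarrow> R e p t = 0" "p + e \<le> t \<Longrightarrow> R e p t = t - p - e * c" "\<bar>R e p t - max 0 (t - p)\<bar> \<le> e"
  using assms(1)[unfolded smoothed_step_family_def, rule_format, OF assms(2), of p] by simp_all

text \<open>A product of two flat exponentials is a bump supported on the unit interval; normalise and integrate it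
twice, then rescale.\<close>

lemma smoothed_step_family_exists:
  obtains K S R c where "smoothed_step_family K S R c"
proof -
  define b where "b x = flat_exp 1 x * flat_exp 1 (-1 * x + 1)" for x
  have b: "smooth_real b"
    unfolding b_def[abs_def] by (intro smooth_real_mult smooth_real_affine smooth_real_flat_exp)
  have b0: "b x = 0" if "x \<le> 0 \<or> x \<ge> 1" for x using that by (auto simp: b_def flat_exp_def)
  have bpos: "b x > 0" if "0 < x" "x < 1" for x using that by (auto simp: b_def flat_exp_def)
  obtain B where B: "\<And>x. (B has_real_derivative b x) (at x)" "B 0 = 0"
    using continuous_antiderivative[OF smooth_real_continuous[OF b]] by blast
  have "\<exists>z. 0 < z \<and> z < 1 \<and> B 1 - B 0 = (1 - 0) * b z" using MVT2[of 0 1 B b] B by auto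
  then have m: "B 1 > 0" using B(2) bpos by auto
  define \<rho> where "\<rho> x = (1 / B 1) * b x" for x
  define H where "H x = (1 / B 1) * B x" for x
  have s\<rho>: "smooth_real \<rho>" unfolding \<rho>_def[abs_def] by (intro smooth_real_cmult b)
  have \<rho>0: "\<rho> x \<ge> 0" for x
  proof (cases "0 < x \<and> x < 1")
    case True then show ?thesis using bpos[of x] m by (simp add: \<rho>_def)
  next
    case False then show ?thesis using b0[of x] by (simp add: \<rho>_def not_less)
  qed
  have \<rho>z: "\<rho> x = 0" if "x \<le> 0 \<or> x \<ge> 1" for x using b0[OF that] by (simp add: \<rho>_def)
  have H': "(H has_real_derivative \<rho> x) (at x)" for x
    unfolding H_def[abs_def] \<rho>_def by (intro DERIV_cmult B)
  have sH: "smooth_real H" by (rule smooth_real_antiderivative[OF s\<rho> H'])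
  have H0: "H x = 0" if "x \<le> 0" for x
    using deriv_zero_const_on[of H \<rho> x 0] H' \<rho>z that B(2) by (auto simp: H_def)
  have H1: "H x = 1" if "x \<ge> 1" for x
    using deriv_zero_const_on[of H \<rho> 1 x] H' \<rho>z that m by (auto simp: H_def)
  have mono: "H x \<le> H y" if "x \<le> y" for x y
    using H' \<rho>0 that by (intro DERIV_nonneg_imp_nondecreasing[of x y H]) blast+
  have Hge: "0 \<le> H x" for x using mono[of "min x 0" x] H0[of "min x 0"] by simp
  have Hle: "H x \<le> 1" for x using mono[of x "max x 1"] H1[of "max x 1"] by simp
  obtain R where R: "\<And>x. (R has_real_derivative H x) (at x)" "R 0 = 0"
    using continuous_antiderivative[OF smooth_real_continuous[OF sH]] by blast
  have R0: "R x = 0" if "x \<le> 0" for x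
    using deriv_zero_const_on[of R H x 0] R H0 that by auto
  have R1: "R x = x - (1 - R 1)" if "x \<ge> 1" for x
  proof -
    have "((\<lambda>x. R x - x) has_real_derivative H t - 1) (at t)" for t
      by (auto intro!: derivative_eq_intros R)
    from deriv_zero_const_on[OF this, of 1 x] H1 that show ?thesis by auto
  qed
  have Rge: "R x \<ge> 0" if "x \<ge> 0" for x
    using DERIV_nonneg_imp_nondecreasing[of 0 x R] R Hge that by metis
  have Rle: "R x \<le> x" if "x \<ge> 0" for x
  proof -
    have "((\<lambda>x. x - R x) has_real_derivative 1 - H t) (at t)" for t
      by (auto intro!: derivative_eq_intros R)
    moreover have "1 - H t \<ge> 0" for t using Hle[of t] by simp
    ultimately have "0 - R 0 \<le> x - R x"
      using DERIV_nonneg_imp_nondecreasing[of 0 x "\<lambda>x. x - R x"] that by metis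
    then show ?thesis using R(2) by simp
  qed
  have Rb: "\<bar>R x - max 0 x\<bar> \<le> 1" for x
  proof -
    consider "x \<le> 0" | "0 \<le> x" "x \<le> 1" | "x \<ge> 1" by linarith
    then show ?thesis
    proof cases
      case 2 then show ?thesis using Rge[of x] Rle[of x] by (auto simp: max_def)
    next
      case 3 then show ?thesis using R1[of x] Rge[of 1] Rle[of 1] by (auto simp: max_def)
    qed (use R0[of x] in auto)
  qed
  have sR: "smooth_real R" by (rule smooth_real_antiderivative[OF sH R(1)])
  have \<rho>: "x \<le> 0 \<Longrightarrow> \<rho> x = 0" "x \<ge> 1 \<Longrightarrow> \<rho> x = 0" for x using \<rho>z by blast+
  define k where "k e p t = (1 / e) * \<rho> ((1 / e) * t + (- p / e))" for e p t :: real
  define h where "h e p t = H ((1 / e) * t + (- p / e))" for e p t :: real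
  define q where "q e p t = e * R ((1 / e) * t + (- p / e))" for e p t :: real
  have "smoothed_step_family k h q (1 - R 1)"
    unfolding smoothed_step_family_def
  proof (intro allI impI, goal_cases)
    case e: (1 e p)
    have arg: "(1 / e) * t + (- p / e) = (t - p) / e" for t by (simp add: diff_divide_distrib)
    have d: "((\<lambda>t. (1 / e) * t + (- p / e)) has_real_derivative 1 / e) (at t)" for t
      using e by (auto intro!: derivative_eq_intros)
    have lo: "(1 / e) * t + (- p / e) \<le> 0" if "t \<le> p" for t
      unfolding arg using that e by (simp add: divide_nonpos_pos)
    have hi: "(1 / e) * t + (- p / e) \<ge> 1" if "p + e \<le> t" for t
      unfolding arg using that e by (simp add: le_divide_eq)
    have "smooth_real (k e p)" "smooth_real (h e p)" "smooth_real (q e p)"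
      unfolding k_def[abs_def] h_def[abs_def] q_def[abs_def] by (intro smooth_real_cmult smooth_real_affine s\<rho> sH sR)+
    moreover have "(h e p has_real_derivative k e p t) (at t)" for t
      using DERIV_chain2[OF H' d, of t] by (simp add: h_def[abs_def] k_def)
    moreover have "(q e p has_real_derivative h e p t) (at t)" for t
      using DERIV_cmult[OF DERIV_chain2[OF R(1) d], of e t] e by (simp add: q_def[abs_def] h_def)
    moreover have "0 \<le> k e p t" for t using \<rho>0 e by (simp add: k_def)
    moreover have "p < t" if "k e p t \<noteq> 0" for t
    proof (rule ccontr)
      assume "\<not> p < t"
      then have "\<rho> ((1 / e) * t + (- p / e)) = 0" by (intro \<rho>(1) lo) simp
      with that show False by (simp only: k_def mult_zero_right)
    qed
    moreover have "t < p + e" if "k e p t \<noteq> 0" for t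
    proof (rule ccontr)
      assume "\<not> t < p + e"
      then have "\<rho> ((1 / e) * t + (- p / e)) = 0" by (intro \<rho>(2) hi) simp
      with that show False by (simp only: k_def mult_zero_right)
    qed
    moreover have "q e p t = t - p - e * (1 - R 1)" if "p + e \<le> t" for t
    proof -
      have "q e p t = e * ((t - p) / e - (1 - R 1))" unfolding q_def R1[OF hi[OF that]] by (simp only: arg)
      also have "\<dots> = e * ((t - p) / e) - e * (1 - R 1)" by (rule right_diff_distrib)
      finally show ?thesis using e by (simp del: right_diff_distrib)
    qed
    moreover have "\<bar>q e p t - max 0 (t - p)\<bar> \<le> e" for t
    proof -
      have "max 0 (t - p) = e * max 0 ((t - p) / e)"
        using e by (auto simp: max_def zero_le_divide_iff)
      then have "q e p t - max 0 (t - p) = e * (R ((t - p) / e) - max 0 ((t - p) / e))"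
        unfolding q_def arg by (simp only: right_diff_distrib)
      then show ?thesis using Rb[of "(t - p) / e"] e by (simp add: abs_mult)
    qed
    moreover have "h e p t = 0" "q e p t = 0" if "t \<le> p" for t
      using H0[OF lo[OF that]] R0[OF lo[OF that]] by (simp_all only: h_def q_def mult_zero_right)
    moreover have "h e p t = 1" if "p + e \<le> t" for t
      unfolding h_def using H1[OF hi[OF that]] .
    moreover have "0 \<le> h e p t" "h e p t \<le> 1" for t unfolding h_def using Hge Hle by blast+
    ultimately show ?case
      by (intro conjI allI impI) assumption+
  qed
  then show ?thesis by (rule that)
qed

section \<open>Test functions and weak derivatives\<close>

lemma partials_Nil [simp]: "partials [] g = g"
  by (simp add: partials_def)

lemma partials_Cons: "partials (i # is) g = (\<lambda>x. frechet_derivative (partials is g) (at x) i)"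
  by (simp add: partials_def)

lemma partials_append: "partials (is @ js) g = partials is (partials js g)"
  by (simp add: partials_def)

text \<open>The complement of \<open>C\<close> is open, so \<open>g\<close> vanishes near each of its points.\<close>

lemma partials_zero_outside:
  assumes "closed C" "\<And>x. x \<notin> C \<Longrightarrow> g x = 0" "x \<notin> C"
  shows "partials is g x = 0"
  using assms(3)
proof (induction "is" arbitrary: x)
  case (Cons i "is")
  have "(partials is g has_derivative (\<lambda>h. 0)) (at x)"
  proof (rule has_derivative_transform_within_open)
    show "((\<lambda>x. 0) has_derivative (\<lambda>h. 0)) (at x)" by simp
    show "open (- C)" using assms(1) by auto
    show "x \<in> - C" using Cons.prems by simp
    show "\<And>y. y \<in> - C \<Longrightarrow> 0 = partials is g y" using Cons.IH by simp
  qed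
  then have "frechet_derivative (partials is g) (at x) = (\<lambda>h. 0)"
    by (metis frechet_derivative_at)
  then show ?case by (simp add: partials_Cons)
qed (use assms(2) in simp)

lemma test_functions_partials:
  assumes "\<phi> \<in> test_functions S" "set is \<subseteq> Basis"
  shows "partials is \<phi> \<in> test_functions S"
proof -
  obtain C where C: "compact C" "C \<subseteq> S" "\<And>x. x \<notin> C \<Longrightarrow> \<phi> x = 0" and sm: "smooth \<phi>"
    using assms(1) by (auto simp: test_functions_def)
  have "smooth (partials is \<phi>)"
    using sm assms(2) unfolding smooth_def
    by (metis partials_append set_append Un_least)
  moreover have "partials is \<phi> x = 0" if "x \<notin> C" for x
    using that by (rule partials_zero_outside[OF compact_imp_closed[OF C(1)], rotated]) (rule C(3))
  ultimately show ?thesis using C by (auto simp: test_functions_def)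
qed

lemma test_functions_differentiable:
  assumes "\<phi> \<in> test_functions S" shows "\<phi> differentiable (at x)"
proof -
  have "partials [] \<phi> differentiable_on UNIV"
    using assms unfolding test_functions_def smooth_def by (metis (mono_tags, lifting) empty_set empty_subsetI mem_Collect_eq)
  then show ?thesis by (simp add: differentiable_on_def)
qed

lemma test_functions_continuous:
  assumes "\<phi> \<in> test_functions S" shows "continuous_on A \<phi>"
  using test_functions_differentiable[OF assms]
  by (meson continuous_at_imp_continuous_on differentiable_imp_continuous_within)

lemma test_functions_borel: "\<phi> \<in> test_functions S \<Longrightarrow> \<phi> \<in> borel_measurable borel"
  by (intro borel_measurable_continuous_onI test_functions_continuous)

lemma test_functions_L2:
  assumes "\<phi> \<in> test_functions S" "S \<in> sets lebesgue"
  shows "\<phi> \<in> L2 S"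
proof -
  obtain C where C: "compact C" "\<And>x. x \<notin> C \<Longrightarrow> \<phi> x = 0"
    using assms(1) by (auto simp: test_functions_def)
  have "integrable lborel (\<lambda>x. indicator C x *\<^sub>R (\<phi> x)\<^sup>2)"
    using C by (intro borel_integrable_compact continuous_intros test_functions_continuous[OF assms(1)])
  moreover have "(\<lambda>x. indicator C x *\<^sub>R (\<phi> x)\<^sup>2) = (\<lambda>x. (\<phi> x)\<^sup>2)"
    using C(2) by (auto simp: fun_eq_iff indicator_def)
  ultimately have i: "integrable lborel (\<lambda>x. (\<phi> x)\<^sup>2)" by simp
  have "integrable lebesgue (\<lambda>x. (\<phi> x)\<^sup>2)"
    using i borel_measurable_integrable[OF i] by (simp add: integrable_completion)
  then have "integrable (lebesgue_on S) (\<lambda>x. (\<phi> x)\<^sup>2)"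
    using assms(2) by (subst integrable_restrict_space) (auto intro!: integrable_mult_indicator simp del: real_scaleR_def)
  moreover have "\<phi> \<in> borel_measurable (lebesgue_on S)"
    using test_functions_borel[OF assms(1)]
    by (intro measurable_restrict_space1 measurable_completion) simp
  ultimately show ?thesis by (simp add: L2_def)
qed

lemma has_L2_weak_deriv_linear:
  assumes 1: "has_L2_weak_deriv S is w1 g1" "w1 \<in> L2 S"
    and 2: "has_L2_weak_deriv S is w2 g2" "w2 \<in> L2 S"
    and S: "S \<in> sets lebesgue" and B: "set is \<subseteq> Basis"
  shows "has_L2_weak_deriv S is (\<lambda>x. w1 x + c * w2 x) (\<lambda>x. g1 x + c * g2 x)"
proof -
  have g: "g1 \<in> L2 S" "g2 \<in> L2 S" using 1 2 by (auto simp: has_L2_weak_deriv_def)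
  have "(\<integral>x. (w1 x + c * w2 x) * partials is \<phi> x \<partial>lebesgue_on S) =
      (- 1) ^ length is * (\<integral>x. (g1 x + c * g2 x) * \<phi> x \<partial>lebesgue_on S)"
    if \<phi>: "\<phi> \<in> test_functions S" for \<phi>
  proof -
    have p: "\<phi> \<in> L2 S" "partials is \<phi> \<in> L2 S"
      using \<phi> test_functions_partials[OF \<phi> B] test_functions_L2 S by auto
    have "(\<integral>x. (w1 x + c * w2 x) * partials is \<phi> x \<partial>lebesgue_on S)
       = (\<integral>x. w1 x * partials is \<phi> x + c * (w2 x * partials is \<phi> x) \<partial>lebesgue_on S)"
      by (simp add: algebra_simps)
    also have "\<dots> = (\<integral>x. w1 x * partials is \<phi> x \<partial>lebesgue_on S)
        + c * (\<integral>x. w2 x * partials is \<phi> x \<partial>lebesgue_on S)"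
      using L2_prod_integrable[OF 1(2) p(2)] L2_prod_integrable[OF 2(2) p(2)] by simp
    also have "\<dots> = (- 1) ^ length is * ((\<integral>x. g1 x * \<phi> x \<partial>lebesgue_on S)
        + c * (\<integral>x. g2 x * \<phi> x \<partial>lebesgue_on S))"
      using 1 2 \<phi> by (simp add: has_L2_weak_deriv_def algebra_simps)
    also have "\<dots> = (- 1) ^ length is * (\<integral>x. g1 x * \<phi> x + c * (g2 x * \<phi> x) \<partial>lebesgue_on S)"
      using L2_prod_integrable[OF g(1) p(1)] L2_prod_integrable[OF g(2) p(1)] by simp
    finally show ?thesis by (simp add: algebra_simps)
  qed
  then show ?thesis
    using L2_add[OF g(1) L2_scale[OF g(2)]] by (auto simp: has_L2_weak_deriv_def)
qed

text \<open>Partial derivatives of test functions are test functions, so weak derivatives can be taken one at a time.\<close>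

lemma has_L2_weak_deriv_append:
  assumes "has_L2_weak_deriv S is w g" "has_L2_weak_deriv S js g h" "set js \<subseteq> Basis"
  shows "has_L2_weak_deriv S (is @ js) w h"
  using assms test_functions_partials[of _ S js]
  by (auto simp: has_L2_weak_deriv_def partials_append power_add)

lemma has_L2_weak_deriv_Nil: "w \<in> L2 S \<Longrightarrow> has_L2_weak_deriv S [] w w"
  by (simp add: has_L2_weak_deriv_def)

lemma Basis_plane: "(Basis :: (real \<times> real) set) = {(1, 0), (0, 1)}"
  by (auto simp: Basis_prod_def)

lemma partial_derivative_1:
  assumes "\<phi> differentiable (at (x, y))"
  shows "((\<lambda>t. \<phi> (t, y)) has_real_derivative partials [(1, 0)] \<phi> (x, y)) (at x)"
proof -
  have "(\<phi> has_derivative frechet_derivative \<phi> (at (x, y))) (at (x, y))"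
    using assms frechet_derivative_works by blast
  moreover have "((\<lambda>t. (t, y)) has_derivative (\<lambda>h. (h, 0))) (at x)"
    by (auto intro!: derivative_eq_intros)
  ultimately have "((\<lambda>t. \<phi> (t, y)) has_derivative (\<lambda>h. frechet_derivative \<phi> (at (x, y)) (h, 0))) (at x)"
    using has_derivative_compose[of "\<lambda>t. (t, y)"] by blast
  moreover have "frechet_derivative \<phi> (at (x, y)) (h, 0) = partials [(1, 0)] \<phi> (x, y) * h" for h
    using linear_scale[OF linear_frechet_derivative[OF assms], of h "(1, 0)"]
    by (simp add: partials_Cons)
  ultimately show ?thesis by (simp add: has_field_derivative_def)
qed

lemma partial_derivative_2:
  assumes "\<phi> differentiable (at (x, y))"
  shows "((\<lambda>t. \<phi> (x, t)) has_real_derivative partials [(0, 1)] \<phi> (x, y)) (at y)"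
proof -
  have "(\<phi> has_derivative frechet_derivative \<phi> (at (x, y))) (at (x, y))"
    using assms frechet_derivative_works by blast
  moreover have "((\<lambda>t. (x, t)) has_derivative (\<lambda>h. (0, h))) (at y)"
    by (auto intro!: derivative_eq_intros)
  ultimately have "((\<lambda>t. \<phi> (x, t)) has_derivative (\<lambda>h. frechet_derivative \<phi> (at (x, y)) (0, h))) (at y)"
    using has_derivative_compose[of "\<lambda>t. (x, t)"] by blast
  moreover have "frechet_derivative \<phi> (at (x, y)) (0, h) = partials [(0, 1)] \<phi> (x, y) * h" for h
    using linear_scale[OF linear_frechet_derivative[OF assms], of h "(0, 1)"]
    by (simp add: partials_Cons)
  ultimately show ?thesis by (simp add: has_field_derivative_def)
qed

lemma product_has_derivative:
  assumes "\<And>x. (\<alpha> has_real_derivative \<alpha>' x) (at x)" "\<And>y. (\<beta> has_real_derivative \<beta>' y) (at y)"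
  shows "(tensor \<alpha> \<beta> has_derivative
     (\<lambda>h. \<alpha>' (fst p) * fst h * \<beta> (snd p) + \<alpha> (fst p) * (\<beta>' (snd p) * snd h))) (at p)"
proof -
  have "(\<alpha> has_derivative (\<lambda>h. \<alpha>' (fst p) * h)) (at (fst p))"
    "(\<beta> has_derivative (\<lambda>h. \<beta>' (snd p) * h)) (at (snd p))"
    using assms by (auto simp: has_field_derivative_def)
  then have "((\<lambda>q. \<alpha> (fst q)) has_derivative (\<lambda>h. \<alpha>' (fst p) * fst h)) (at p)"
    "((\<lambda>q. \<beta> (snd q)) has_derivative (\<lambda>h. \<beta>' (snd p) * snd h)) (at p)"
    using has_derivative_compose[of fst fst p UNIV \<alpha>] has_derivative_compose[of snd snd p UNIV \<beta>]
      has_derivative_fst[OF has_derivative_ident] has_derivative_snd[OF has_derivative_ident] by blast+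
  then have "((\<lambda>q. \<alpha> (fst q) * \<beta> (snd q)) has_derivative
     (\<lambda>h. \<alpha> (fst p) * (\<beta>' (snd p) * snd h) + \<alpha>' (fst p) * fst h * \<beta> (snd p))) (at p)"
    by (rule has_derivative_mult)
  then show ?thesis by (simp add: case_prod_unfold add.commute)
qed

lemma partials_product:
  assumes "\<And>x. (\<alpha> has_real_derivative \<alpha>' x) (at x)" "\<And>y. (\<beta> has_real_derivative \<beta>' y) (at y)"
  shows "partials [(1, 0)] (tensor \<alpha> \<beta>) = tensor \<alpha>' \<beta>"
    and "partials [(0, 1)] (tensor \<alpha> \<beta>) = tensor \<alpha> \<beta>'"
  using frechet_derivative_at[OF product_has_derivative[of \<alpha> \<alpha>' \<beta> \<beta>', OF assms], symmetric]
  by (auto simp: partials_Cons)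

text \<open>Every iterated partial derivative of a product \<open>\<alpha>(x) \<beta>(y)\<close> is again a product of this kind.\<close>

lemma smooth_product:
  assumes "smooth_real \<alpha>" "smooth_real \<beta>"
  shows "smooth (tensor \<alpha> \<beta>)"
proof -
  have form: "\<exists>a b. smooth_real a \<and> smooth_real b \<and>
      partials is (tensor \<alpha> \<beta>) = tensor a b"
    if "set is \<subseteq> Basis" for "is"
    using that
  proof (induction "is")
    case (Cons i "is")
    then obtain a b where ab: "smooth_real a" "smooth_real b"
      "partials is (tensor \<alpha> \<beta>) = tensor a b" by auto
    obtain a' where a': "smooth_real a'" "\<And>x. (a has_real_derivative a' x) (at x)"
      using smooth_real_derivative[OF ab(1)] by blast
    obtain b' where b': "smooth_real b'" "\<And>x. (b has_real_derivative b' x) (at x)"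
      using smooth_real_derivative[OF ab(2)] by blast
    note pp = partials_product[of a a' b b', OF a'(2) b'(2)]
    have split: "partials (i # is) (tensor \<alpha> \<beta>) = partials [i] (tensor a b)"
      using partials_append[of "[i]" "is"] ab(3) by simp
    consider "i = (1, 0)" | "i = (0, 1)" using Cons.prems by (auto simp: Basis_plane)
    then show ?case
    proof cases
      case 1
      then have "partials (i # is) (tensor \<alpha> \<beta>) = tensor a' b"
        using split pp(1) by simp
      then show ?thesis using a' ab by blast
    next
      case 2
      then have "partials (i # is) (tensor \<alpha> \<beta>) = tensor a b'"
        using split pp(2) by simp
      then show ?thesis using b' ab by blast
    qed
  qed (use assms in auto)
  show ?thesis unfolding smooth_def
  proof (intro allI impI)
    fix "is" :: "(real \<times> real) list" assume "set is \<subseteq> Basis"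
    from form[OF this] obtain a b where ab: "smooth_real a" "smooth_real b"
      "partials is (tensor \<alpha> \<beta>) = tensor a b" by blast
    obtain a' b' where "\<And>x. (a has_real_derivative a' x) (at x)" "\<And>x. (b has_real_derivative b' x) (at x)"
      using ab(1,2)[THEN smooth_real_derivative] by metis
    note d = product_has_derivative[of a a' b b', OF this]
    show "partials is (tensor \<alpha> \<beta>) differentiable_on UNIV"
      unfolding ab(3) differentiable_on_def
      using d differentiableI by blast
  qed
qed

lemma test_function_product:
  assumes "smooth_real \<alpha>" "\<And>x. x \<notin> {a..b} \<Longrightarrow> \<alpha> x = 0" "0 < a" "b < L"
    and "smooth_real \<beta>" "\<And>y. y \<notin> {c..d} \<Longrightarrow> \<beta> y = 0" "- l < c" "d < l"
  shows "tensor \<alpha> \<beta> \<in> test_functions (plate L l)"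
proof -
  have "compact ({a..b} \<times> {c..d})" by (intro compact_Times) auto
  moreover have "{a..b} \<times> {c..d} \<subseteq> plate L l" using assms by (auto simp: plate_def)
  moreover have "\<forall>p. p \<notin> {a..b} \<times> {c..d} \<longrightarrow> (tensor \<alpha> \<beta> p) = 0"
    using assms(2,6) by auto
  ultimately show ?thesis
    unfolding test_functions_def using smooth_product[OF assms(1,5)] by blast
qed

section \<open>Absolutely continuous functions\<close>

lemma borel_rep_subset:
  assumes "borel_rep S g r" "T \<subseteq> S" "T \<in> sets borel" "S \<in> sets borel"
  shows "borel_rep T g (\<lambda>x. indicator T x * r x)"
proof -
  have "AE x in lebesgue. x \<in> S \<longrightarrow> g x = r x"
    using assms by (auto simp: borel_rep_def AE_restrict_space_iff)
  then have "AE x in lebesgue_on T. g x = indicator T x * r x"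
    using assms by (subst AE_restrict_space_iff) (auto elim!: AE_mp)
  moreover have "(\<lambda>x. indicator T x * r x) \<in> borel_measurable borel"
    using assms by (intro borel_measurable_times borel_measurable_indicator) (auto simp: borel_rep_def)
  ultimately show ?thesis by (auto simp: borel_rep_def)
qed

lemma borel_rep_integrable_L2:
  assumes r: "borel_rep S g r" and S: "S \<in> sets borel" "bounded S" and g: "g \<in> L2 S"
  shows "integrable lborel r"
  using assms emeasure_bounded_finite borel_rep_L2[OF r S(1)]
  by (intro integrable_of_square[of r S]) (auto simp: borel_rep_def)

lemma continuous_on_compact_rep:
  fixes h :: "'a::euclidean_space \<Rightarrow> real"
  assumes T: "compact T" "S \<subseteq> T" "S \<in> sets borel" and h: "continuous_on T h"
  shows "borel_rep S h (\<lambda>x. indicator S x * h x)"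
    and "integrable lborel (\<lambda>x. indicator S x * h x)"
    and "h \<in> L2 S"
proof -
  have hS: "continuous_on S h" using h T(2) by (rule continuous_on_subset)
  have m: "(\<lambda>x. indicator S x * h x) \<in> borel_measurable borel"
    using borel_measurable_continuous_on_indicator[OF T(3) hS] by simp
  show r: "borel_rep S h (\<lambda>x. indicator S x * h x)" using borel_rep_self[OF T(3) m] .
  have i: "integrable lborel (\<lambda>x. indicator T x *\<^sub>R h x)"
    "integrable lborel (\<lambda>x. indicator T x *\<^sub>R (h x)\<^sup>2)"
    using borel_integrable_compact[OF T(1) h]
      borel_integrable_compact[OF T(1) continuous_on_power[OF h, of 2]] by simp_all
  show "integrable lborel (\<lambda>x. indicator S x * h x)"
    by (rule Bochner_Integration.integrable_bound[OF i(1)])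
      (use m T(2) in \<open>auto split: split_indicator\<close>)
  have "integrable lborel (\<lambda>x. (indicator S x * h x)\<^sup>2)"
    by (rule Bochner_Integration.integrable_bound[OF i(2)])
      (use m T(2) in \<open>auto split: split_indicator\<close>)
  then show "h \<in> L2 S" using borel_rep_L2[OF r T(3)] by simp
qed

lemma fubini_plane:
  assumes "integrable lborel (F :: real \<times> real \<Rightarrow> real)"
  shows "(\<integral>p. F p \<partial>lborel) = (\<integral>x. (\<integral>y. F (x, y) \<partial>lborel) \<partial>lborel)"
    and "(\<integral>p. F p \<partial>lborel) = (\<integral>y. (\<integral>x. F (x, y) \<partial>lborel) \<partial>lborel)"
    and "integrable lborel (\<lambda>x. \<integral>y. F (x, y) \<partial>lborel)"
proof -
  have i: "integrable (lborel \<Otimes>\<^sub>M lborel) F" using assms by (simp add: lborel_prod)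
  show 1: "(\<integral>p. F p \<partial>lborel) = (\<integral>x. (\<integral>y. F (x, y) \<partial>lborel) \<partial>lborel)"
    using lborel_pair.integral_fst'[OF i] by (simp add: lborel_prod)
  show "(\<integral>p. F p \<partial>lborel) = (\<integral>y. (\<integral>x. F (x, y) \<partial>lborel) \<partial>lborel)"
    using lborel_pair.Fubini_integral[of "\<lambda>x y. F (x, y)"] i 1 by simp
  show "integrable lborel (\<lambda>x. \<integral>y. F (x, y) \<partial>lborel)"
    using lborel_pair.integrable_fst'[OF i] .
qed

text \<open>The fundamental theorem of calculus is required, not a derivative at each point: this is what is known
of the third derivative of the beam deflection, whose derivative is only in \<open>L\<^sup>2\<close>.\<close>

definition absolutely_continuous_L2 :: "real \<Rightarrow> real \<Rightarrow> (real \<Rightarrow> real) \<Rightarrow> (real \<Rightarrow> real) \<Rightarrow> bool" where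
  "absolutely_continuous_L2 a b A A' \<longleftrightarrow> A' \<in> L2 {a<..<b} \<and>
     (\<forall>x\<in>{a..b}. A x = A a + (\<integral>t. A' t \<partial>lebesgue_on {a<..<x}))"

lemma absolutely_continuous_L2_rep:
  assumes ac: "absolutely_continuous_L2 a b A A'" and r: "borel_rep {a<..<b} A' r" and x: "x \<in> {a..b}"
  shows "A x = A a + (\<integral>t. indicator {..<x} t * r t \<partial>lborel)"
proof -
  have "borel_rep {a<..<x} A' (\<lambda>t. indicator {a<..<x} t * r t)"
    using x by (intro borel_rep_subset[OF r]) auto
  from borel_rep_integral(2)[OF this]
  have "(\<integral>t. A' t \<partial>lebesgue_on {a<..<x}) = (\<integral>t. indicator {a<..<x} t * r t \<partial>lborel)" by simp
  also have "(\<lambda>t. indicator {a<..<x} t * r t) = (\<lambda>t. indicator {..<x} t * r t)"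
  proof
    fix t show "indicator {a<..<x} t * r t = indicator {..<x} t * r t"
    proof (cases "a < t")
      case False
      then have "r t = 0" using r by (simp add: borel_rep_def)
      then show ?thesis by simp
    qed (simp add: indicator_def)
  qed
  finally show ?thesis using ac x unfolding absolutely_continuous_L2_def by metis
qed

lemma absolutely_continuous_L2_continuous:
  assumes ac: "absolutely_continuous_L2 a b A A'"
  shows "continuous_on {a..b} A"
proof -
  have A': "A' \<in> L2 {a<..<b}" using ac unfolding absolutely_continuous_L2_def by blast
  obtain r where r: "borel_rep {a<..<b} A' r"
    by (rule borel_rep_exists[OF L2_D(1)[OF A']]) simp_all
  have r0: "r t = 0" if "\<not> a < t" for t using r that by (simp add: borel_rep_def)
  have [measurable]: "r \<in> borel_measurable borel" using r by (simp add: borel_rep_def)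
  have int: "integrable lborel r"
    using borel_rep_integrable_L2[OF r _ _ A'] by simp
  have "set_integrable lborel {a..b} r"
    using int unfolding set_integrable_def by (intro integrable_mult_indicator) auto
  then have "r integrable_on {a..b}" by (rule set_borel_integral_eq_integral)
  then have "continuous_on {a..b} (\<lambda>x. A a + integral {a..x} r)"
    by (intro continuous_on_add continuous_on_const indefinite_integral_continuous_1)
  moreover have "A x = A a + integral {a..x} r" if x: "x \<in> {a..b}" for x
  proof -
    have si: "set_integrable lborel {a..x} r"
      using int unfolding set_integrable_def by (intro integrable_mult_indicator) auto
    have "(\<integral>t. indicator {..<x} t * r t \<partial>lborel) = (\<integral>t. indicator {a..x} t * r t \<partial>lborel)"
    proof (rule integral_cong_AE)
      show "AE t in lborel. indicator {..<x} t * r t = indicator {a..x} t * r t"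
        using AE_lborel_singleton[of x]
      proof eventually_elim
        case (elim t)
        then show ?case using r0[of t] by (cases "a < t") (auto simp: indicator_def)
      qed
    qed simp_all
    also have "\<dots> = integral {a..x} r"
      using set_borel_integral_eq_integral(2)[OF si] by (simp add: set_lebesgue_integral_def)
    finally show ?thesis using absolutely_continuous_L2_rep[OF ac r x] by simp
  qed
  ultimately show ?thesis by (metis (no_types, lifting) continuous_on_cong)
qed

lemma absolutely_continuous_L2_C1:
  assumes d: "\<And>x. x \<in> {a..b} \<Longrightarrow> (A has_real_derivative A' x) (at x within {a..b})"
    and c: "continuous_on {a..b} A'"
  shows "absolutely_continuous_L2 a b A A'"
proof -
  have "A' \<in> L2 {a<..<b}"
    by (rule continuous_on_compact_rep(3)[OF compact_Icc[of a b] _ _ c]) auto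
  moreover have "A x = A a + (\<integral>t. A' t \<partial>lebesgue_on {a<..<x})" if x: "x \<in> {a..b}" for x
  proof -
    have c': "continuous_on {a..x} A'" using c x by (auto intro: continuous_on_subset)
    have r1: "borel_rep {a<..<x} A' (\<lambda>t. indicator {a<..<x} t * A' t)"
      by (rule continuous_on_compact_rep(1)[OF compact_Icc _ _ c']) auto
    have "(\<integral>t. A' t \<partial>lebesgue_on {a<..<x}) = (\<integral>t. indicator {a<..<x} t * A' t \<partial>lborel)"
      using borel_rep_integral(2)[OF r1] by simp
    also have "\<dots> = (\<integral>t. indicator {a..x} t * A' t \<partial>lborel)"
    proof (rule integral_cong_AE)
      show "(\<lambda>t. indicator {a<..<x} t * A' t) \<in> borel_measurable lborel"
        using r1 by (simp add: borel_rep_def)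
      show "(\<lambda>t. indicator {a..x} t * A' t) \<in> borel_measurable lborel"
        using borel_measurable_continuous_on_indicator[OF _ c'] by simp
      show "AE t in lborel. indicator {a<..<x} t * A' t = indicator {a..x} t * A' t"
        using AE_lborel_singleton[of x] AE_lborel_singleton[of a]
        by eventually_elim (auto split: split_indicator)
    qed
    also have "\<dots> = A x - A a"
    proof -
      have "(A has_real_derivative A' t) (at t within {a..x})" if "a \<le> t" "t \<le> x" for t
        using d[of t] x that by (auto intro: DERIV_subset)
      then show ?thesis
        using integral_FTC_atLeastAtMost[of a x A A'] x c'
        by (simp add: has_real_derivative_iff_has_vector_derivative)
    qed
    finally show ?thesis by simp
  qed
  ultimately show ?thesis unfolding absolutely_continuous_L2_def by blast
qed

lemma integral_FTC_open:
  fixes \<phi> :: "real \<Rightarrow> real"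
  assumes "\<And>x. (\<phi> has_real_derivative \<phi>' x) (at x)" "continuous_on UNIV \<phi>'" "a \<le> b"
  shows "(\<integral>x. indicator {a<..<b} x * \<phi>' x \<partial>lborel) = \<phi> b - \<phi> a"
    and "integrable lborel (\<lambda>x. indicator {a<..<b} x * \<phi>' x)"
proof -
  have c': "continuous_on {a..b} \<phi>'" using assms(2) by (rule continuous_on_subset) auto
  have m: "\<phi>' \<in> borel_measurable borel" using assms(2) by (rule borel_measurable_continuous_onI)
  have "(\<integral>x. indicator {a<..<b} x * \<phi>' x \<partial>lborel) = (\<integral>x. indicator {a..b} x * \<phi>' x \<partial>lborel)"
  proof (rule integral_cong_AE)
    show "AE t in lborel. indicator {a<..<b} t * \<phi>' t = indicator {a..b} t * \<phi>' t"
      using AE_lborel_singleton[of a] AE_lborel_singleton[of b]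
      by eventually_elim (auto split: split_indicator)
  qed (use m in auto)
  also have "\<dots> = \<phi> b - \<phi> a"
    using integral_FTC_atLeastAtMost[of a b \<phi> \<phi>'] assms c'
    by (auto simp: has_real_derivative_iff_has_vector_derivative[symmetric] intro: DERIV_subset)
  finally show "(\<integral>x. indicator {a<..<b} x * \<phi>' x \<partial>lborel) = \<phi> b - \<phi> a" .
  show "integrable lborel (\<lambda>x. indicator {a<..<b} x * \<phi>' x)"
    by (rule continuous_on_compact_rep(2)[OF compact_Icc _ _ c']) auto
qed

lemma continuous_bounded_Icc:
  fixes h :: "real \<Rightarrow> real"
  assumes "continuous_on {a..b} h"
  obtains M where "\<And>x. x \<in> {a..b} \<Longrightarrow> \<bar>h x\<bar> \<le> M"
proof -
  have "bounded (h ` {a..b})"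
    by (intro compact_imp_bounded compact_continuous_image assms compact_Icc)
  then obtain M where "\<forall>x\<in>{a..b}. \<bar>h x\<bar> \<le> M" by (auto simp: bounded_iff)
  then show thesis using that by blast
qed

lemma integrable_mult_bounded:
  assumes F: "integrable lborel F" and h: "h \<in> borel_measurable borel"
    and M: "\<And>x. F x \<noteq> 0 \<Longrightarrow> \<bar>h x\<bar> \<le> (M::real)"
  shows "integrable lborel (\<lambda>x. F x * h x)"
proof (rule Bochner_Integration.integrable_bound)
  show "integrable lborel (\<lambda>x. \<bar>M\<bar> * F x)" using F by simp
  show "(\<lambda>x. F x * h x) \<in> borel_measurable lborel"
    using borel_measurable_integrable[OF F] h by simp
  show "AE x in lborel. norm (F x * h x) \<le> norm (\<bar>M\<bar> * F x)"
  proof (rule AE_I2)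
    fix x
    have "\<bar>F x\<bar> * \<bar>h x\<bar> \<le> \<bar>F x\<bar> * \<bar>M\<bar>" if "F x \<noteq> 0"
      using M[OF that] by (intro mult_left_mono) auto
    then show "norm (F x * h x) \<le> norm (\<bar>M\<bar> * F x)"
      by (cases "F x = 0") (simp_all add: abs_mult mult.commute)
  qed
qed

lemma integrable_mult_continuous:
  fixes r \<phi> :: "real \<Rightarrow> real"
  assumes ri: "integrable lborel r" and r0: "\<And>x. x \<notin> {a<..<b} \<Longrightarrow> r x = 0"
    and \<phi>: "continuous_on UNIV \<phi>"
  shows "integrable lborel (\<lambda>t. r t * \<phi> t)"
proof -
  obtain M where M: "\<And>x. x \<in> {a..b} \<Longrightarrow> \<bar>\<phi> x\<bar> \<le> M"
    by (rule continuous_bounded_Icc[where a = a and b = b, OF continuous_on_subset[OF \<phi> subset_UNIV]]) (rule that)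
  show ?thesis
  proof (rule integrable_mult_bounded[OF ri borel_measurable_continuous_onI[OF \<phi>]])
    fix x assume "r x \<noteq> 0"
    then have "x \<in> {a<..<b}" using r0 by blast
    then show "\<bar>\<phi> x\<bar> \<le> M" by (intro M) simp
  qed
qed

text \<open>Write \<open>A\<close> as the integral of its derivative and exchange the order of integration over the triangle
\<open>t < x\<close>.\<close>

lemma integration_by_parts_L2:
  assumes ac: "absolutely_continuous_L2 a b A A'" and r: "borel_rep {a<..<b} A' r" and ab: "a \<le> b"
    and \<phi>: "\<And>x. (\<phi> has_real_derivative \<phi>' x) (at x)" and c: "continuous_on UNIV \<phi>'"
  shows "(\<integral>x. indicator {a<..<b} x * A x * \<phi>' x \<partial>lborel) =
    A b * \<phi> b - A a * \<phi> a - (\<integral>x. r x * \<phi> x \<partial>lborel)"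
proof -
  have A': "A' \<in> L2 {a<..<b}" using ac unfolding absolutely_continuous_L2_def by blast
  have rm[measurable]: "r \<in> borel_measurable borel" and r0: "\<And>x. x \<notin> {a<..<b} \<Longrightarrow> r x = 0"
    using r by (auto simp: borel_rep_def)
  have ri: "integrable lborel r"
    using borel_rep_integrable_L2[OF r _ _ A'] by simp
  define e where "e x = indicator {a<..<b} x * \<phi>' x" for x
  have ei: "integrable lborel e"
    using integral_FTC_open(2)[OF \<phi> c ab] by (simp add: e_def[abs_def])
  define F where "F = (\<lambda>p. indicator {p. snd p < fst p} p *\<^sub>R (tensor e r p))"
  have Fi: "integrable lborel F"
    unfolding F_def
  proof (rule integrable_mult_indicator[OF _ product_integrable[OF ei ri]])
    have "open {p::real\<times>real. snd p < fst p}" by (intro open_Collect_less continuous_intros)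
    then show "{p::real\<times>real. snd p < fst p} \<in> sets lborel" by simp
  qed
  have 1: "(\<integral>t. F (x, t) \<partial>lborel) = e x * (A x - A a)" for x
  proof (cases "x \<in> {a<..<b}")
    case True
    have "(\<lambda>t. F (x, t)) = (\<lambda>t. e x * (indicator {..<x} t * r t))"
      by (auto simp: F_def split: split_indicator)
    then show ?thesis using absolutely_continuous_L2_rep[OF ac r, of x] True by simp
  next
    case False then show ?thesis by (simp add: F_def e_def)
  qed
  have 2: "(\<integral>x. F (x, t) \<partial>lborel) = r t * (\<phi> b - \<phi> t)" for t
  proof (cases "t \<in> {a<..<b}")
    case True
    then have "(\<lambda>x. F (x, t)) = (\<lambda>x. r t * (indicator {t<..<b} x * \<phi>' x))"
      by (auto simp: F_def e_def split: split_indicator)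
    then show ?thesis using integral_FTC_open(1)[OF \<phi> c, of t b] True by simp
  next
    case False then show ?thesis using r0 by (simp add: F_def)
  qed
  have "(\<integral>x. e x * (A x - A a) \<partial>lborel) = (\<integral>t. r t * (\<phi> b - \<phi> t) \<partial>lborel)"
    using fubini_plane(1,2)[OF Fi] by (simp add: 1 2)
  moreover have "integrable lborel (\<lambda>x. e x * (A x - A a))"
    using fubini_plane(3)[OF Fi] by (simp add: 1)
  then have "integrable lborel (\<lambda>x. e x * (A x - A a) + e x * A a)"
    using ei by simp
  then have "(\<integral>x. e x * A x \<partial>lborel) = (\<integral>x. e x * (A x - A a) \<partial>lborel) + (\<integral>x. e x * A a \<partial>lborel)"
    using \<open>integrable lborel (\<lambda>x. e x * (A x - A a))\<close> ei
    by (subst Bochner_Integration.integral_add[symmetric]) (auto simp: algebra_simps)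
  moreover have "(\<integral>x. e x * A a \<partial>lborel) = (\<phi> b - \<phi> a) * A a"
    using integral_FTC_open(1)[OF \<phi> c ab] by (simp add: e_def[abs_def])
  moreover have "(\<integral>t. r t * (\<phi> b - \<phi> t) \<partial>lborel) = (A b - A a) * \<phi> b - (\<integral>t. r t * \<phi> t \<partial>lborel)"
  proof -
    have i: "integrable lborel (\<lambda>t. r t * \<phi> t)"
      using \<phi> r0 by (intro integrable_mult_continuous[OF ri, of a b]) (auto intro: DERIV_continuous_on)
    have "(\<lambda>t. indicator {..<b} t * r t) = r" using r0 by (force split: split_indicator)
    then have "(\<integral>t. r t \<partial>lborel) = A b - A a"
      using absolutely_continuous_L2_rep[OF ac r, of b] ab by simp
    then have "(\<integral>t. \<phi> b * r t - r t * \<phi> t \<partial>lborel) = (A b - A a) * \<phi> b - (\<integral>t. r t * \<phi> t \<partial>lborel)"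
      using ri i by simp
    then show ?thesis by (simp add: algebra_simps)
  qed
  ultimately have "(\<integral>x. e x * A x \<partial>lborel) = A b * \<phi> b - A a * \<phi> a - (\<integral>x. r x * \<phi> x \<partial>lborel)"
    by (simp add: algebra_simps)
  then show ?thesis by (simp add: e_def[abs_def] mult_ac)
qed

section \<open>Products of functions of one variable on the plate\<close>

lemma plate_borel [simp]: "plate L l \<in> sets borel"
  unfolding plate_def by (intro borel_open open_Times) auto

lemma bounded_plate: "bounded (plate L l)"
  unfolding plate_def by (intro bounded_Times) auto

lemma closure_plate: "L > 0 \<Longrightarrow> l > 0 \<Longrightarrow> closure (plate L l) = {0..L} \<times> {-l..l}"
  unfolding plate_def by (simp add: closure_Times)

lemma plate_indicator:
  "indicator (plate L l) (x, y) = (indicator {0<..<L} x * indicator {-l<..<l} y :: real)"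
  by (simp add: plate_def indicator_def)

text \<open>A null set on the line is the base of a null strip in the plane.\<close>

lemma AE_lborel_coordinates:
  assumes "AE x in lborel. P (x::real)"
  shows "AE p in (lborel :: (real \<times> real) measure). P (fst p)" (is ?f)
    and "AE p in (lborel :: (real \<times> real) measure). P (snd p)" (is ?s)
proof -
  obtain N where N: "N \<in> null_sets lborel" "{x \<in> space lborel. \<not> P x} \<subseteq> N"
    using assms by (rule AE_E3) auto
  have "emeasure (lborel \<Otimes>\<^sub>M lborel) (N \<times> (UNIV :: real set)) = emeasure lborel N * emeasure lborel (UNIV :: real set)"
    "emeasure (lborel \<Otimes>\<^sub>M lborel) ((UNIV :: real set) \<times> N) = emeasure lborel (UNIV :: real set) * emeasure lborel N"
    by (rule lborel.emeasure_pair_measure_Times; use N in auto)+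
  then have "N \<times> UNIV \<in> null_sets (lborel :: (real \<times> real) measure)"
    "UNIV \<times> N \<in> null_sets (lborel :: (real \<times> real) measure)"
    using N by (auto simp: null_sets_def lborel_prod[symmetric] intro!: pair_measureI)
  note n = this
  show ?f by (rule AE_I'[OF n(1)]) (use N(2) in auto)
  show ?s by (rule AE_I'[OF n(2)]) (use N(2) in auto)
qed

lemma plate_product_rep:
  assumes r: "borel_rep {0<..<L} f r" and s: "borel_rep {-l<..<l} g s"
  shows "borel_rep (plate L l) (tensor f g) (tensor r s)"
proof -
  have "AE x in lborel. x \<in> {0<..<L} \<longrightarrow> f x = r x" "AE y in lborel. y \<in> {-l<..<l} \<longrightarrow> g y = s y"
    using r s by (auto simp: borel_rep_def AE_restrict_space_iff AE_completion_iff)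
  then have "AE p in lborel. p \<in> plate L l \<longrightarrow> (tensor f g p) = tensor r s p"
    using AE_lborel_coordinates(1)[of "\<lambda>x. x \<in> {0<..<L} \<longrightarrow> f x = r x"]
      AE_lborel_coordinates(2)[of "\<lambda>y. y \<in> {-l<..<l} \<longrightarrow> g y = s y"]
    by (auto simp: plate_def elim!: AE_mp)
  then have "AE p in lebesgue_on (plate L l). tensor f g p = tensor r s p"
    by (subst AE_restrict_space_iff) (simp_all add: AE_completion_iff)
  moreover have "tensor r s \<in> borel_measurable borel"
  proof -
    have [measurable]: "r \<in> borel_measurable borel" "s \<in> borel_measurable borel"
      using r s by (auto simp: borel_rep_def)
    have "tensor r s \<in> borel_measurable (borel \<Otimes>\<^sub>M borel)" by measurable
    then show ?thesis by (simp add: borel_prod)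
  qed
  moreover have "r x * s y = 0" if "(x, y) \<notin> plate L l" for x y
    using r s that by (auto simp: borel_rep_def plate_def)
  ultimately show ?thesis
    unfolding borel_rep_def by auto
qed

lemma L2_product_plate:
  assumes "f \<in> L2 {0<..<L}" "g \<in> L2 {-l<..<l}"
  shows "tensor f g \<in> L2 (plate L l)"
proof -
  obtain r where r: "borel_rep {0<..<L} f r"
    by (rule borel_rep_exists[OF L2_D(1)[OF assms(1)]]) simp_all
  obtain s where s: "borel_rep {-l<..<l} g s"
    by (rule borel_rep_exists[OF L2_D(1)[OF assms(2)]]) simp_all
  have "integrable lborel (\<lambda>(x, y). (r x)\<^sup>2 * (s y)\<^sup>2)"
    using borel_rep_L2[OF r] borel_rep_L2[OF s] assms by (intro product_integrable) simp_all
  then have "integrable lborel (\<lambda>p. (tensor r s p)\<^sup>2)"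
    by (simp add: case_prod_unfold power_mult_distrib)
  then show ?thesis using borel_rep_L2[OF plate_product_rep[OF r s]] by simp
qed

lemma test_functions_bounded:
  assumes "\<phi> \<in> test_functions S"
  obtains M where "\<And>x. \<bar>\<phi> x\<bar> \<le> M"
proof -
  obtain C where C: "compact C" "\<And>x. x \<notin> C \<Longrightarrow> \<phi> x = 0"
    using assms by (auto simp: test_functions_def)
  have "bounded (\<phi> ` C)"
    using C(1) test_functions_continuous[OF assms]
    by (intro compact_imp_bounded compact_continuous_image)
  then obtain M where M: "\<forall>x\<in>C. \<bar>\<phi> x\<bar> \<le> M" by (auto simp: bounded_iff)
  have "\<bar>\<phi> x\<bar> \<le> max M 0" for x
    using M C(2)[of x] by (cases "x \<in> C") force+
  then show ?thesis using that by blast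
qed

lemma test_function_slices:
  assumes "\<phi> \<in> test_functions S"
  shows "((\<lambda>t. \<phi> (t, y)) has_real_derivative partials [(1, 0)] \<phi> (x, y)) (at x)" (is ?dx)
    "continuous_on UNIV (\<lambda>x. partials [(1, 0)] \<phi> (x, y))" (is ?cx)
    "((\<lambda>t. \<phi> (x, t)) has_real_derivative partials [(0, 1)] \<phi> (x, y)) (at y)" (is ?dy)
    "continuous_on UNIV (\<lambda>y. partials [(0, 1)] \<phi> (x, y))" (is ?cy)
proof -
  show ?dx
    ?dy
    using partial_derivative_1 partial_derivative_2 test_functions_differentiable[OF assms] by blast+
  have "partials [(1, 0)] \<phi> \<in> test_functions S" "partials [(0, 1)] \<phi> \<in> test_functions S"
    using assms by (auto intro!: test_functions_partials simp: Basis_plane)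
  note c = this[THEN test_functions_continuous]
  show ?cx
    ?cy
    by (rule continuous_on_compose2[OF c(1)[of UNIV]] continuous_on_compose2[OF c(2)[of UNIV]];
        auto intro!: continuous_intros)+
qed

lemma test_function_zero_outside: "\<phi> \<in> test_functions S \<Longrightarrow> p \<notin> S \<Longrightarrow> \<phi> p = 0"
  by (auto simp: test_functions_def)

lemma L2_continuous_Icc:
  fixes h :: "real \<Rightarrow> real"
  assumes "continuous_on {a..b} h" shows "h \<in> L2 {a<..<b}"
  by (rule continuous_on_compact_rep(3)[OF compact_Icc _ _ assms]) auto

lemma product_test_integral:
  assumes "f \<in> L2 {0<..<L}" "g \<in> L2 {-l<..<l}" "borel_rep {0<..<L} f a" "borel_rep {-l<..<l} g b"
    and \<phi>: "\<phi> \<in> test_functions S"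
  shows "(\<integral>p. tensor f g p * \<phi> p \<partial>lebesgue_on (plate L l)) =
      (\<integral>x. (\<integral>y. a x * b y * \<phi> (x, y) \<partial>lborel) \<partial>lborel)" (is "?I = _")
    and "(\<integral>p. tensor f g p * \<phi> p \<partial>lebesgue_on (plate L l)) =
      (\<integral>y. (\<integral>x. a x * b y * \<phi> (x, y) \<partial>lborel) \<partial>lborel)"
proof -
  have ab: "integrable lborel a" "integrable lborel b"
    using borel_rep_integrable_L2[OF assms(3) _ _ assms(1)] borel_rep_integrable_L2[OF assms(4) _ _ assms(2)]
    by simp_all
  obtain M where "\<And>p. \<bar>\<phi> p\<bar> \<le> M" using test_functions_bounded[OF \<phi>] by blast
  then have i: "integrable lborel (\<lambda>p. tensor a b p * \<phi> p)"
    by (intro integrable_mult_bounded[OF product_integrable[OF ab] test_functions_borel[OF \<phi>]])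
  have "?I = (\<integral>p. tensor a b p * \<phi> p \<partial>lborel)"
    by (rule borel_rep_integral(2)[OF borel_rep_mult_borel[OF plate_product_rep[OF assms(3,4)]
          test_functions_borel[OF \<phi>]] plate_borel])
  then show "?I = (\<integral>x. (\<integral>y. a x * b y * \<phi> (x, y) \<partial>lborel) \<partial>lborel)"
    "?I = (\<integral>y. (\<integral>x. a x * b y * \<phi> (x, y) \<partial>lborel) \<partial>lborel)"
    using fubini_plane(1,2)[OF i] by simp_all
qed

text \<open>Integrate by parts on each line parallel to the first axis; test functions vanish at both ends of it.\<close>

lemma weak_deriv_product_1:
  assumes ac: "absolutely_continuous_L2 0 L A A'" and B: "continuous_on {-l..l} B" and pos: "L > 0"
  shows "has_L2_weak_deriv (plate L l) [(1, 0)] (tensor A B) (tensor A' B)"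
  unfolding has_L2_weak_deriv_def
proof (intro conjI ballI)
  have A': "A' \<in> L2 {0<..<L}" using ac unfolding absolutely_continuous_L2_def by blast
  have A: "continuous_on {0..L} A" using absolutely_continuous_L2_continuous[OF ac] .
  show "tensor A' B \<in> L2 (plate L l)"
    by (rule L2_product_plate[OF A' L2_continuous_Icc[OF B]])
  fix \<phi> assume \<phi>: "\<phi> \<in> test_functions (plate L l)"
  let ?d = "partials [(1, 0)] \<phi>"
  have d: "?d \<in> test_functions (plate L l)" using \<phi> by (intro test_functions_partials) (auto simp: Basis_plane)
  obtain r where r: "borel_rep {0<..<L} A' r"
    by (rule borel_rep_exists[OF L2_D(1)[OF A']]) simp_all
  define b where "b y = indicator {-l<..<l} y * B y" for y
  define a where "a x = indicator {0<..<L} x * A x" for x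
  have b: "borel_rep {-l<..<l} B b" and a: "borel_rep {0<..<L} A a"
    unfolding b_def[abs_def] a_def[abs_def]
    by (rule continuous_on_compact_rep(1)[OF compact_Icc _ _ B] continuous_on_compact_rep(1)[OF compact_Icc _ _ A];
        auto)+
  have inner: "(\<integral>x. a x * b y * ?d (x, y) \<partial>lborel) = - (\<integral>x. r x * b y * \<phi> (x, y) \<partial>lborel)" for y
  proof -
    have "(\<integral>x. a x * ?d (x, y) \<partial>lborel) =
        A L * \<phi> (L, y) - A 0 * \<phi> (0, y) - (\<integral>x. r x * \<phi> (x, y) \<partial>lborel)"
      unfolding a_def using pos
      by (intro integration_by_parts_L2[OF ac r _ test_function_slices(1,2)[OF \<phi>]]) simp
    moreover have "\<phi> (L, y) = 0" "\<phi> (0, y) = 0"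
      using test_function_zero_outside[OF \<phi>] by (auto simp: plate_def)
    ultimately have *: "(\<integral>x. a x * ?d (x, y) \<partial>lborel) = - (\<integral>x. r x * \<phi> (x, y) \<partial>lborel)" by simp
    have "(\<lambda>x. a x * b y * ?d (x, y)) = (\<lambda>x. b y * (a x * ?d (x, y)))"
      "(\<lambda>x. r x * b y * \<phi> (x, y)) = (\<lambda>x. b y * (r x * \<phi> (x, y)))" by (auto simp: mult_ac)
    then show ?thesis using * by simp
  qed
  show "(\<integral>p. tensor A B p * ?d p \<partial>lebesgue_on (plate L l)) =
      (- 1) ^ length [(1, 0) :: real \<times> real] *
      (\<integral>p. tensor A' B p * \<phi> p \<partial>lebesgue_on (plate L l))"
    unfolding product_test_integral(2)[OF L2_continuous_Icc[OF A] L2_continuous_Icc[OF B] a b d]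
      product_test_integral(2)[OF A' L2_continuous_Icc[OF B] r b \<phi>] inner by simp
qed

lemma weak_deriv_product_2:
  assumes A: "continuous_on {0..L} A" and ac: "absolutely_continuous_L2 (-l) l B B'" and pos: "l > 0"
  shows "has_L2_weak_deriv (plate L l) [(0, 1)] (tensor A B) (tensor A B')"
  unfolding has_L2_weak_deriv_def
proof (intro conjI ballI)
  have B': "B' \<in> L2 {-l<..<l}" using ac unfolding absolutely_continuous_L2_def by blast
  have B: "continuous_on {-l..l} B" using absolutely_continuous_L2_continuous[OF ac] .
  show "tensor A B' \<in> L2 (plate L l)"
    by (rule L2_product_plate[OF L2_continuous_Icc[OF A] B'])
  fix \<phi> assume \<phi>: "\<phi> \<in> test_functions (plate L l)"
  let ?d = "partials [(0, 1)] \<phi>"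
  have d: "?d \<in> test_functions (plate L l)" using \<phi> by (intro test_functions_partials) (auto simp: Basis_plane)
  obtain r where r: "borel_rep {-l<..<l} B' r"
    by (rule borel_rep_exists[OF L2_D(1)[OF B']]) simp_all
  define b where "b y = indicator {-l<..<l} y * B y" for y
  define a where "a x = indicator {0<..<L} x * A x" for x
  have b: "borel_rep {-l<..<l} B b" and a: "borel_rep {0<..<L} A a"
    unfolding b_def[abs_def] a_def[abs_def]
    by (rule continuous_on_compact_rep(1)[OF compact_Icc _ _ B] continuous_on_compact_rep(1)[OF compact_Icc _ _ A];
        auto)+
  have inner: "(\<integral>y. a x * b y * ?d (x, y) \<partial>lborel) = - (\<integral>y. a x * r y * \<phi> (x, y) \<partial>lborel)" for x
  proof -
    have "(\<integral>y. b y * ?d (x, y) \<partial>lborel) =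
        B l * \<phi> (x, l) - B (-l) * \<phi> (x, -l) - (\<integral>y. r y * \<phi> (x, y) \<partial>lborel)"
      unfolding b_def using pos
      by (intro integration_by_parts_L2[OF ac r _ test_function_slices(3,4)[OF \<phi>]]) simp
    moreover have "\<phi> (x, l) = 0" "\<phi> (x, -l) = 0"
      using test_function_zero_outside[OF \<phi>] by (auto simp: plate_def)
    ultimately have *: "(\<integral>y. b y * ?d (x, y) \<partial>lborel) = - (\<integral>y. r y * \<phi> (x, y) \<partial>lborel)" by simp
    then show ?thesis by (simp add: mult.assoc)
  qed
  show "(\<integral>p. tensor A B p * ?d p \<partial>lebesgue_on (plate L l)) =
      (- 1) ^ length [(0, 1) :: real \<times> real] *
      (\<integral>p. tensor A B' p * \<phi> p \<partial>lebesgue_on (plate L l))"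
    unfolding product_test_integral(1)[OF L2_continuous_Icc[OF A] L2_continuous_Icc[OF B] a b d]
      product_test_integral(1)[OF L2_continuous_Icc[OF A] B' a r \<phi>] inner by simp
qed

section \<open>The Green function of the hinged interval\<close>

text \<open>The Green function of \<open>- d\<^sup>2/dx\<^sup>2\<close> on \<open>(0, L)\<close> with zero boundary values, usually written
\<open>min t s * (L - max t s) / L\<close>. In this form it is Taylor's formula at the left end with the slope there
eliminated by the condition at the right end.\<close>

definition green :: "real \<Rightarrow> real \<Rightarrow> real \<Rightarrow> real" where
  "green L t s = t * (L - s) / L - max 0 (t - s)"

lemma green_symmetric: "L \<noteq> 0 \<Longrightarrow> green L t s = green L s t"
  by (auto simp: green_def max_def field_simps)

lemma green_bound:
  assumes "t \<in> {0..L}" "s \<in> {0..L}" "L > 0"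
  shows "\<bar>green L t s\<bar> \<le> L"
proof -
  have "t * (L - s) \<le> L * L" using assms by (intro mult_mono) auto
  then have "0 \<le> t * (L - s) / L" "t * (L - s) / L \<le> L" using assms by (auto simp: divide_le_eq)
  moreover have "0 \<le> max 0 (t - s)" "max 0 (t - s) \<le> L" using assms by auto
  ultimately show ?thesis by (simp add: green_def)
qed

lemma L2_subset:
  assumes "g \<in> L2 S" "T \<subseteq> S" "T \<in> sets borel" "S \<in> sets borel"
  shows "g \<in> L2 T"
proof -
  obtain r where r: "borel_rep S g r"
    by (rule borel_rep_exists[OF L2_D(1)[OF assms(1)] assms(4)])
  have "integrable lborel (\<lambda>x. indicator T x *\<^sub>R (r x)\<^sup>2)"
    using borel_rep_L2[OF r assms(4)] assms by (intro integrable_mult_indicator) simp_all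
  moreover have "(\<lambda>x. indicator T x *\<^sub>R (r x)\<^sup>2) = (\<lambda>x. (indicator T x * r x)\<^sup>2)"
    by (auto split: split_indicator)
  ultimately show ?thesis
    using borel_rep_L2[OF borel_rep_subset[OF r assms(2,3,4)] assms(3)] by simp
qed

lemma absolutely_continuous_L2_initial:
  assumes ac: "absolutely_continuous_L2 a b A A'" and x: "x \<in> {a..b}"
  shows "absolutely_continuous_L2 a x A A'"
proof -
  have A': "A' \<in> L2 {a<..<b}" using ac unfolding absolutely_continuous_L2_def by blast
  have "A' \<in> L2 {a<..<x}" using x by (intro L2_subset[OF A']) auto
  moreover have "{a..x} \<subseteq> {a..b}" using x by auto
  ultimately show ?thesis using ac unfolding absolutely_continuous_L2_def by blast
qed

text \<open>Taylor's formula with integral remainder, at \<open>t\<close> and at \<open>L\<close>; the latter determines \<open>A1 0\<close> in terms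
of the second derivative.\<close>

lemma green_representation_strong:
  assumes ac: "absolutely_continuous_L2 0 L A1 A2" and r: "borel_rep {0<..<L} A2 r"
    and d: "\<And>x. x \<in> {0..L} \<Longrightarrow> (A has_real_derivative A1 x) (at x within {0..L})"
    and bc: "A 0 = 0" "A L = 0" and L: "L > 0" and t: "t \<in> {0..L}"
  shows "A t = - (\<integral>s. green L t s * r s \<partial>lborel)"
proof -
  have A2: "A2 \<in> L2 {0<..<L}" using ac unfolding absolutely_continuous_L2_def by blast
  have A1: "continuous_on {0..L} A1" using absolutely_continuous_L2_continuous[OF ac] .
  have r0: "r x = 0" if "x \<notin> {0<..<L}" for x using r that by (simp add: borel_rep_def)
  have ri: "integrable lborel r" using borel_rep_integrable_L2[OF r _ _ A2] by simp
  have taylor: "A x = x * A1 0 + (\<integral>s. r s * max 0 (x - s) \<partial>lborel)" if x: "x \<in> {0..L}" for x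
  proof -
    have rx: "borel_rep {0<..<x} A2 (\<lambda>s. indicator {0<..<x} s * r s)"
      using x by (intro borel_rep_subset[OF r]) auto
    have "absolutely_continuous_L2 0 L A A1" by (rule absolutely_continuous_L2_C1[OF d A1])
    then have "A x = A 0 + (\<integral>s. A1 s \<partial>lebesgue_on {0<..<x})"
      using x unfolding absolutely_continuous_L2_def by blast
    also have "(\<integral>s. A1 s \<partial>lebesgue_on {0<..<x}) = (\<integral>s. indicator {0<..<x} s * A1 s \<partial>lborel)"
    proof (rule borel_rep_integral(2)[OF continuous_on_compact_rep(1)[OF compact_Icc]])
      show "continuous_on {0..x} A1" using A1 x by (auto intro: continuous_on_subset)
    qed auto
    also have "\<dots> = (\<integral>s. indicator {0<..<x} s * A1 s * 1 \<partial>lborel)" by simp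
    also have "\<dots> = A1 x * (x - x) - A1 0 * (0 - x) - (\<integral>s. indicator {0<..<x} s * r s * (s - x) \<partial>lborel)"
      using x by (intro integration_by_parts_L2[OF absolutely_continuous_L2_initial[OF ac x] rx])
        (auto intro!: derivative_eq_intros)
    also have "(\<integral>s. indicator {0<..<x} s * r s * (s - x) \<partial>lborel) = (\<integral>s. - (r s * max 0 (x - s)) \<partial>lborel)"
    proof (intro Bochner_Integration.integral_cong refl)
      fix s show "indicator {0<..<x} s * r s * (s - x) = - (r s * max 0 (x - s))"
        using r0[of s] by (cases "s \<in> {0<..<x}") (auto simp: max_def algebra_simps)
    qed
    finally show ?thesis using bc by simp
  qed
  have i1: "integrable lborel (\<lambda>s. r s * max 0 (x - s))" "integrable lborel (\<lambda>s. r s * (x - s))" for x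
    using r0 by (auto intro!: integrable_mult_continuous[OF ri, of 0 L] continuous_intros)
  have "(\<integral>s. r s * max 0 (L - s) \<partial>lborel) = (\<integral>s. r s * (L - s) \<partial>lborel)"
  proof (intro Bochner_Integration.integral_cong refl)
    fix s show "r s * max 0 (L - s) = r s * (L - s)"
      using r0[of s] by (cases "s < L") auto
  qed
  then have "A1 0 = - (1 / L) * (\<integral>s. r s * (L - s) \<partial>lborel)"
    using taylor[of L] bc L by (simp add: field_simps)
  then have "A t = - (t / L) * (\<integral>s. r s * (L - s) \<partial>lborel) + (\<integral>s. r s * max 0 (t - s) \<partial>lborel)"
    using taylor[OF t] by simp
  also have "\<dots> = (\<integral>s. - (t / L) * (r s * (L - s)) + r s * max 0 (t - s) \<partial>lborel)"
    using i1 by simp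
  also have "\<dots> = (\<integral>s. - (green L t s * r s) \<partial>lborel)"
    by (intro Bochner_Integration.integral_cong refl) (use L in \<open>simp add: green_def field_simps\<close>)
  finally show ?thesis by simp
qed

text \<open>The kernels are concentrated on \<open>S\<close> near \<open>p\<close>, and \<open>p\<close> may lie on the boundary of \<open>S\<close>: this is how the
boundary values enter when weak derivatives are tested with functions supported inside.\<close>

lemma approximate_identity:
  fixes w :: "'a::euclidean_space \<Rightarrow> real"
  assumes w: "continuous (at p within S) w" and m: "(\<lambda>x. indicator S x * w x) \<in> borel_measurable borel"
    and k: "\<And>n x. 0 \<le> k n x" "\<And>n. integrable lborel (k n)" "\<And>n. (\<integral>x. k n x \<partial>lborel) = 1"
    and supp: "\<And>n x. k n x \<noteq> 0 \<Longrightarrow> x \<in> S \<and> dist x p \<le> e n" and e: "e \<longlonglongrightarrow> 0"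
  shows "(\<lambda>n. \<integral>x. indicator S x * w x * k n x \<partial>lborel) \<longlonglongrightarrow> w p"
proof (rule tendstoI)
  fix \<eta> :: real assume \<eta>: "\<eta> > 0"
  obtain \<delta> where \<delta>: "\<delta> > 0" "\<And>x. x \<in> S \<Longrightarrow> dist x p < \<delta> \<Longrightarrow> dist (w x) (w p) < \<eta> / 2"
  proof -
    have "\<forall>\<epsilon>>0. \<exists>\<delta>>0. \<forall>x\<in>S. dist x p < \<delta> \<longrightarrow> dist (w x) (w p) < \<epsilon>"
      using w by (simp add: continuous_within_eps_delta)
    then show thesis using half_gt_zero[OF \<eta>] that by blast
  qed
  have "\<forall>\<^sub>F n in sequentially. e n < \<delta>" by (rule order_tendstoD(2)[OF e \<delta>(1)])
  then show "\<forall>\<^sub>F n in sequentially. dist (\<integral>x. indicator S x * w x * k n x \<partial>lborel) (w p) < \<eta>"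
  proof eventually_elim
    case (elim n)
    define D where "D x = indicator S x * w x * k n x - w p * k n x" for x
    have le: "\<bar>D x\<bar> \<le> \<eta> / 2 * k n x" for x
    proof (cases "k n x = 0")
      case False
      then have x: "x \<in> S" "dist x p < \<delta>" using supp[of n x] elim by auto
      have "D x = (w x - w p) * k n x" using x by (simp add: D_def algebra_simps)
      moreover have "\<bar>w x - w p\<bar> \<le> \<eta> / 2" using \<delta>(2)[OF x] by (simp add: dist_real_def)
      then have "\<bar>w x - w p\<bar> * k n x \<le> \<eta> / 2 * k n x" using k(1)[of n x] by (rule mult_right_mono)
      ultimately show ?thesis using k(1)[of n x] by (simp add: abs_mult)
    qed (simp add: D_def)
    have km: "k n \<in> borel_measurable borel" using borel_measurable_integrable[OF k(2)[of n]] by simp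
    have iD: "integrable lborel D"
    proof (rule Bochner_Integration.integrable_bound)
      show "integrable lborel (\<lambda>x. \<eta> / 2 * k n x)" using k(2) by simp
      show "D \<in> borel_measurable lborel" using m km unfolding D_def[abs_def] by simp
      show "AE x in lborel. norm (D x) \<le> norm (\<eta> / 2 * k n x)"
        using le k(1)[of n] \<eta> by (intro AE_I2) (simp add: abs_mult)
    qed
    have "(\<integral>x. indicator S x * w x * k n x \<partial>lborel) = (\<integral>x. D x + w p * k n x \<partial>lborel)"
      by (simp add: D_def)
    also have "\<dots> = (\<integral>x. D x \<partial>lborel) + w p" using iD k(2,3) by simp
    finally have "dist (\<integral>x. indicator S x * w x * k n x \<partial>lborel) (w p) = \<bar>\<integral>x. D x \<partial>lborel\<bar>"
      by (simp add: dist_real_def)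
    also have "\<dots> \<le> (\<integral>x. \<bar>D x\<bar> \<partial>lborel)" by (rule integral_abs_bound)
    also have "\<dots> \<le> (\<integral>x. \<eta> / 2 * k n x \<partial>lborel)"
      using iD k(2) le by (intro integral_mono) auto
    also have "\<dots> < \<eta>" using k(3) \<eta> by simp
    finally show ?case .
  qed
qed

lemma smoothed_step_family_integral:
  assumes fam: "smoothed_step_family K S R c" and e: "e > 0"
  shows "integrable lborel (K e p)" "(\<integral>t. K e p t \<partial>lborel) = 1"
proof -
  note fD = smoothed_step_family_D[OF fam e]
  have eq: "(\<lambda>t. indicator {p<..<p + e} t * K e p t) = K e p"
    using fD(7) by (force split: split_indicator)
  have "p \<le> p + e" using e by simp
  note F = integral_FTC_open[OF fD(4)[of p] smooth_real_continuous[OF fD(1)] this]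
  show "integrable lborel (K e p)" using F(2) by (simp only: eq)
  have "S e p (p + e) = 1" "S e p p = 0" by (rule fD(11), simp) (rule fD(10), simp)
  then show "(\<integral>t. K e p t \<partial>lborel) = 1" using F(1) by (simp add: eq)
qed

text \<open>As a function of \<open>s\<close>, \<open>green L x0\<close> is a tent with kinks at \<open>0\<close>, \<open>x0\<close> and \<open>L\<close>. It is approximated by test
functions: combinations of three smooth ramps, with the outer kinks moved into the interval. Their
second derivatives approximate point masses at the kinks, and as \<open>V\<close> vanishes at \<open>0\<close> and \<open>L\<close> only the
value at \<open>x0\<close> survives. This recovers point values of \<open>V\<close> from its weak second derivative.\<close>

lemma green_representation_weak:
  assumes L: "L > 0" and V: "continuous_on {0..L} V" "V 0 = 0" "V L = 0"
    and g: "integrable lborel g" "\<And>x. x \<notin> {0<..<L} \<Longrightarrow> g x = 0"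
    and weak: "\<And>\<alpha> \<alpha>1 \<alpha>2 a b. smooth_real \<alpha> \<Longrightarrow> (\<And>x. (\<alpha> has_real_derivative \<alpha>1 x) (at x)) \<Longrightarrow>
       (\<And>x. (\<alpha>1 has_real_derivative \<alpha>2 x) (at x)) \<Longrightarrow> 0 < a \<Longrightarrow> b < L \<Longrightarrow>
       (\<And>x. x \<notin> {a..b} \<Longrightarrow> \<alpha> x = 0) \<Longrightarrow>
       (\<integral>x. indicator {0<..<L} x * V x * \<alpha>2 x \<partial>lborel) = (\<integral>x. g x * \<alpha> x \<partial>lborel)"
    and x0: "x0 \<in> {0<..<L}"
  shows "V x0 = - (\<integral>s. green L x0 s * g s \<partial>lborel)"
proof -
  let ?V = "\<lambda>x. indicator {0<..<L} x * V x"
  obtain k h q c where fam: "smoothed_step_family k h q c"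
    by (rule smoothed_step_family_exists)
  \<comment> \<open>The width \<open>e n\<close> is at most a third of the distance from \<open>x0\<close> to the ends, which leaves room for the
    shifts of the outer kinks.\<close>
  define \<delta> where "\<delta> = min x0 (L - x0)"
  define e where "e n = \<delta> / (real n + 3)" for n
  have \<delta>: "\<delta> > 0" "\<delta> \<le> x0" "\<delta> \<le> L - x0" using x0 by (auto simp: \<delta>_def)
  have e: "e n > 0" "3 * e n \<le> \<delta>" for n using \<delta> by (auto simp: e_def field_simps)
  have e0: "e \<longlonglongrightarrow> 0" using tendsto_mult[OF tendsto_const[of \<delta>] LIMSEQ_ignore_initial_segment[OF lim_inverse_n, of 3]]
    by (simp add: e_def[abs_def] field_simps)
  \<comment> \<open>The left kink moves to \<open>e n\<close>. A ramp needs the length \<open>e n\<close> to become affine, so the right kink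
    moves by \<open>2 * e n\<close>: the support then ends before \<open>L\<close>.\<close>
  define b where "b n = L - 2 * e n" for n
  have b: "x0 < b n" "e n < x0" "b n + e n < L" "b n + e n = L - e n" for n
    using e[of n] \<delta> by (auto simp: b_def)
  have b0: "b \<longlonglongrightarrow> L" unfolding b_def using tendsto_diff[OF tendsto_const tendsto_mult[OF tendsto_const e0]] by force
  \<comment> \<open>The weights make total slope and total moment vanish to the right of the last kink.\<close>
  define c1 where "c1 n = (b n - x0) / (b n - e n)" for n
  define c2 where "c2 n = (x0 - e n) / (b n - e n)" for n
  have be: "b n - e n > 0" for n using b[of n] by simp
  have c12: "c1 n + c2 n = 1" "c1 n * e n + c2 n * b n = x0" "0 \<le> c1 n" "0 \<le> c2 n" for n
  proof -
    show "c1 n + c2 n = 1"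
      using be[of n] unfolding c1_def c2_def add_divide_distrib[symmetric] by simp
    have "c1 n * e n + c2 n * b n = ((b n - x0) * e n + (x0 - e n) * b n) / (b n - e n)"
      by (simp add: c1_def c2_def add_divide_distrib)
    also have "(b n - x0) * e n + (x0 - e n) * b n = x0 * (b n - e n)" by (simp add: algebra_simps)
    finally show "c1 n * e n + c2 n * b n = x0" using be[of n] by simp
    show "0 \<le> c1 n" "0 \<le> c2 n" using b[of n] be[of n] by (auto simp: c1_def c2_def)
  qed
  have c1_lim: "c1 \<longlonglongrightarrow> (L - x0) / (L - 0)" and c2_lim: "c2 \<longlonglongrightarrow> (x0 - 0) / (L - 0)"
    unfolding c1_def c2_def using L by (intro tendsto_divide tendsto_diff tendsto_const b0 e0; simp)+
  note fD = smoothed_step_family_D[OF fam e(1)]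
  define K where "K p n = k (e n) p" for p n
  define S where "S p n = h (e n) p" for p n
  define Q where "Q p n = q (e n) p" for p n
  have S': "(S p n has_real_derivative K p n t) (at t)" and Q': "(Q p n has_real_derivative S p n t) (at t)"
    and Qs: "smooth_real (Q p n)" and Ks: "smooth_real (K p n)"
    and Q0: "t \<le> p \<Longrightarrow> Q p n t = 0" and Q1: "p + e n \<le> t \<Longrightarrow> Q p n t = t - p - e n * c"
    and Qb: "\<bar>Q p n t - max 0 (t - p)\<bar> \<le> e n"
    and K_supp: "K p n t \<noteq> 0 \<Longrightarrow> p < t \<and> t < p + e n" and K0: "0 \<le> K p n t" for p n t
    unfolding K_def S_def Q_def by (fact fD)+
  define \<alpha> where "\<alpha> n t = c1 n * Q (e n) n t - Q x0 n t + c2 n * Q (b n) n t" for n t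
  define \<alpha>1 where "\<alpha>1 n t = c1 n * S (e n) n t - S x0 n t + c2 n * S (b n) n t" for n t
  define \<alpha>2 where "\<alpha>2 n t = c1 n * K (e n) n t - K x0 n t + c2 n * K (b n) n t" for n t
  have eq: "(\<integral>x. ?V x * \<alpha>2 n x \<partial>lborel) = (\<integral>x. g x * \<alpha> n x \<partial>lborel)" for n
  proof (rule weak)
    show "smooth_real (\<alpha> n)"
      unfolding \<alpha>_def[abs_def] by (intro smooth_real_add smooth_real_diff smooth_real_cmult Qs)
    show "(\<alpha> n has_real_derivative \<alpha>1 n x) (at x)" for x
      unfolding \<alpha>_def[abs_def] \<alpha>1_def by (intro DERIV_add DERIV_diff DERIV_cmult Q')
    show "(\<alpha>1 n has_real_derivative \<alpha>2 n x) (at x)" for x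
      unfolding \<alpha>1_def[abs_def] \<alpha>2_def by (intro DERIV_add DERIV_diff DERIV_cmult S')
    show "0 < e n" by (rule e(1))
    show "b n + e n < L" by (rule b(3))
    fix x assume "x \<notin> {e n..b n + e n}"
    then have "x < e n \<or> x > b n + e n" by auto
    then consider "x < e n" | "x > b n + e n" by blast
    then show "\<alpha> n x = 0"
    proof cases
      case 1
      then show ?thesis using b(1,2)[of n] by (simp add: \<alpha>_def Q0)
    next
      case 2
      then have "Q (e n) n x = x - e n - e n * c" "Q x0 n x = x - x0 - e n * c"
        "Q (b n) n x = x - b n - e n * c"
        using b(1,2)[of n] by (auto intro!: Q1)
      note Qx = this
      have "\<alpha> n x = (c1 n + c2 n) * (x - e n * c) - (x - e n * c) - (c1 n * e n + c2 n * b n) + x0"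
        unfolding \<alpha>_def Qx by (simp only: algebra_simps)
      also have "\<dots> = 0" unfolding c12(1) c12(2) by simp
      finally show ?thesis .
    qed
  qed
  have Vrep: "borel_rep {0<..<L} V (\<lambda>x. ?V x)"
    and Vi: "integrable lborel (\<lambda>x. ?V x)"
    by (rule continuous_on_compact_rep(1,2)[OF compact_Icc _ _ V(1)]; auto)+
  have Vm: "(\<lambda>x. ?V x) \<in> borel_measurable borel"
    using Vrep by (simp add: borel_rep_def)
  have Ki: "integrable lborel (K p n)" "(\<integral>t. K p n t \<partial>lborel) = 1" for p n
    unfolding K_def by (rule smoothed_step_family_integral[OF fam e(1)])+
  have lim: "(\<lambda>n. \<integral>x. ?V x * K (p n) n x \<partial>lborel) \<longlonglongrightarrow> V q"
    if p: "p \<longlonglongrightarrow> q" "q \<in> {0..L}" "\<And>n. 0 < p n" "\<And>n. p n + e n < L" for p q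
  proof (rule approximate_identity[where e = "\<lambda>n. \<bar>p n - q\<bar> + e n"])
    show "continuous (at q within {0<..<L}) V"
      using V(1) p(2) by (meson continuous_on_eq_continuous_within continuous_within_subset greaterThanLessThan_subseteq_atLeastAtMost_iff order_refl)
    show "0 \<le> K (p n) n x" for n x by (rule K0)
    show "K (p n) n x \<noteq> 0 \<Longrightarrow> x \<in> {0<..<L} \<and> dist x q \<le> \<bar>p n - q\<bar> + e n" for n x
      using K_supp[of "p n" n x] p(3,4)[of n] by (auto simp: dist_real_def)
    show "(\<lambda>n. \<bar>p n - q\<bar> + e n) \<longlonglongrightarrow> 0"
      using tendsto_add[OF tendsto_rabs[OF tendsto_diff[OF p(1) tendsto_const[of q]]] e0] by simp
  qed (use Vm Ki in auto)
  have VKi: "integrable lborel (\<lambda>x. ?V x * K p n x)" for p n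
  proof -
    have "continuous_on UNIV (K p n)" by (rule smooth_real_continuous[OF Ks])
    then show ?thesis by (rule integrable_mult_continuous[OF Vi, of 0 L, rotated]) simp
  qed
  have "(\<lambda>n. \<integral>x. ?V x * \<alpha>2 n x \<partial>lborel) =
    (\<lambda>n. c1 n * (\<integral>x. ?V x * K (e n) n x \<partial>lborel)
       - (\<integral>x. ?V x * K x0 n x \<partial>lborel)
       + c2 n * (\<integral>x. ?V x * K (b n) n x \<partial>lborel))"
  proof
    fix n
    have "(\<integral>x. ?V x * \<alpha>2 n x \<partial>lborel) =
      (\<integral>x. c1 n * (?V x * K (e n) n x)
       - ?V x * K x0 n x
       + c2 n * (?V x * K (b n) n x) \<partial>lborel)"
      by (simp add: \<alpha>2_def algebra_simps)
    also have "\<dots> = c1 n * (\<integral>x. ?V x * K (e n) n x \<partial>lborel)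
       - (\<integral>x. ?V x * K x0 n x \<partial>lborel)
       + c2 n * (\<integral>x. ?V x * K (b n) n x \<partial>lborel)"
      using VKi by simp
    finally show "(\<integral>x. ?V x * \<alpha>2 n x \<partial>lborel) = \<dots>" .
  qed
  moreover have "\<dots> \<longlonglongrightarrow> (L - x0) / (L - 0) * V 0 - V x0 + (x0 - 0) / (L - 0) * V L"
  proof (intro tendsto_add tendsto_diff tendsto_mult c1_lim c2_lim)
    have "e n + e n < L" "x0 + e n < L" "0 < b n" for n
      using e[of n] b[of n] \<delta> x0 by (auto simp: b_def)
    then show "(\<lambda>n. \<integral>x. ?V x * K (e n) n x \<partial>lborel) \<longlonglongrightarrow> V 0"
      "(\<lambda>n. \<integral>x. ?V x * K x0 n x \<partial>lborel) \<longlonglongrightarrow> V x0"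
      "(\<lambda>n. \<integral>x. ?V x * K (b n) n x \<partial>lborel) \<longlonglongrightarrow> V L"
      using L x0 e(1) b(3) by (intro lim e0 b0 tendsto_const; simp)+
  qed
  ultimately have lhs: "(\<lambda>n. \<integral>x. g x * \<alpha> n x \<partial>lborel) \<longlonglongrightarrow> - V x0"
    using V eq by simp
  have rhs: "(\<lambda>n. \<integral>x. g x * \<alpha> n x \<partial>lborel) \<longlonglongrightarrow> (\<integral>x. g x * green L x0 x \<partial>lborel)"
  proof (rule integral_dominated_convergence[where w = "\<lambda>x. 4 * L * \<bar>g x\<bar>"])
    have gm: "g \<in> borel_measurable lborel" using g(1) by simp
    show "(\<lambda>x. g x * \<alpha> n x) \<in> borel_measurable lborel" for n
    proof -
      have "continuous_on UNIV (\<alpha> n)"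
        unfolding \<alpha>_def[abs_def]
        by (intro smooth_real_continuous smooth_real_add smooth_real_diff smooth_real_cmult Qs)
      then show ?thesis using gm borel_measurable_continuous_onI by (intro borel_measurable_times) auto
    qed
    have "continuous_on UNIV (green L x0)"
      unfolding green_def using L by (intro continuous_intros) auto
    then show "(\<lambda>x. g x * green L x0 x) \<in> borel_measurable lborel"
      using gm borel_measurable_continuous_onI by (intro borel_measurable_times) auto
    show "integrable lborel (\<lambda>x. 4 * L * \<bar>g x\<bar>)" using g(1) by simp
    have Ql: "\<bar>Q p n x\<bar> \<le> 2 * L" if "x < L" "0 \<le> p" for p n x
    proof -
      have "max 0 (x - p) \<le> L" using that L by simp
      moreover have "e n \<le> L" using e[of n] \<delta> x0 by simp
      ultimately show ?thesis using Qb[of p n x] by linarith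
    qed
    show "AE x in lborel. norm (g x * \<alpha> n x) \<le> 4 * L * \<bar>g x\<bar>" for n
    proof (rule AE_I2)
      fix x show "norm (g x * \<alpha> n x) \<le> 4 * L * \<bar>g x\<bar>"
      proof (cases "x \<in> {0<..<L}")
        case True
        have "\<bar>\<alpha> n x\<bar> \<le> \<bar>c1 n * Q (e n) n x\<bar> + \<bar>Q x0 n x\<bar> + \<bar>c2 n * Q (b n) n x\<bar>"
          unfolding \<alpha>_def by linarith
        also have "\<dots> = c1 n * \<bar>Q (e n) n x\<bar> + \<bar>Q x0 n x\<bar> + c2 n * \<bar>Q (b n) n x\<bar>"
          by (simp add: abs_mult c12)
        also have "\<dots> \<le> c1 n * (2 * L) + 2 * L + c2 n * (2 * L)"
          using True x0 e[of n] b[of n] c12(3,4)[of n] by (intro add_mono mult_left_mono Ql) auto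
        also have "\<dots> = (c1 n + c2 n) * (2 * L) + 2 * L" by (simp add: algebra_simps)
        finally have "\<bar>\<alpha> n x\<bar> \<le> 4 * L" by (simp add: c12)
        then show ?thesis by (simp add: abs_mult mult.commute mult_left_mono)
      qed (use g(2) in simp)
    qed
    show "AE x in lborel. (\<lambda>n. g x * \<alpha> n x) \<longlonglongrightarrow> g x * green L x0 x"
    proof (rule AE_I2)
      fix x show "(\<lambda>n. g x * \<alpha> n x) \<longlonglongrightarrow> g x * green L x0 x"
      proof (cases "x \<in> {0<..<L}")
        case True
        have Qlim: "(\<lambda>n. Q (p n) n x) \<longlonglongrightarrow> max 0 (x - q)" if "p \<longlonglongrightarrow> q" for p q
        proof -
          have "(\<lambda>n. Q (p n) n x - max 0 (x - p n)) \<longlonglongrightarrow> 0"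
            by (rule Lim_null_comparison[OF _ e0]) (simp add: Qb)
          moreover have "(\<lambda>n. max 0 (x - p n)) \<longlonglongrightarrow> max 0 (x - q)"
            by (intro tendsto_intros that)
          ultimately show ?thesis using tendsto_add by fastforce
        qed
        have "\<alpha> n x = c1 n * Q (e n) n x - Q x0 n x + c2 n * Q (b n) n x" for n
          by (simp add: \<alpha>_def)
        moreover have "(\<lambda>n. c1 n * Q (e n) n x - Q x0 n x + c2 n * Q (b n) n x) \<longlonglongrightarrow>
          (L - x0) / (L - 0) * max 0 (x - 0) - max 0 (x - x0) + (x0 - 0) / (L - 0) * max 0 (x - L)"
          by (intro tendsto_intros c1_lim c2_lim Qlim e0 b0)
        moreover have "(L - x0) / (L - 0) * max 0 (x - 0) - max 0 (x - x0) + (x0 - 0) / (L - 0) * max 0 (x - L)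
          = green L x0 x"
          using True L green_symmetric[of L x x0] by (simp add: green_def mult.commute)
        ultimately have "(\<lambda>n. \<alpha> n x) \<longlonglongrightarrow> green L x0 x" by simp
        then show ?thesis by (rule tendsto_mult[OF tendsto_const])
      qed (use g(2) in simp)
    qed
  qed
  show ?thesis using LIMSEQ_unique[OF lhs rhs] by (simp add: mult.commute)
qed

section \<open>Integration over the cross-sections\<close>

lemma integral_product:
  fixes f g :: "real \<Rightarrow> real"
  assumes "integrable lborel f" "integrable lborel g"
  shows "(\<integral>p. tensor f g p \<partial>lborel) = (\<integral>x. f x \<partial>lborel) * (\<integral>y. g y \<partial>lborel)"
  unfolding fubini_plane(1)[OF product_integrable[OF assms]] by simp

lemma indicator_rep:
  "borel_rep {-l<..<l} (\<lambda>y. 1) (indicator {-l<..<l::real})" "integrable lborel (indicator {-l<..<l::real} :: real \<Rightarrow> real)"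
  using continuous_on_compact_rep(1,2)[OF compact_Icc _ _ continuous_on_const[of "{-l..l}" "1::real"], of "{-l<..<l}"]
  by force+

lemma continuous_plate_rep:
  assumes w: "continuous_on ({0..L} \<times> {-l..l}) w"
  shows "borel_rep (plate L l) w (\<lambda>p. indicator (plate L l) p * w p)" (is ?a)
    "integrable lborel (\<lambda>p. indicator (plate L l) p * w p)" (is ?b)
    "w \<in> L2 (plate L l)" (is ?c)
proof -
  have c: "compact ({0..L} \<times> {-l..l})" by (intro compact_Times) auto
  have s: "plate L l \<subseteq> {0..L} \<times> {-l..l}" by (auto simp: plate_def)
  show ?a
    ?b ?c
    using continuous_on_compact_rep[OF c s plate_borel w] by auto
qed

text \<open>Testing with \<open>\<alpha>(x) \<beta>(y)\<close> separates the variables, so that one-dimensional arguments apply to weak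
derivatives in the plane.\<close>

lemma weak_deriv_product_test:
  assumes w: "continuous_on ({0..L} \<times> {-l..l}) w"
    and r: "borel_rep (plate L l) g r"
    and t: "smooth_real \<alpha>" "\<And>x. x \<notin> {a..b} \<Longrightarrow> \<alpha> x = 0" "0 < a" "b < L"
      "smooth_real \<beta>" "\<And>y. y \<notin> {c..d} \<Longrightarrow> \<beta> y = 0" "- l < c" "d < l"
    and \<alpha>: "\<And>x. (\<alpha> has_real_derivative \<alpha>1 x) (at x)" "\<And>x. (\<alpha>1 has_real_derivative \<alpha>2 x) (at x)"
    and \<beta>: "\<And>x. (\<beta> has_real_derivative \<beta>1 x) (at x)"
  shows "has_L2_weak_deriv (plate L l) [(1, 0), (1, 0)] w g \<Longrightarrow>
      (\<integral>p. (indicator (plate L l) p * w p) * tensor \<alpha>2 \<beta> p \<partial>lborel) =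
      (\<integral>p. r p * tensor \<alpha> \<beta> p \<partial>lborel)" (is "_ \<Longrightarrow> ?xx = ?R")
    and "has_L2_weak_deriv (plate L l) [(1, 0), (0, 1)] w g \<Longrightarrow>
      (\<integral>p. (indicator (plate L l) p * w p) * tensor \<alpha>1 \<beta>1 p \<partial>lborel) =
      (\<integral>p. r p * tensor \<alpha> \<beta> p \<partial>lborel)" (is "_ \<Longrightarrow> ?xy = _")
proof -
  let ?\<phi> = "tensor \<alpha> \<beta>"
  have \<phi>: "?\<phi> \<in> test_functions (plate L l)"
    using test_function_product[OF t] .
  note wr = continuous_plate_rep(1)[OF w]
  have R: "(\<integral>p. g p * ?\<phi> p \<partial>lebesgue_on (plate L l)) = (\<integral>p. r p * ?\<phi> p \<partial>lborel)"
    by (rule borel_rep_integral(2)[OF borel_rep_mult_borel[OF r test_functions_borel[OF \<phi>]] plate_borel])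
  have Lh: "(\<integral>p. w p * partials is ?\<phi> p \<partial>lebesgue_on (plate L l)) =
      (\<integral>p. (indicator (plate L l) p * w p) * partials is ?\<phi> p \<partial>lborel)" if "set is \<subseteq> Basis" for "is"
    by (rule borel_rep_integral(2)[OF borel_rep_mult_borel[OF wr
          test_functions_borel[OF test_functions_partials[OF \<phi> that]]] plate_borel])
  have xx: "partials [(1, 0), (1, 0)] ?\<phi> = tensor \<alpha>2 \<beta>"
    using partials_append[of "[(1, 0)]" "[(1, 0)]" ?\<phi>] partials_product(1)[OF \<alpha>(1) \<beta>]
      partials_product(1)[OF \<alpha>(2) \<beta>] by simp
  have "smooth_real \<beta>1" by (rule smooth_real_derivative_smooth[OF t(5) \<beta>])
  then obtain \<beta>3 where \<beta>3: "\<And>x. (\<beta>1 has_real_derivative \<beta>3 x) (at x)"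
    using smooth_real_derivative by blast
  have xy: "partials [(1, 0), (0, 1)] ?\<phi> = tensor \<alpha>1 \<beta>1"
    using partials_append[of "[(1, 0)]" "[(0, 1)]" ?\<phi>] partials_product(2)[OF \<alpha>(1) \<beta>]
      partials_product(1)[OF \<alpha>(1) \<beta>3] by simp
  show "?xx = ?R" if "has_L2_weak_deriv (plate L l) [(1, 0), (1, 0)] w g"
  proof -
    have B: "set [(1, 0), (1, 0)] \<subseteq> (Basis :: (real \<times> real) set)" by (simp add: Basis_plane)
    have "(\<integral>p. w p * partials [(1, 0), (1, 0)] ?\<phi> p \<partial>lebesgue_on (plate L l)) =
        (- 1) ^ length ([(1, 0), (1, 0)] :: (real \<times> real) list) * (\<integral>p. g p * ?\<phi> p \<partial>lebesgue_on (plate L l))"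
      using that \<phi> unfolding has_L2_weak_deriv_def by blast
    then show ?thesis unfolding Lh[OF B] R unfolding xx by simp
  qed
  show "?xy = ?R" if "has_L2_weak_deriv (plate L l) [(1, 0), (0, 1)] w g"
  proof -
    have B: "set [(1, 0), (0, 1)] \<subseteq> (Basis :: (real \<times> real) set)" by (simp add: Basis_plane)
    have "(\<integral>p. w p * partials [(1, 0), (0, 1)] ?\<phi> p \<partial>lebesgue_on (plate L l)) =
        (- 1) ^ length ([(1, 0), (0, 1)] :: (real \<times> real) list) * (\<integral>p. g p * ?\<phi> p \<partial>lebesgue_on (plate L l))"
      using that \<phi> unfolding has_L2_weak_deriv_def by blast
    then show ?thesis unfolding Lh[OF B] R unfolding xy by simp
  qed
qed

text \<open>Test functions vanish near the free edges, where functions in the energy space do not. The constant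
\<open>1\<close> is therefore approximated in the transverse variable.\<close>

lemma cutoff_sequence_exists:
  fixes l :: real
  assumes l: "l > 0"
  obtains \<beta> :: "nat \<Rightarrow> real \<Rightarrow> real" and c d :: "nat \<Rightarrow> real"
  where "\<And>n. smooth_real (\<beta> n)" "\<And>n y. y \<notin> {c n..d n} \<Longrightarrow> \<beta> n y = 0" "\<And>n. - l < c n" "\<And>n. d n < l"
    "\<And>n y. \<bar>\<beta> n y\<bar> \<le> 1" "\<And>y. y \<in> {-l<..<l} \<Longrightarrow> (\<lambda>n. \<beta> n y) \<longlonglongrightarrow> 1"
proof -
  obtain K S R k where fam: "smoothed_step_family K S R k"
    by (rule smoothed_step_family_exists)
  define e where "e n = l / (real n + 4)" for n
  have e: "e n > 0" "4 * e n \<le> l" for n using l by (auto simp: e_def field_simps)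
  have e0: "e \<longlonglongrightarrow> 0"
    using tendsto_mult[OF tendsto_const[of l] LIMSEQ_ignore_initial_segment[OF lim_inverse_n, of 4]]
    by (simp add: e_def[abs_def] field_simps)
  note fD = smoothed_step_family_D[OF fam e(1)]
  define \<beta> where "\<beta> n y = S (e n) (- l + e n) y - S (e n) (l - 2 * e n) y" for n y
  show ?thesis
  proof (rule that[of \<beta> "\<lambda>n. - l + e n" "\<lambda>n. l - e n"])
    fix n
    show "smooth_real (\<beta> n)" unfolding \<beta>_def[abs_def]
      by (intro smooth_real_diff fD(2))
    show "- l < - l + e n" "l - e n < l" using e[of n] by auto
    fix y
    show "\<bar>\<beta> n y\<bar> \<le> 1"
      using fD(8,9)[of n "- l + e n" y] fD(8,9)[of n "l - 2 * e n" y] unfolding \<beta>_def by linarith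
    assume "y \<notin> {- l + e n..l - e n}"
    then have "y < - l + e n \<or> y > l - e n" by auto
    then show "\<beta> n y = 0"
    proof
      assume y: "y < - l + e n"
      then show ?thesis using e[of n] by (simp add: \<beta>_def fD(10))
    next
      assume y: "y > l - e n"
      then show ?thesis using e[of n] by (simp add: \<beta>_def fD(11))
    qed
  next
    fix y assume y: "y \<in> {-l<..<l}"
    then have "(l - \<bar>y\<bar>) / 2 > 0" by auto
    then have "\<forall>\<^sub>F n in sequentially. e n < (l - \<bar>y\<bar>) / 2"
      by (rule order_tendstoD(2)[OF e0])
    then have "\<forall>\<^sub>F n in sequentially. \<beta> n y = 1"
    proof eventually_elim
      case (elim n)
      then have "- l + e n + e n \<le> y" "y \<le> l - 2 * e n" by auto
      then show ?case by (simp add: \<beta>_def fD(10,11))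
    qed
    then show "(\<lambda>n. \<beta> n y) \<longlonglongrightarrow> 1" by (rule tendsto_eventually)
  qed
qed

text \<open>The integral over a cross-section, not the mean: a factor \<open>2 l\<close> appears when it is compared with values of \<open>w\<close>.\<close>

definition transverse :: "real \<Rightarrow> (real \<times> real \<Rightarrow> real) \<Rightarrow> real \<Rightarrow> real" where
  "transverse l w x = (\<integral>y. indicator {-l<..<l} y * w (x, y) \<partial>lborel)"

lemma transverse_continuous:
  assumes w: "continuous_on ({0..L} \<times> {-l..l}) w"
  shows "continuous_on {0..L} (transverse l w)"
proof -
  have "continuous_on {0..L} (\<lambda>x. integral (cbox (-l) l) (\<lambda>y. w (x, y)))"
    using w by (intro integral_continuous_on_param) (simp add: case_prod_unfold)
  moreover have "transverse l w x = integral (cbox (-l) l) (\<lambda>y. w (x, y))" if x: "x \<in> {0..L}" for x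
  proof -
    have c: "continuous_on {-l..l} (\<lambda>y. w (x, y))"
      using x by (intro continuous_on_compose2[OF w]) (auto intro!: continuous_intros)
    have si: "set_integrable lborel {-l<..<l} (\<lambda>y. w (x, y))"
      using continuous_on_compact_rep(2)[OF compact_Icc _ _ c, of "{-l<..<l}"]
      by (force simp: set_integrable_def)
    have "transverse l w x = integral {-l<..<l} (\<lambda>y. w (x, y))"
      using set_borel_integral_eq_integral(2)[OF si] by (simp add: transverse_def set_lebesgue_integral_def)
    also have "\<dots> = integral (cbox (-l) l) (\<lambda>y. w (x, y))"
      using integral_open_interval[of "-l" l "\<lambda>y. w (x, y)"] by (simp add: box_real cbox_interval)
    finally show ?thesis .
  qed
  ultimately show ?thesis by (metis (no_types, lifting) continuous_on_cong)
qed

text \<open>Differentiation in \<open>x\<close> commutes with integration over the cross-section: test with \<open>\<alpha>(x) \<beta>\<^sub>n(y)\<close> and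
let the cutoffs \<open>\<beta>\<^sub>n\<close> tend to one.\<close>

lemma transverse_second_deriv:
  assumes l: "l > 0" and w: "continuous_on ({0..L} \<times> {-l..l}) w"
    and g: "has_L2_weak_deriv (plate L l) [(1, 0), (1, 0)] w g" and r: "borel_rep (plate L l) g r"
    and t: "smooth_real \<alpha>" "\<And>x. x \<notin> {a..b} \<Longrightarrow> \<alpha> x = 0" "0 < a" "b < L"
    and \<alpha>: "\<And>x. (\<alpha> has_real_derivative \<alpha>1 x) (at x)" "\<And>x. (\<alpha>1 has_real_derivative \<alpha>2 x) (at x)"
  shows "(\<integral>x. indicator {0<..<L} x * transverse l w x * \<alpha>2 x \<partial>lborel) =
    (\<integral>x. (\<integral>y. r (x, y) \<partial>lborel) * \<alpha> x \<partial>lborel)"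
proof -
  obtain \<beta> :: "nat \<Rightarrow> real \<Rightarrow> real" and c d :: "nat \<Rightarrow> real"
    where \<beta>: "\<And>n. smooth_real (\<beta> n)" "\<And>n y. y \<notin> {c n..d n} \<Longrightarrow> \<beta> n y = 0" "\<And>n. - l < c n" "\<And>n. d n < l"
    "\<And>n y. \<bar>\<beta> n y\<bar> \<le> 1" "\<And>y. y \<in> {-l<..<l} \<Longrightarrow> (\<lambda>n. \<beta> n y) \<longlonglongrightarrow> 1"
    by (rule cutoff_sequence_exists[OF l]) (rule that)
  let ?w = "\<lambda>p. indicator (plate L l) p * w p"
  have gL2: "g \<in> L2 (plate L l)" using g by (simp add: has_L2_weak_deriv_def)
  have ri: "integrable lborel r"
    using borel_rep_integrable_L2[OF r plate_borel bounded_plate gL2] .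
  have r0: "r p = 0" if "p \<notin> plate L l" for p using r that unfolding borel_rep_def by blast
  note wr = continuous_plate_rep[OF w]
  have s2: "smooth_real \<alpha>2"
    by (rule smooth_real_derivative_smooth[OF smooth_real_derivative_smooth[OF t(1) \<alpha>(1)] \<alpha>(2)])
  obtain M where M: "\<And>x. x \<in> {0..L} \<Longrightarrow> \<bar>\<alpha> x\<bar> \<le> M"
    by (rule continuous_bounded_Icc[where a = 0 and b = L, OF smooth_real_continuous[OF t(1)]]) (rule that)
  obtain M2 where M2: "\<And>x. x \<in> {0..L} \<Longrightarrow> \<bar>\<alpha>2 x\<bar> \<le> M2"
    by (rule continuous_bounded_Icc[where a = 0 and b = L, OF smooth_real_continuous[OF s2]]) (rule that)
  have bm: "h \<in> borel_measurable borel" if "smooth_real h" for h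
    using smooth_real_continuous[OF that] by (rule borel_measurable_continuous_onI)
  have lim: "(\<lambda>n. \<integral>p. F p * tensor h (\<beta> n) p \<partial>lborel) \<longlonglongrightarrow> (\<integral>p. F p * h (fst p) \<partial>lborel)"
    and Fh: "integrable lborel (\<lambda>p. F p * h (fst p))"
    if F: "integrable lborel F" "\<And>p. p \<notin> plate L l \<Longrightarrow> F p = 0" and h: "smooth_real h" "\<And>x. x \<in> {0..L} \<Longrightarrow> \<bar>h x\<bar> \<le> B" for F h B
  proof -
    have [measurable]: "F \<in> borel_measurable borel" "h \<in> borel_measurable borel" "\<beta> n \<in> borel_measurable borel" for n
      using F(1) bm[OF h(1)] bm[OF \<beta>(1)] by auto
    have hm: "(\<lambda>p::real\<times>real. h (fst p)) \<in> borel_measurable borel"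
      by (simp add: borel_prod[symmetric])
    have bm': "(\<lambda>p::real\<times>real. \<beta> n (snd p)) \<in> borel_measurable borel" for n
      by (simp add: borel_prod[symmetric])
    show Fh: "integrable lborel (\<lambda>p. F p * h (fst p))"
    proof (rule integrable_mult_bounded[OF F(1) hm])
      fix p assume "F p \<noteq> 0"
      then have "p \<in> plate L l" using F(2) by blast
      then show "\<bar>h (fst p)\<bar> \<le> B" by (intro h(2)) (auto simp: plate_def)
    qed
    show "(\<lambda>n. \<integral>p. F p * tensor h (\<beta> n) p \<partial>lborel) \<longlonglongrightarrow> (\<integral>p. F p * h (fst p) \<partial>lborel)"
    proof (rule integral_dominated_convergence[where w = "\<lambda>p. \<bar>F p * h (fst p)\<bar>"])
      show "integrable lborel (\<lambda>p. \<bar>F p * h (fst p)\<bar>)" using Fh by (rule integrable_abs)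
      show "(\<lambda>p. F p * h (fst p)) \<in> borel_measurable lborel" using Fh by simp
      show "(\<lambda>p. F p * tensor h (\<beta> n) p) \<in> borel_measurable lborel" for n
        using F(1) hm bm'[of n] by (simp add: case_prod_unfold)
      show "AE p in lborel. norm (F p * tensor h (\<beta> n) p) \<le> \<bar>F p * h (fst p)\<bar>" for n
      proof (rule AE_I2)
        fix p :: "real \<times> real"
        have "\<bar>F p * h (fst p)\<bar> * \<bar>\<beta> n (snd p)\<bar> \<le> \<bar>F p * h (fst p)\<bar> * 1"
          by (intro mult_left_mono \<beta>(5)) simp
        then show "norm (F p * tensor h (\<beta> n) p) \<le> \<bar>F p * h (fst p)\<bar>"
          by (simp add: case_prod_unfold abs_mult mult.assoc)
      qed
      show "AE p in lborel. (\<lambda>n. F p * tensor h (\<beta> n) p) \<longlonglongrightarrow> F p * h (fst p)"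
      proof (rule AE_I2)
        fix p :: "real \<times> real"
        show "(\<lambda>n. F p * tensor h (\<beta> n) p) \<longlonglongrightarrow> F p * h (fst p)"
        proof (cases "p \<in> plate L l")
          case True
          then have "(\<lambda>n. \<beta> n (snd p)) \<longlonglongrightarrow> 1" by (intro \<beta>(6)) (auto simp: plate_def)
          then have "(\<lambda>n. F p * (h (fst p) * \<beta> n (snd p))) \<longlonglongrightarrow> F p * (h (fst p) * 1)"
            by (intro tendsto_intros)
          then show ?thesis by (simp add: case_prod_unfold)
        qed (simp add: F(2))
      qed
    qed
  qed
  have w0: "?w p = 0" if "p \<notin> plate L l" for p using that by simp
  have "(\<integral>p. ?w p * tensor \<alpha>2 (\<beta> n) p \<partial>lborel) =
      (\<integral>p. r p * tensor \<alpha> (\<beta> n) p \<partial>lborel)" for n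
  proof -
    obtain \<beta>1 where "\<And>x. (\<beta> n has_real_derivative \<beta>1 x) (at x)"
      using smooth_real_derivative[OF \<beta>(1)] by blast
    from weak_deriv_product_test(1)[OF w r t \<beta>(1-4) \<alpha> this g] show ?thesis .
  qed
  then have "(\<integral>p. ?w p * \<alpha>2 (fst p) \<partial>lborel) = (\<integral>p. r p * \<alpha> (fst p) \<partial>lborel)"
    using lim[OF wr(2) w0 s2 M2] lim[OF ri r0 t(1) M] by (simp add: LIMSEQ_unique)
  moreover have "(\<integral>p. ?w p * \<alpha>2 (fst p) \<partial>lborel) =
      (\<integral>x. indicator {0<..<L} x * transverse l w x * \<alpha>2 x \<partial>lborel)"
  proof -
    have "(\<lambda>y. ?w (x, y) * \<alpha>2 (fst (x, y))) =
        (\<lambda>y. indicator {0<..<L} x * \<alpha>2 x * (indicator {-l<..<l} y * w (x, y)))" for x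
      by (simp add: plate_indicator mult_ac)
    then have "(\<integral>y. ?w (x, y) * \<alpha>2 (fst (x, y)) \<partial>lborel) =
        indicator {0<..<L} x * \<alpha>2 x * transverse l w x" for x
      unfolding transverse_def by (simp only: integral_mult_right_zero)
    then have *: "(\<integral>y. ?w (x, y) * \<alpha>2 (fst (x, y)) \<partial>lborel) =
        indicator {0<..<L} x * transverse l w x * \<alpha>2 x" for x
      by (simp only: mult_ac)
    have "(\<integral>p. ?w p * \<alpha>2 (fst p) \<partial>lborel) = (\<integral>x. (\<integral>y. ?w (x, y) * \<alpha>2 (fst (x, y)) \<partial>lborel) \<partial>lborel)"
      by (rule fubini_plane(1)[OF Fh[OF wr(2) w0 s2 M2]])
    then show ?thesis by (simp only: *)
  qed
  moreover have "(\<integral>p. r p * \<alpha> (fst p) \<partial>lborel) = (\<integral>x. (\<integral>y. r (x, y) \<partial>lborel) * \<alpha> x \<partial>lborel)"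
    using fubini_plane(1)[OF Fh[OF ri r0 t(1) M]] by simp
  ultimately show ?thesis by simp
qed

section \<open>Pointwise bounds and duality on the plate\<close>

lemma H2_star_D:
  assumes "w \<in> H2_star L l" "L > 0" "l > 0"
  shows "continuous_on ({0..L} \<times> {-l..l}) w"
    and "\<And>y. y \<in> {-l<..<l} \<Longrightarrow> w (0, y) = 0" "\<And>y. y \<in> {-l<..<l} \<Longrightarrow> w (L, y) = 0"
    and "w \<in> L2 (plate L l)"
  using assms by (auto simp: H2_star_def closure_plate sobolev_def)

lemma plate_rep_facts:
  assumes "g \<in> L2 (plate L l)" "borel_rep (plate L l) g r"
  shows "integrable lborel r" "\<And>p. p \<notin> plate L l \<Longrightarrow> r p = 0"
    and "(\<integral>p. \<bar>g p\<bar> \<partial>lebesgue_on (plate L l)) = (\<integral>p. \<bar>r p\<bar> \<partial>lborel)"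
proof -
  show "integrable lborel r"
    using borel_rep_integrable_L2[OF assms(2) plate_borel bounded_plate assms(1)] .
  show "\<And>p. p \<notin> plate L l \<Longrightarrow> r p = 0" using assms(2) unfolding borel_rep_def by blast
  have "borel_rep (plate L l) (\<lambda>p. \<bar>g p\<bar>) (\<lambda>p. \<bar>r p\<bar>)"
    using assms(2) unfolding borel_rep_def by (auto elim!: AE_mp)
  then show "(\<integral>p. \<bar>g p\<bar> \<partial>lebesgue_on (plate L l)) = (\<integral>p. \<bar>r p\<bar> \<partial>lborel)"
    by (rule borel_rep_integral(2)) simp
qed

lemma plate_slice_zero:
  assumes "\<And>p. p \<notin> plate L l \<Longrightarrow> r p = (0::real)" "s \<notin> {0<..<L}"
  shows "(\<integral>y. r (s, y) \<partial>lborel) = 0"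
proof -
  have "r (s, y) = 0" for y using assms by (auto simp: plate_def)
  then show ?thesis by simp
qed

lemma transverse_green:
  assumes L: "L > 0" and l: "l > 0" and w: "w \<in> H2_star L l"
    and g: "has_L2_weak_deriv (plate L l) [(1, 0), (1, 0)] w g" and r: "borel_rep (plate L l) g r"
    and x: "x \<in> {0<..<L}"
  shows "transverse l w x = - (\<integral>s. green L x s * (\<integral>y. r (s, y) \<partial>lborel) \<partial>lborel)"
proof -
  note wD = H2_star_D[OF w L l]
  have gL2: "g \<in> L2 (plate L l)" using g by (simp add: has_L2_weak_deriv_def)
  note rf = plate_rep_facts[OF gL2 r]
  have end0: "transverse l w a = 0" if "\<And>y. y \<in> {-l<..<l} \<Longrightarrow> w (a, y) = 0" for a
  proof -
    have "(\<lambda>y. indicator {-l<..<l} y * w (a, y)) = (\<lambda>y. 0)"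
      using that by (force split: split_indicator)
    then show ?thesis by (simp add: transverse_def)
  qed
  show ?thesis
  proof (rule green_representation_weak[OF L transverse_continuous[OF wD(1)] _ _ _ _ _ x])
    show "transverse l w 0 = 0" "transverse l w L = 0" using end0 wD by blast+
    show "integrable lborel (\<lambda>s. \<integral>y. r (s, y) \<partial>lborel)" using fubini_plane(3)[OF rf(1)] .
    show "(\<integral>y. r (s, y) \<partial>lborel) = 0" if "s \<notin> {0<..<L}" for s
      using rf(2) that by (rule plate_slice_zero)
    show "(\<integral>x. indicator {0<..<L} x * transverse l w x * \<alpha>2 x \<partial>lborel) =
        (\<integral>x. (\<integral>y. r (x, y) \<partial>lborel) * \<alpha> x \<partial>lborel)"
      if "smooth_real \<alpha>" "\<And>x. (\<alpha> has_real_derivative \<alpha>1 x) (at x)"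
        "\<And>x. (\<alpha>1 has_real_derivative \<alpha>2 x) (at x)" "0 < a" "b < L" "\<And>x. x \<notin> {a..b} \<Longrightarrow> \<alpha> x = 0"
      for \<alpha> \<alpha>1 \<alpha>2 a b
      using transverse_second_deriv[OF l wD(1) g r that(1,6,4,5,2,3)] .
  qed
qed

lemma transverse_bound:
  assumes L: "L > 0" and l: "l > 0" and w: "w \<in> H2_star L l"
    and g: "has_L2_weak_deriv (plate L l) [(1, 0), (1, 0)] w g" and x: "x \<in> {0<..<L}"
  shows "\<bar>transverse l w x\<bar> \<le> L * (\<integral>p. \<bar>g p\<bar> \<partial>lebesgue_on (plate L l))"
proof -
  have gL2: "g \<in> L2 (plate L l)" using g by (simp add: has_L2_weak_deriv_def)
  obtain r where r: "borel_rep (plate L l) g r"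
    by (rule borel_rep_exists[OF L2_D(1)[OF gL2] plate_borel])
  note rf = plate_rep_facts[OF gL2 r]
  define G where "G s = (\<integral>y. r (s, y) \<partial>lborel)" for s
  have G0: "G s = 0" if "s \<notin> {0<..<L}" for s
    unfolding G_def using rf(2) that by (rule plate_slice_zero)
  have Gi: "integrable lborel G" using fubini_plane(3)[OF rf(1)] by (simp add: G_def[abs_def])
  have ia: "integrable lborel (\<lambda>p. \<bar>r p\<bar>)" using rf(1) by simp
  have gi: "integrable lborel (\<lambda>s. green L x s * G s)"
  proof -
    have "continuous_on UNIV (green L x)"
      unfolding green_def using L by (intro continuous_intros) auto
    from integrable_mult_continuous[OF Gi, of 0 L, OF G0 this] show ?thesis by (simp add: mult.commute)
  qed
  have "\<bar>transverse l w x\<bar> = \<bar>\<integral>s. green L x s * G s \<partial>lborel\<bar>"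
    using transverse_green[OF L l w g r x] by (simp add: G_def)
  also have "\<dots> \<le> (\<integral>s. \<bar>green L x s * G s\<bar> \<partial>lborel)" by (rule integral_abs_bound)
  also have "\<dots> \<le> (\<integral>s. L * (\<integral>y. \<bar>r (s, y)\<bar> \<partial>lborel) \<partial>lborel)"
  proof (rule integral_mono)
    show "integrable lborel (\<lambda>s. \<bar>green L x s * G s\<bar>)" using gi by (rule integrable_abs)
    show "integrable lborel (\<lambda>s. L * (\<integral>y. \<bar>r (s, y)\<bar> \<partial>lborel))"
      using fubini_plane(3)[OF ia] by simp
    fix s
    have "\<bar>G s\<bar> \<le> (\<integral>y. \<bar>r (s, y)\<bar> \<partial>lborel)" unfolding G_def by (rule integral_abs_bound)
    then show "\<bar>green L x s * G s\<bar> \<le> L * (\<integral>y. \<bar>r (s, y)\<bar> \<partial>lborel)"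
    proof (cases "s \<in> {0<..<L}")
      case True
      then have "\<bar>green L x s\<bar> \<le> L" using x L by (intro green_bound) auto
      then show ?thesis unfolding abs_mult using L
        by (intro mult_mono \<open>\<bar>G s\<bar> \<le> _\<close>) auto
    qed (use G0 L in simp)
  qed
  also have "\<dots> = L * (\<integral>p. \<bar>r p\<bar> \<partial>lborel)" using fubini_plane(1)[OF ia] by simp
  finally show ?thesis by (simp add: rf(3))
qed

text \<open>This is \<open>\<integral> M w\<^sub>x\<^sub>x = \<integral> M'' w\<close>, two integrations by parts without boundary terms. Both \<open>M\<close> and the
cross-section integrals of \<open>w\<close> are Green potentials of their second derivatives, so the identity
reduces to the symmetry of the Green function and Fubini's theorem.\<close>

lemma bending_duality:
  assumes L: "L > 0" and l: "l > 0" and w: "w \<in> H2_star L l"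
    and g: "has_L2_weak_deriv (plate L l) [(1, 0), (1, 0)] w g"
    and ac: "absolutely_continuous_L2 0 L M1 M2"
    and M: "\<And>x. x \<in> {0..L} \<Longrightarrow> (M has_real_derivative M1 x) (at x within {0..L})" "M 0 = 0" "M L = 0"
  shows "(\<integral>p. M (fst p) * g p \<partial>lebesgue_on (plate L l)) = (\<integral>p. M2 (fst p) * w p \<partial>lebesgue_on (plate L l))"
proof -
  let ?w = "\<lambda>p. indicator (plate L l) p * w p"
  note wD = H2_star_D[OF w L l]
  note wr = continuous_plate_rep[OF wD(1)]
  have gL2: "g \<in> L2 (plate L l)" using g by (simp add: has_L2_weak_deriv_def)
  obtain r where r: "borel_rep (plate L l) g r"
    by (rule borel_rep_exists[OF L2_D(1)[OF gL2] plate_borel])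
  note rf = plate_rep_facts[OF gL2 r]
  have M2: "M2 \<in> L2 {0<..<L}" using ac unfolding absolutely_continuous_L2_def by blast
  obtain q where q: "borel_rep {0<..<L} M2 q"
    by (rule borel_rep_exists[OF L2_D(1)[OF M2]]) simp_all
  have qi: "integrable lborel q" using borel_rep_integrable_L2[OF q _ _ M2] by simp
  have q0: "q x = 0" if "x \<notin> {0<..<L}" for x using q that unfolding borel_rep_def by blast
  have Mc: "continuous_on {0..L} M" using M(1) by (rule DERIV_continuous_on)
  define m where "m x = indicator {0<..<L} x * M x" for x
  have m: "borel_rep {0<..<L} M m"
    unfolding m_def[abs_def]
    by (rule continuous_on_compact_rep(1)[OF compact_Icc _ _ Mc]) auto
  let ?one = "indicator {-l<..<l} :: real \<Rightarrow> real"
  note one = indicator_rep[of l]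
  define G where "G s = (\<integral>y. r (s, y) \<partial>lborel)" for s
  have G0: "G s = 0" if "s \<notin> {0<..<L}" for s
    unfolding G_def using rf(2) that by (rule plate_slice_zero)
  have Gi: "integrable lborel G" using fubini_plane(3)[OF rf(1)] by (simp add: G_def[abs_def])
  obtain C where C: "\<And>x. x \<in> {0..L} \<Longrightarrow> \<bar>M x\<bar> \<le> C" by (rule continuous_bounded_Icc[OF Mc]) (rule that)
  have "bounded (w ` ({0..L} \<times> {-l..l}))"
    by (intro compact_imp_bounded compact_continuous_image wD(1) compact_Times compact_Icc)
  then obtain B where B: "\<forall>p\<in>{0..L} \<times> {-l..l}. \<bar>w p\<bar> \<le> B" by (auto simp: bounded_iff)
  have repq: "borel_rep (plate L l) (\<lambda>p. M2 (fst p) * w p)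
      (\<lambda>p. tensor q ?one p * (?w p))"
    using borel_rep_mult[OF plate_product_rep[OF q one(1)] wr(1)] by (simp add: case_prod_unfold)
  have iq: "integrable lborel (\<lambda>p. tensor q ?one p * (?w p))"
  proof (rule integrable_mult_bounded[OF product_integrable[OF qi one(2)]])
    show "(\<lambda>p. ?w p) \<in> borel_measurable borel"
      using wr(1) unfolding borel_rep_def by blast
    fix p assume "tensor q ?one p \<noteq> 0"
    then have p: "p \<in> plate L l"
      using q0 by (cases p) (auto simp: plate_def split: split_indicator_asm)
    then have "p \<in> {0..L} \<times> {-l..l}" by (auto simp: plate_def)
    then have "\<bar>w p\<bar> \<le> B" using B by blast
    then show "\<bar>?w p\<bar> \<le> B" using p by simp
  qed
  have repm: "borel_rep (plate L l) (\<lambda>p. M (fst p) * g p)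
      (\<lambda>p. r p * tensor m ?one p)"
    using borel_rep_mult[OF r plate_product_rep[OF m one(1)]] by (simp add: case_prod_unfold mult.commute)
  have im: "integrable lborel (\<lambda>p. r p * tensor m ?one p)"
  proof (rule integrable_mult_bounded[OF rf(1)])
    show "tensor m ?one \<in> borel_measurable borel"
      using plate_product_rep[OF m one(1)] unfolding borel_rep_def by blast
    fix p assume "r p \<noteq> 0"
    then have p: "p \<in> plate L l" using rf(2) by blast
    then have "\<bar>M (fst p)\<bar> \<le> C" by (intro C) (auto simp: plate_def)
    then show "\<bar>case p of (x, y) \<Rightarrow> m x * ?one y\<bar> \<le> C"
      using p by (auto simp: m_def plate_def)
  qed
  \<comment> \<open>The Green function cut off outside the square, where it is unbounded.\<close>
  define T where "T = (\<lambda>(x, s). if x \<in> {0..L} \<and> s \<in> {0..L} then green L x s else 0)"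
  have Tm: "T \<in> borel_measurable borel"
  proof -
    have "continuous_on ({0..L} \<times> {0..L}) (\<lambda>(x, s). green L x s)"
      unfolding green_def case_prod_unfold using L by (intro continuous_intros) auto
    then have "(\<lambda>p. indicator ({0..L} \<times> {0..L}) p *\<^sub>R (\<lambda>(x, s). green L x s) p) \<in> borel_measurable borel"
      by (intro borel_measurable_continuous_on_indicator borel_closed closed_Times) auto
    moreover have "(\<lambda>p. indicator ({0..L} \<times> {0..L}) p *\<^sub>R (\<lambda>(x, s). green L x s) p) = T"
      by (auto simp: T_def split: split_indicator)
    ultimately show ?thesis by simp
  qed
  have Tb: "\<bar>T p\<bar> \<le> L" for p
    using green_bound L by (cases p) (auto simp: T_def)
  have iT: "integrable lborel (\<lambda>p. tensor q G p * T p)"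
    using integrable_mult_bounded[OF product_integrable[OF qi Gi] Tm Tb] .
  have in1: "(\<integral>s. q x * G s * T (x, s) \<partial>lborel) = - (q x * transverse l w x)" for x
  proof (cases "x \<in> {0<..<L}")
    case True
    have "(\<lambda>s. q x * G s * T (x, s)) = (\<lambda>s. q x * (green L x s * G s))"
    proof
      fix s show "q x * G s * T (x, s) = q x * (green L x s * G s)"
        using True G0[of s] by (cases "s \<in> {0<..<L}") (auto simp: T_def)
    qed
    then show ?thesis using transverse_green[OF L l w g r True] by (simp add: G_def)
  qed (simp add: q0)
  have in2: "(\<integral>x. q x * G s * T (x, s) \<partial>lborel) = - (G s * m s)" for s
  proof (cases "s \<in> {0<..<L}")
    case True
    have "(\<lambda>x. q x * G s * T (x, s)) = (\<lambda>x. G s * (green L s x * q x))"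
    proof
      fix x show "q x * G s * T (x, s) = G s * (green L s x * q x)"
        using True q0[of x] green_symmetric[of L x s] L by (cases "x \<in> {0<..<L}") (auto simp: T_def)
    qed
    then show ?thesis
      using green_representation_strong[OF ac q M(1) M(2,3) L, of s] True by (simp add: m_def)
  qed (simp add: G0)
  have "(\<integral>p. M2 (fst p) * w p \<partial>lebesgue_on (plate L l)) =
      (\<integral>p. tensor q ?one p * (?w p) \<partial>lborel)"
    by (rule borel_rep_integral(2)[OF repq plate_borel])
  also have "\<dots> = (\<integral>x. q x * transverse l w x \<partial>lborel)"
  proof -
    have "(\<integral>y. q x * ?one y * (indicator (plate L l) (x, y) * w (x, y)) \<partial>lborel) = q x * transverse l w x" for x
    proof (cases "x \<in> {0<..<L}")
      case True
      have "(\<lambda>y. q x * ?one y * (indicator (plate L l) (x, y) * w (x, y))) =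
          (\<lambda>y. q x * (indicator {-l<..<l} y * w (x, y)))"
        using True by (auto simp: plate_def split: split_indicator)
      then show ?thesis by (simp add: transverse_def)
    qed (simp add: q0)
    then show ?thesis using fubini_plane(1)[OF iq] by simp
  qed
  also have "\<dots> = - (\<integral>p. tensor q G p * T p \<partial>lborel)"
    using fubini_plane(1)[OF iT] by (simp add: in1)
  also have "\<dots> = (\<integral>s. G s * m s \<partial>lborel)"
    using fubini_plane(2)[OF iT] by (simp add: in2)
  also have "\<dots> = (\<integral>p. r p * tensor m ?one p \<partial>lborel)"
  proof -
    have "(\<integral>y. r (s, y) * (m s * ?one y) \<partial>lborel) = G s * m s" for s
    proof -
      have "(\<lambda>y. r (s, y) * (m s * ?one y)) = (\<lambda>y. r (s, y) * m s)"
      proof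
        fix y show "r (s, y) * (m s * ?one y) = r (s, y) * m s"
          using rf(2)[of "(s, y)"] by (cases "y \<in> {-l<..<l}") (auto simp: plate_def )
      qed
      then show ?thesis unfolding G_def by (simp only: integral_mult_left_zero)
    qed
    then show ?thesis using fubini_plane(1)[OF im] by simp
  qed
  also have "\<dots> = (\<integral>p. M (fst p) * g p \<partial>lebesgue_on (plate L l))"
    by (rule borel_rep_integral(2)[OF repm plate_borel, symmetric])
  finally show ?thesis by simp
qed

text \<open>Since \<open>w\<close> vanishes on the edge \<open>x = 0\<close>, the difference is the integral of \<open>w\<^sub>x\<^sub>y\<close> over the rectangle
between \<open>0\<close> and \<open>x\<close> and between \<open>y'\<close> and \<open>y\<close>. Its indicator is replaced by a product of differences of
smooth steps, which are bounded by one in absolute value; this suffices for the inequality.\<close>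

lemma transverse_oscillation:
  assumes L: "L > 0" and l: "l > 0" and w: "w \<in> H2_star L l"
    and g: "has_L2_weak_deriv (plate L l) [(1, 0), (0, 1)] w g"
    and x: "x \<in> {0<..<L}" and y: "y \<in> {-l<..<l}" "y' \<in> {-l<..<l}"
  shows "\<bar>w (x, y) - w (x, y')\<bar> \<le> (\<integral>p. \<bar>g p\<bar> \<partial>lebesgue_on (plate L l))"
proof -
  note wD = H2_star_D[OF w L l]
  note wr = continuous_plate_rep[OF wD(1)]
  have gL2: "g \<in> L2 (plate L l)" using g by (simp add: has_L2_weak_deriv_def)
  obtain r where r: "borel_rep (plate L l) g r"
    by (rule borel_rep_exists[OF L2_D(1)[OF gL2] plate_borel])
  note rf = plate_rep_facts[OF gL2 r]
  obtain k h q c where fam: "smoothed_step_family k h q c"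
    by (rule smoothed_step_family_exists)
  \<comment> \<open>Steps of width \<open>e n\<close> starting at \<open>e n\<close>, \<open>x\<close>, \<open>y\<close> and \<open>y'\<close> end inside the plate.\<close>
  define \<delta> where "\<delta> = min (min x (L - x)) (min (l - \<bar>y\<bar>) (l - \<bar>y'\<bar>))"
  have \<delta>: "\<delta> > 0" "\<delta> \<le> x" "\<delta> \<le> L - x" "\<delta> \<le> l - \<bar>y\<bar>" "\<delta> \<le> l - \<bar>y'\<bar>"
    using x y by (auto simp: \<delta>_def)
  define e where "e n = \<delta> / (real n + 3)" for n
  have e: "e n > 0" "3 * e n \<le> \<delta>" for n using \<delta> by (auto simp: e_def field_simps)
  have e0: "e \<longlonglongrightarrow> 0"
    using tendsto_mult[OF tendsto_const[of \<delta>] LIMSEQ_ignore_initial_segment[OF lim_inverse_n, of 3]]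
    by (simp add: e_def[abs_def] field_simps)
  note fD = smoothed_step_family_D[OF fam e(1)]
  define K where "K p n = k (e n) p" for p n
  define S where "S p n = h (e n) p" for p n
  have S': "(S p n has_real_derivative K p n t) (at t)" and Ss: "smooth_real (S p n)"
    and Ks: "smooth_real (K p n)" and S0: "t \<le> p \<Longrightarrow> S p n t = 0" and S1: "p + e n \<le> t \<Longrightarrow> S p n t = 1"
    and K_supp: "K p n t \<noteq> 0 \<Longrightarrow> p < t \<and> t < p + e n" and K0: "0 \<le> K p n t" for p n t
    unfolding K_def S_def by (fact fD)+
  have Sb: "\<bar>S p n t - S q n t\<bar> \<le> 1" for p q n t
    unfolding S_def using fD(8,9)[of n p t] fD(8,9)[of n q t] by linarith
  have Ki: "integrable lborel (K p n)" "(\<integral>t. K p n t \<partial>lborel) = 1" for p n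
    unfolding K_def by (rule smoothed_step_family_integral[OF fam e(1)])+
  \<comment> \<open>The left step stands at \<open>e n\<close> instead of \<open>0\<close> to keep the support inside; in the limit it reaches
    the edge, where \<open>w\<close> vanishes.\<close>
  define \<alpha> where "\<alpha> n t = S (e n) n t - S x n t" for n t
  define \<alpha>1 where "\<alpha>1 n t = K (e n) n t - K x n t" for n t
  define \<beta> where "\<beta> n t = S y n t - S y' n t" for n t
  define \<beta>1 where "\<beta>1 n t = K y n t - K y' n t" for n t
  let ?w = "\<lambda>p. indicator (plate L l) p * w p"
  have eq: "(\<integral>p. ?w p * tensor (\<alpha>1 n) (\<beta>1 n) p \<partial>lborel) =
      (\<integral>p. r p * tensor (\<alpha> n) (\<beta> n) p \<partial>lborel)" for n
  proof -
    have a: "smooth_real (\<alpha> n)" "smooth_real (\<beta> n)"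
      unfolding \<alpha>_def[abs_def] \<beta>_def[abs_def] by (intro smooth_real_diff Ss)+
    have d: "(\<alpha> n has_real_derivative \<alpha>1 n t) (at t)" "(\<beta> n has_real_derivative \<beta>1 n t) (at t)" for t
      unfolding \<alpha>_def[abs_def] \<alpha>1_def \<beta>_def[abs_def] \<beta>1_def by (intro DERIV_diff S')+
    have "smooth_real (\<alpha>1 n)" by (rule smooth_real_derivative_smooth[OF a(1) d(1)])
    then obtain \<alpha>2 where d2: "\<And>t. (\<alpha>1 n has_real_derivative \<alpha>2 t) (at t)"
      using smooth_real_derivative by blast
    have za: "\<alpha> n t = 0" if "t \<notin> {e n..x + e n}" for t
    proof -
      have en: "e n < x" using e[of n] \<delta> by linarith
      have "t < e n \<or> t > x + e n" using that by auto
      then show ?thesis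
      proof
        assume "t < e n" then show ?thesis using en by (simp add: \<alpha>_def S0)
      next
        assume "t > x + e n" then show ?thesis using en by (simp add: \<alpha>_def S1)
      qed
    qed
    have zb: "\<beta> n t = 0" if "t \<notin> {min y y'..max y y' + e n}" for t
    proof -
      have "t < min y y' \<or> t > max y y' + e n" using that by auto
      then show ?thesis
      proof
        assume "t < min y y'" then show ?thesis by (simp add: \<beta>_def S0)
      next
        assume "t > max y y' + e n"
        then have "y + e n \<le> t" "y' + e n \<le> t" by auto
        then show ?thesis by (simp add: \<beta>_def S1)
      qed
    qed
    have bnd: "0 < e n" "x + e n < L" "- l < min y y'" "max y y' + e n < l"
      using e[of n] \<delta> y by auto
    show ?thesis
      by (rule weak_deriv_product_test(2)[where a = "e n" and b = "x + e n"
            and c = "min y y'" and d = "max y y' + e n"])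
        (fact wD(1) r a za bnd zb d d2 g)+
  qed
  let ?t = "\<lambda>p q n z. ?w z * tensor (K p n) (K q n) z"
  have Kp: "integrable lborel (tensor (K p n) (K q n))"
    "(\<integral>z. tensor (K p n) (K q n) z \<partial>lborel) = 1" for p q n
    using product_integrable[OF Ki(1) Ki(1)] integral_product[OF Ki(1) Ki(1)] Ki(2) by auto
  have wKi: "integrable lborel (\<lambda>z. ?t p q n z)" for p q n
  proof -
    obtain B1 where B1: "\<And>t. t \<in> {0..L} \<Longrightarrow> \<bar>K p n t\<bar> \<le> B1"
      by (rule continuous_bounded_Icc[where a = 0 and b = L, OF smooth_real_continuous[OF Ks]]) (rule that)
    obtain B2 where B2: "\<And>t. t \<in> {-l..l} \<Longrightarrow> \<bar>K q n t\<bar> \<le> B2"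
      by (rule continuous_bounded_Icc[where a = "-l" and b = l, OF smooth_real_continuous[OF Ks]]) (rule that)
    show ?thesis
    proof (rule integrable_mult_bounded[OF wr(2)])
      fix z assume "?w z \<noteq> 0"
      then have "z \<in> plate L l" by (auto split: split_indicator_asm)
      then have z: "fst z \<in> {0..L}" "snd z \<in> {-l..l}" by (auto simp: plate_def)
      have "\<bar>K p n (fst z)\<bar> * \<bar>K q n (snd z)\<bar> \<le> B1 * B2"
        using B1[OF z(1)] by (intro mult_mono B1 B2 z) auto
      then show "\<bar>case z of (t, s) \<Rightarrow> K p n t * K q n s\<bar> \<le> B1 * B2"
        by (simp add: case_prod_unfold abs_mult)
    qed (use borel_measurable_integrable[OF Kp(1)] in simp)
  qed
  have lim: "(\<lambda>n. \<integral>z. ?t (a n) b n z \<partial>lborel) \<longlonglongrightarrow> w (q, b)"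
    if a: "a \<longlonglongrightarrow> q" "q \<in> {0..L}" "\<And>n. 0 < a n" "\<And>n. a n + e n < L" and b: "b = y \<or> b = y'" for a q b
  proof (rule approximate_identity[where e = "\<lambda>n. \<bar>a n - q\<bar> + 2 * e n"])
    have bl: "b \<in> {-l<..<l}" "b + e n < l" for n using b y e[of n] \<delta> by auto
    then have "(q, b) \<in> {0..L} \<times> {-l..l}" using a(2) by auto
    then have "continuous (at (q, b) within {0..L} \<times> {-l..l}) w"
      using wD(1) by (simp add: continuous_on_eq_continuous_within)
    then show "continuous (at (q, b) within plate L l) w"
      by (rule continuous_within_subset) (auto simp: plate_def)
    show "(\<lambda>p. ?w p) \<in> borel_measurable borel" using wr(1) unfolding borel_rep_def by blast
    show "0 \<le> (case z of (t, s) \<Rightarrow> K (a n) n t * K b n s)" for n z using K0 by (cases z) simp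
    show "z \<in> plate L l \<and> dist z (q, b) \<le> \<bar>a n - q\<bar> + 2 * e n"
      if "(case z of (t, s) \<Rightarrow> K (a n) n t * K b n s) \<noteq> 0" for n z
    proof (cases z)
      case (Pair t s)
      then have ts: "a n < t" "t < a n + e n" "b < s" "s < b + e n"
        using that K_supp[of "a n" n t] K_supp[of b n s] by auto
      have "dist z (q, b) \<le> \<bar>t - q\<bar> + \<bar>s - b\<bar>"
        using sqrt_sum_squares_le_sum_abs[of "t - q" "s - b"]
        by (simp add: Pair dist_Pair_Pair dist_real_def)
      then show ?thesis using ts a(3,4)[of n] bl(1) bl(2)[of n] by (auto simp: Pair plate_def)
    qed
    show "(\<lambda>n. \<bar>a n - q\<bar> + 2 * e n) \<longlonglongrightarrow> 0"
      using tendsto_add[OF tendsto_rabs[OF tendsto_diff[OF a(1) tendsto_const[of q]]]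
          tendsto_mult[OF tendsto_const[of 2] e0]] by simp
  qed (use Kp in auto)
  have split: "(\<integral>p. ?w p * tensor (\<alpha>1 n) (\<beta>1 n) p \<partial>lborel) =
      (\<integral>z. ?t (e n) y n z \<partial>lborel)
    - (\<integral>z. ?t (e n) y' n z \<partial>lborel)
    - (\<integral>z. ?t x y n z \<partial>lborel)
    + (\<integral>z. ?t x y' n z \<partial>lborel)" (is "?l n = ?r n") for n
  proof -
    have "?r n = (\<integral>z. ?t (e n) y n z
      - ?t (e n) y' n z
      - ?t x y n z
      + ?t x y' n z \<partial>lborel)"
      using wKi by simp
    also have "\<dots> = ?l n"
      by (intro Bochner_Integration.integral_cong refl)
        (simp add: case_prod_unfold \<alpha>1_def \<beta>1_def algebra_simps)
    finally show ?thesis by simp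
  qed
  have "?r \<longlonglongrightarrow> w (0, y) - w (0, y') - w (x, y) + w (x, y')"
  proof (intro tendsto_add tendsto_diff)
    have "e n + e n < L" "x + e n < L" for n using e[of n] \<delta> by auto
    then show "(\<lambda>n. \<integral>z. ?t (e n) y n z \<partial>lborel) \<longlonglongrightarrow> w (0, y)"
      "(\<lambda>n. \<integral>z. ?t (e n) y' n z \<partial>lborel) \<longlonglongrightarrow> w (0, y')"
      "(\<lambda>n. \<integral>z. ?t x y n z \<partial>lborel) \<longlonglongrightarrow> w (x, y)"
      "(\<lambda>n. \<integral>z. ?t x y' n z \<partial>lborel) \<longlonglongrightarrow> w (x, y')"
      using L x e(1) by (intro lim e0 tendsto_const; simp)+
  qed
  then have "(\<lambda>n. \<integral>p. r p * tensor (\<alpha> n) (\<beta> n) p \<partial>lborel)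
      \<longlonglongrightarrow> w (0, y) - w (0, y') - w (x, y) + w (x, y')"
    by (simp only: split[symmetric] eq)
  also have "w (0, y) - w (0, y') - w (x, y) + w (x, y') = - (w (x, y) - w (x, y'))"
    using wD(2) y by simp
  finally have "(\<lambda>n. \<integral>p. r p * tensor (\<alpha> n) (\<beta> n) p \<partial>lborel)
      \<longlonglongrightarrow> - (w (x, y) - w (x, y'))" .
  then have "(\<lambda>n. \<bar>\<integral>p. r p * tensor (\<alpha> n) (\<beta> n) p \<partial>lborel\<bar>)
      \<longlonglongrightarrow> \<bar>- (w (x, y) - w (x, y'))\<bar>" by (rule tendsto_rabs)
  moreover have "\<bar>\<integral>p. r p * tensor (\<alpha> n) (\<beta> n) p \<partial>lborel\<bar> \<le> (\<integral>p. \<bar>r p\<bar> \<partial>lborel)" for n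
  proof -
    have b: "\<bar>r p * tensor (\<alpha> n) (\<beta> n) p\<bar> \<le> \<bar>r p\<bar>" for p
    proof -
      have "\<bar>\<alpha> n (fst p)\<bar> * \<bar>\<beta> n (snd p)\<bar> \<le> 1 * 1"
        unfolding \<alpha>_def \<beta>_def by (intro mult_mono Sb) auto
      then have "\<bar>r p\<bar> * (\<bar>\<alpha> n (fst p)\<bar> * \<bar>\<beta> n (snd p)\<bar>) \<le> \<bar>r p\<bar> * 1"
        by (intro mult_left_mono) auto
      then show ?thesis by (simp add: case_prod_unfold abs_mult)
    qed
    have "\<bar>\<integral>p. r p * tensor (\<alpha> n) (\<beta> n) p \<partial>lborel\<bar>
        \<le> (\<integral>p. \<bar>r p * tensor (\<alpha> n) (\<beta> n) p\<bar> \<partial>lborel)" by (rule integral_abs_bound)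
    also have "\<dots> \<le> (\<integral>p. \<bar>r p\<bar> \<partial>lborel)"
      by (rule integral_mono') (use rf(1) b in auto)
    finally show ?thesis .
  qed
  ultimately have "\<bar>- (w (x, y) - w (x, y'))\<bar> \<le> (\<integral>p. \<bar>r p\<bar> \<partial>lborel)"
    by (intro LIMSEQ_le_const2) auto
  then show ?thesis unfolding rf(3) by simp
qed

text \<open>Sobolev embedding on the narrow plate, with the dependence of the constant on the width explicit. A
value of \<open>w\<close> differs from the mean over its cross-section by at most the oscillation there.\<close>

lemma plate_sup_bound:
  assumes L: "L > 0" and l: "l > 0" and w: "w \<in> H2_star L l"
    and gxx: "has_L2_weak_deriv (plate L l) [(1, 0), (1, 0)] w wxx"
    and gxy: "has_L2_weak_deriv (plate L l) [(1, 0), (0, 1)] w wxy"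
    and p: "(x, y) \<in> plate L l"
  shows "\<bar>w (x, y)\<bar> \<le> (\<integral>p. \<bar>wxy p\<bar> \<partial>lebesgue_on (plate L l))
    + L / (2 * l) * (\<integral>p. \<bar>wxx p\<bar> \<partial>lebesgue_on (plate L l))"
proof -
  define A where "A = (\<integral>p. \<bar>wxy p\<bar> \<partial>lebesgue_on (plate L l))"
  define B where "B = (\<integral>p. \<bar>wxx p\<bar> \<partial>lebesgue_on (plate L l))"
  have A0: "A \<ge> 0" unfolding A_def by (rule Bochner_Integration.integral_nonneg) simp
  have x: "x \<in> {0<..<L}" and y: "y \<in> {-l<..<l}" using p by (auto simp: plate_def)
  note wD = H2_star_D[OF w L l]
  let ?i = "\<lambda>s. indicator {-l<..<l} s :: real"
  have c: "continuous_on {-l..l} (\<lambda>s. w (x, s))"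
    using x by (intro continuous_on_compose2[OF wD(1)]) (auto intro!: continuous_intros)
  have i1: "integrable lborel (\<lambda>s. ?i s * w (x, s))"
    by (rule continuous_on_compact_rep(2)[OF compact_Icc _ _ c]) auto
  have i2: "integrable lborel ?i" using emeasure_bounded_finite[of "{-l<..<l}"]
    by (intro integrable_real_indicator) simp_all
  have i3: "(\<integral>s. ?i s \<partial>lborel) = 2 * l" using l by simp
  have "2 * l * w (x, y) - transverse l w x = (\<integral>s. ?i s * w (x, y) \<partial>lborel) - (\<integral>s. ?i s * w (x, s) \<partial>lborel)"
    unfolding transverse_def by (simp only: integral_mult_left_zero i3)
  also have "\<dots> = (\<integral>s. ?i s * w (x, y) - ?i s * w (x, s) \<partial>lborel)"
    by (rule Bochner_Integration.integral_diff[symmetric, OF integrable_mult_left[OF i2] i1])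
  finally have "\<bar>2 * l * w (x, y) - transverse l w x\<bar>
      \<le> (\<integral>s. \<bar>?i s * w (x, y) - ?i s * w (x, s)\<bar> \<partial>lborel)"
    using integral_abs_bound[of lborel "\<lambda>s. ?i s * w (x, y) - ?i s * w (x, s)"] by simp
  also have "\<dots> \<le> (\<integral>s. ?i s * A \<partial>lborel)"
  proof (rule integral_mono')
    show "integrable lborel (\<lambda>s. ?i s * A)" by (rule integrable_mult_left[OF i2])
    fix s
    show "\<bar>?i s * w (x, y) - ?i s * w (x, s)\<bar> \<le> ?i s * A"
    proof (cases "s \<in> {-l<..<l}")
      case True
      then show ?thesis using transverse_oscillation[OF L l w gxy x y True] by (simp add: A_def)
    qed simp
    show "0 \<le> ?i s * A" using A0 by simp
  qed
  also have "\<dots> = 2 * l * A" by (simp only: integral_mult_left_zero i3)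
  finally have "\<bar>2 * l * w (x, y) - transverse l w x\<bar> \<le> 2 * l * A" .
  moreover have "\<bar>transverse l w x\<bar> \<le> L * B"
    using transverse_bound[OF L l w gxx x] unfolding B_def .
  ultimately have "\<bar>2 * l * w (x, y)\<bar> \<le> 2 * l * A + L * B" by linarith
  then have "2 * l * \<bar>w (x, y)\<bar> \<le> 2 * l * A + L * B" using l by (simp add: abs_mult)
  then have "\<bar>w (x, y)\<bar> \<le> (2 * l * A + L * B) / (2 * l)"
    using l by (simp add: le_divide_eq mult.commute)
  also have "\<dots> = A + L / (2 * l) * B" using l by (simp add: add_divide_distrib)
  finally show ?thesis unfolding A_def B_def .
qed

section \<open>The corrected beam and the energy estimate\<close>

lemma sobolev_2_plane:
  assumes "w \<in> L2 S" "has_L2_weak_deriv S [(1, 0)] w w1" "has_L2_weak_deriv S [(0, 1)] w w2"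
    and "has_L2_weak_deriv S [(1, 0), (1, 0)] w w11" "has_L2_weak_deriv S [(1, 0), (0, 1)] w w12"
    and "has_L2_weak_deriv S [(0, 1), (1, 0)] w w21" "has_L2_weak_deriv S [(0, 1), (0, 1)] w w22"
  shows "w \<in> sobolev 2 (S :: (real \<times> real) set)"
proof -
  have "\<exists>g. has_L2_weak_deriv S is w g"
    if i: "set is \<subseteq> (Basis :: (real \<times> real) set)" "length is \<le> 2" for "is"
  proof -
    consider "is = []" | i where "is = [i]" | i j where "is = [i, j]"
      using i(2) by (cases "is" rule: remdups_adj.cases) (auto simp: Suc_le_eq)
    then show ?thesis
    proof cases
      case 1
      then show ?thesis using has_L2_weak_deriv_Nil[OF assms(1)] by blast
    next
      case 2
      then show ?thesis using i(1) assms(2,3) by (auto simp: Basis_plane)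
    next
      case 3
      then show ?thesis using i(1) assms(4-7) by (auto simp: Basis_plane)
    qed
  qed
  then show ?thesis using assms(1) by (simp add: sobolev_def)
qed

lemma product_weak_derivs:
  assumes A: "absolutely_continuous_L2 0 L A A1" "absolutely_continuous_L2 0 L A1 A2"
    and B: "absolutely_continuous_L2 (-l) l B B1" "absolutely_continuous_L2 (-l) l B1 B2"
    and pos: "L > 0" "l > 0"
  defines "W \<equiv> \<lambda>(x, y). A x * B y"
  shows "W \<in> L2 (plate L l)"
    and "has_L2_weak_deriv (plate L l) [(1, 0)] W (tensor A1 B)" (is ?x)
    and "has_L2_weak_deriv (plate L l) [(0, 1)] W (tensor A B1)" (is ?y)
    and "has_L2_weak_deriv (plate L l) [(1, 0), (1, 0)] W (tensor A2 B)" (is ?xx)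
    and "has_L2_weak_deriv (plate L l) [(1, 0), (0, 1)] W (tensor A1 B1)" (is ?xy)
    and "has_L2_weak_deriv (plate L l) [(0, 1), (1, 0)] W (tensor A1 B1)" (is ?yx)
    and "has_L2_weak_deriv (plate L l) [(0, 1), (0, 1)] W (tensor A B2)" (is ?yy)
proof -
  note cA = A[THEN absolutely_continuous_L2_continuous] and cB = B[THEN absolutely_continuous_L2_continuous]
  show "W \<in> L2 (plate L l)"
    unfolding W_def by (rule L2_product_plate[OF L2_continuous_Icc[OF cA(1)] L2_continuous_Icc[OF cB(1)]])
  show 1: ?x
    unfolding W_def by (rule weak_deriv_product_1[OF A(1) cB(1) pos(1)])
  show 2: ?y
    unfolding W_def by (rule weak_deriv_product_2[OF cA(1) B(1) pos(2)])
  have b: "set [(1::real, 0::real)] \<subseteq> Basis" "set [(0::real, 1::real)] \<subseteq> Basis"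
    by (auto simp: Basis_plane)
  show ?xx
    using has_L2_weak_deriv_append[OF 1 weak_deriv_product_1[OF A(2) cB(1) pos(1)] b(1)] by simp
  show ?xy
    using has_L2_weak_deriv_append[OF 1 weak_deriv_product_2[OF cA(2) B(1) pos(2)] b(2)] by simp
  show ?yx
    using has_L2_weak_deriv_append[OF 2 weak_deriv_product_1[OF A(1) cB(2) pos(1)] b(1)] by simp
  show ?yy
    using has_L2_weak_deriv_append[OF 2 weak_deriv_product_2[OF cA(1) B(2) pos(2)] b(2)] by simp
qed

lemma H2_star_linear:
  assumes w: "w1 \<in> H2_star L l" "w2 \<in> H2_star L l"
  shows "(\<lambda>p. w1 p + c * w2 p) \<in> H2_star L l"
proof -
  have L2: "w1 \<in> L2 (plate L l)" "w2 \<in> L2 (plate L l)" using w by (auto simp: H2_star_def sobolev_def)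
  have "\<exists>g. has_L2_weak_deriv (plate L l) is (\<lambda>p. w1 p + c * w2 p) g"
    if i: "set is \<subseteq> Basis" "length is \<le> 2" for "is"
  proof -
    have "\<exists>g. has_L2_weak_deriv (plate L l) is w1 g" "\<exists>g. has_L2_weak_deriv (plate L l) is w2 g"
      using w i unfolding H2_star_def sobolev_def by blast+
    then obtain g1 g2 where "has_L2_weak_deriv (plate L l) is w1 g1" "has_L2_weak_deriv (plate L l) is w2 g2"
      by blast
    from has_L2_weak_deriv_linear[OF this(1) L2(1) this(2) L2(2) _ i(1)] show ?thesis by auto
  qed
  moreover have "(\<lambda>p. w1 p + c * w2 p) \<in> L2 (plate L l)"
    using L2_add[OF L2(1) L2_scale[OF L2(2)]] .
  moreover have "continuous_on (closure (plate L l)) (\<lambda>p. w1 p + c * w2 p)"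
    using w by (auto simp: H2_star_def intro!: continuous_intros)
  ultimately show ?thesis using w by (auto simp: H2_star_def sobolev_def)
qed

lemma weak_hessian_linear:
  assumes "weak_hessian (plate L l) w1 axx axy ayy" "weak_hessian (plate L l) w2 bxx bxy byy"
    and "w1 \<in> L2 (plate L l)" "w2 \<in> L2 (plate L l)"
  shows "weak_hessian (plate L l) (\<lambda>p. w1 p + c * w2 p)
    (\<lambda>p. axx p + c * bxx p) (\<lambda>p. axy p + c * bxy p) (\<lambda>p. ayy p + c * byy p)"
  using assms unfolding weak_hessian_def
  by (auto intro!: has_L2_weak_deriv_linear simp: Basis_plane)

text \<open>The subtracted term curves the cross-sections by \<open>- \<nu> \<psi>''\<close>, the curvature for which the bending moment
across the free edges vanishes to leading order. The condition on \<open>\<psi>''\<close> at the ends keeps the sum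
zero on the hinged edges.\<close>

lemma corrected_beam_H2_star:
  fixes \<nu> :: real
  assumes A: "absolutely_continuous_L2 0 L \<psi> \<psi>1" "absolutely_continuous_L2 0 L \<psi>1 \<psi>2"
      "absolutely_continuous_L2 0 L \<psi>2 \<psi>3" "absolutely_continuous_L2 0 L \<psi>3 \<psi>4"
    and bc: "\<psi> 0 = 0" "\<psi> L = 0" "\<psi>2 0 = 0" "\<psi>2 L = 0" and pos: "L > 0" "l > 0"
  defines "z \<equiv> \<lambda>(x, y). \<psi> x - \<nu> / 2 * (y\<^sup>2 * \<psi>2 x)"
  shows "z \<in> H2_star L l"
    and "weak_hessian (plate L l) z (\<lambda>(x, y). \<psi>2 x - \<nu> / 2 * (y\<^sup>2 * \<psi>4 x))
      (\<lambda>(x, y). - \<nu> * (y * \<psi>3 x)) (\<lambda>(x, y). - \<nu> * \<psi>2 x)" (is ?hessian)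
proof -
  define V where "V = (\<lambda>(x, y::real). \<psi> x * 1)"
  define W where "W = (\<lambda>(x, y::real). \<psi>2 x * y\<^sup>2)"
  have z: "z = (\<lambda>p. V p + (- \<nu> / 2) * W p)"
    by (auto simp: z_def V_def W_def fun_eq_iff)
  have Y: "absolutely_continuous_L2 (-l) l (\<lambda>y. 1) (\<lambda>y. 0)" "absolutely_continuous_L2 (-l) l (\<lambda>y. 0) (\<lambda>y. 0)"
    "absolutely_continuous_L2 (-l) l (\<lambda>y. y\<^sup>2) (\<lambda>y. 2 * y)" "absolutely_continuous_L2 (-l) l (\<lambda>y. 2 * y) (\<lambda>y. 2)"
    by (rule absolutely_continuous_L2_C1; auto intro!: derivative_eq_intros continuous_intros)+
  note v = product_weak_derivs[OF A(1,2) Y(1,2) pos, folded V_def]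
  note w = product_weak_derivs[OF A(3,4) Y(3,4) pos, folded W_def]
  have cont: "continuous_on ({0..L} \<times> {-l..l}) V" "continuous_on ({0..L} \<times> {-l..l}) W"
    unfolding V_def W_def case_prod_unfold
    by (intro continuous_intros continuous_on_compose2[OF absolutely_continuous_L2_continuous[OF A(1)]]
        continuous_on_compose2[OF absolutely_continuous_L2_continuous[OF A(3)]]; auto)+
  have "V \<in> H2_star L l" "W \<in> H2_star L l"
    using sobolev_2_plane[OF v] sobolev_2_plane[OF w] cont pos bc
    by (auto simp: H2_star_def closure_plate V_def W_def)
  then show "z \<in> H2_star L l" unfolding z by (rule H2_star_linear)
  have hV: "weak_hessian (plate L l) V (\<lambda>(x, y). \<psi>2 x * 1) (\<lambda>(x, y). \<psi>1 x * 0) (\<lambda>(x, y). \<psi> x * 0)"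
    unfolding weak_hessian_def using v(4,5,7) by blast
  have hW: "weak_hessian (plate L l) W (\<lambda>(x, y). \<psi>4 x * y\<^sup>2) (\<lambda>(x, y). \<psi>3 x * (2 * y)) (\<lambda>(x, y). \<psi>2 x * 2)"
    unfolding weak_hessian_def using w(4,5,7) by blast
  have "weak_hessian (plate L l) z
      (\<lambda>p. (\<lambda>(x, y). \<psi>2 x * 1) p + (- \<nu> / 2) * (\<lambda>(x, y). \<psi>4 x * y\<^sup>2) p)
      (\<lambda>p. (\<lambda>(x, y). \<psi>1 x * 0) p + (- \<nu> / 2) * (\<lambda>(x, y). \<psi>3 x * (2 * y)) p)
      (\<lambda>p. (\<lambda>(x, y). \<psi> x * 0) p + (- \<nu> / 2) * (\<lambda>(x, y). \<psi>2 x * 2) p)"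
    unfolding z by (rule weak_hessian_linear[OF hV hW v(1) w(1)])
  then show ?hessian
    by (simp add: case_prod_unfold mult_ac)
qed

text \<open>On the right stand the energy density of \<open>w\<close> and the residual of the corrected beam, with \<open>X\<close>, \<open>S\<close>, \<open>Y\<close>
for the second derivatives of \<open>w\<close> and \<open>p\<close>, \<open>q\<close> for the third and fourth derivative of \<open>\<psi>\<close>. As
\<open>1 - \<nu> \<ge> 1/2\<close>, the energy density controls half of the squares; by Young's inequality
\<open>s t \<le> t\<^sup>2/4 + s\<^sup>2\<close>, half of that absorbs the residual up to the last term, as the coefficients of the residual are at most
of order \<open>l\<close>.\<close>

lemma energy_density_bound:
  fixes \<nu> \<kappa> X Y S y l p q :: real
  assumes \<nu>: "0 \<le> \<nu>" "\<nu> \<le> 1 / 2" and \<kappa>: "\<kappa> \<ge> 0" and y: "\<bar>y\<bar> \<le> l" "l \<le> 1"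
  shows "(X\<^sup>2 + S\<^sup>2 + Y\<^sup>2) / 4 \<le>
    (\<nu> * ((X + Y) * (X + Y)) + (1 - \<nu>) * (X * X + 2 * (S * S) + Y * Y) + \<kappa> * (X * X))
    + (- ((1 + \<kappa>) * \<nu> / 2) * (y\<^sup>2 * q * X) - 2 * (1 - \<nu>) * \<nu> * (y * p * S) - \<nu>\<^sup>2 / 2 * (y\<^sup>2 * q * Y))
    + ((1 + \<kappa>)\<^sup>2 + 5) * l\<^sup>2 * (p\<^sup>2 + q\<^sup>2)"
proof -
  define a where "a = (1 + \<kappa>) * \<nu> / 2 * (y\<^sup>2 * q)"
  define b where "b = 2 * (1 - \<nu>) * \<nu> * (y * p)"
  define c where "c = \<nu>\<^sup>2 / 2 * (y\<^sup>2 * q)"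
  have young: "s * t \<le> t\<^sup>2 / 4 + s\<^sup>2" for s t :: real
    using zero_le_power2[of "t / 2 - s"] by (simp add: power2_eq_square algebra_simps)
  have y2: "y\<^sup>2 \<le> l\<^sup>2" using y(1) by (metis abs_ge_zero power2_abs power_mono)
  have l0: "0 \<le> l" using y by linarith
  have l1: "l\<^sup>2 \<le> 1" using y(2) l0 by (simp add: power_le_one)
  have y4: "(y\<^sup>2)\<^sup>2 \<le> l\<^sup>2"
  proof -
    have "(y\<^sup>2)\<^sup>2 = y\<^sup>2 * y\<^sup>2" by (simp add: power2_eq_square)
    also have "\<dots> \<le> l\<^sup>2 * 1" using y2 l1 by (intro mult_mono) auto
    finally show ?thesis by simp
  qed
  have sq: "(k * t)\<^sup>2 \<le> m * (l\<^sup>2 * r\<^sup>2)" if "k\<^sup>2 \<le> m" "t\<^sup>2 \<le> l\<^sup>2 * r\<^sup>2" "0 \<le> m" for k t m r :: real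
    using that unfolding power_mult_distrib by (intro mult_mono) auto
  have q4: "(y\<^sup>2 * q)\<^sup>2 \<le> l\<^sup>2 * q\<^sup>2" unfolding power_mult_distrib using y4 by (intro mult_right_mono) auto
  have p2: "(y * p)\<^sup>2 \<le> l\<^sup>2 * p\<^sup>2" unfolding power_mult_distrib using y2 by (intro mult_right_mono) auto
  have "((1 + \<kappa>) * \<nu> / 2)\<^sup>2 \<le> (1 + \<kappa>)\<^sup>2"
  proof (rule power_mono)
    show "(1 + \<kappa>) * \<nu> / 2 \<le> 1 + \<kappa>" using \<nu> \<kappa> mult_left_mono[of \<nu> 2 "1 + \<kappa>"] by simp
  qed (use \<nu> \<kappa> in simp)
  from sq[OF this q4] have a2: "a\<^sup>2 \<le> (1 + \<kappa>)\<^sup>2 * (l\<^sup>2 * q\<^sup>2)" by (simp add: a_def)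
  have n1: "(1 - \<nu>) * \<nu> \<le> 1 * 1" using \<nu> by (intro mult_mono) auto
  have "(2 * (1 - \<nu>) * \<nu>)\<^sup>2 \<le> 2\<^sup>2"
  proof (rule power_mono)
    show "2 * (1 - \<nu>) * \<nu> \<le> 2" using n1 by (simp only: mult.assoc)
    show "0 \<le> 2 * (1 - \<nu>) * \<nu>" using \<nu> by simp
  qed
  from sq[OF this p2] have b2: "b\<^sup>2 \<le> 4 * (l\<^sup>2 * p\<^sup>2)" by (simp add: b_def)
  have "\<nu>\<^sup>2 \<le> 1" using \<nu> by (intro power_le_one) auto
  then have "(\<nu>\<^sup>2 / 2)\<^sup>2 \<le> 1" by (intro power_le_one) auto
  from sq[OF this q4] have c2: "c\<^sup>2 \<le> 1 * (l\<^sup>2 * q\<^sup>2)" by (simp add: c_def)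
  have "(X\<^sup>2 + S\<^sup>2 + Y\<^sup>2) / 2 \<le> (1 - \<nu>) * (X * X + 2 * (S * S) + Y * Y)"
  proof -
    have "(X\<^sup>2 + S\<^sup>2 + Y\<^sup>2) / 2 \<le> (1 / 2) * (X * X + 2 * (S * S) + Y * Y)"
      unfolding power2_eq_square by simp
    also have "\<dots> \<le> (1 - \<nu>) * (X * X + 2 * (S * S) + Y * Y)"
      using \<nu> by (intro mult_right_mono) auto
    finally show ?thesis .
  qed
  moreover have "0 \<le> \<nu> * ((X + Y) * (X + Y))" "0 \<le> \<kappa> * (X * X)" using \<nu> \<kappa> by auto
  ultimately have Q: "(X\<^sup>2 + S\<^sup>2 + Y\<^sup>2) / 2 \<le>
      \<nu> * ((X + Y) * (X + Y)) + (1 - \<nu>) * (X * X + 2 * (S * S) + Y * Y) + \<kappa> * (X * X)" by linarith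
  have R: "- ((1 + \<kappa>) * \<nu> / 2) * (y\<^sup>2 * q * X) - 2 * (1 - \<nu>) * \<nu> * (y * p * S) - \<nu>\<^sup>2 / 2 * (y\<^sup>2 * q * Y)
      = - (a * X) - b * S - c * Y"
    by (simp add: a_def b_def c_def)
  have B: "a\<^sup>2 + b\<^sup>2 + c\<^sup>2 \<le> ((1 + \<kappa>)\<^sup>2 + 5) * l\<^sup>2 * (p\<^sup>2 + q\<^sup>2)"
  proof -
    have "a\<^sup>2 + b\<^sup>2 + c\<^sup>2 \<le> (1 + \<kappa>)\<^sup>2 * (l\<^sup>2 * q\<^sup>2) + 4 * (l\<^sup>2 * p\<^sup>2) + 1 * (l\<^sup>2 * q\<^sup>2)"
      by (intro add_mono a2 b2 c2)
    also have "\<dots> \<le> \<dots> + ((1 + \<kappa>)\<^sup>2 * (l\<^sup>2 * p\<^sup>2) + l\<^sup>2 * p\<^sup>2 + 4 * (l\<^sup>2 * q\<^sup>2))" by simp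
    also have "\<dots> = ((1 + \<kappa>)\<^sup>2 + 5) * l\<^sup>2 * (p\<^sup>2 + q\<^sup>2)" by (simp add: algebra_simps)
    finally show ?thesis .
  qed
  have combine: "(x + s + y) / 4 \<le> U + (- r - s' - t) + V"
    if "(x + s + y) / 2 \<le> U" "a' + b' + c' \<le> V" "r \<le> x / 4 + a'" "s' \<le> s / 4 + b'" "t \<le> y / 4 + c'"
    for U V x s y r s' t a' b' c' :: real
    using that by argo
  show ?thesis unfolding R by (rule combine[OF Q B young young young])
qed

lemma AE_plate_fst:
  assumes "AE x in lebesgue_on {0<..<L}. P x"
  shows "AE p in lebesgue_on (plate L l). P (fst p)"
proof -
  have "AE x in lborel. x \<in> {0<..<L} \<longrightarrow> P x"
    using assms by (simp add: AE_restrict_space_iff AE_completion_iff)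
  then have "AE p in lborel. fst (p::real\<times>real) \<in> {0<..<L} \<longrightarrow> P (fst p)" by (rule AE_lborel_coordinates(1))
  then have "AE p in lborel. p \<in> plate L l \<longrightarrow> P (fst p)"
    by (rule AE_mp) (auto simp: plate_def)
  then show ?thesis by (subst AE_restrict_space_iff) (simp_all add: AE_completion_iff)
qed

lemma plate_integral_fst:
  assumes h: "integrable (lebesgue_on {0<..<L}) h" and l: "l > 0"
  shows "integrable (lebesgue_on (plate L l)) (\<lambda>p. h (fst p))"
    and "(\<integral>p. h (fst p) \<partial>lebesgue_on (plate L l)) = 2 * l * (\<integral>x. h x \<partial>lebesgue_on {0<..<L})"
proof -
  obtain r where r: "borel_rep {0<..<L} h r"
    by (rule borel_rep_exists[OF borel_measurable_integrable[OF h]]) simp_all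
  let ?one = "indicator {-l<..<l} :: real \<Rightarrow> real"
  note one = indicator_rep[of l]
  have ri: "integrable lborel r" using borel_rep_integral(3)[OF r] h by simp
  have rep: "borel_rep (plate L l) (\<lambda>p. h (fst p)) (tensor r ?one)"
    using plate_product_rep[OF r one(1)] by (simp add: case_prod_unfold)
  show "integrable (lebesgue_on (plate L l)) (\<lambda>p. h (fst p))"
    using borel_rep_integral(3)[OF rep plate_borel] product_integrable[OF ri one(2)] by simp
  have "(\<integral>y. ?one y \<partial>lborel) = 2 * l" using l by simp
  then show "(\<integral>p. h (fst p) \<partial>lebesgue_on (plate L l)) = 2 * l * (\<integral>x. h x \<partial>lebesgue_on {0<..<L})"
    using borel_rep_integral(2)[OF rep plate_borel] integral_product[OF ri one(2)]
      borel_rep_integral(2)[OF r] by simp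
qed

text \<open>Subtract from the equation of the plate, tested with \<open>w = u - z\<close>, the same form evaluated at the
corrected beam \<open>z\<close>. The load and the leading part of \<open>z\<close> cancel by the beam equation, so the energy
of \<open>w\<close> equals minus the residual of \<open>z\<close> tested with \<open>w\<close>. Of the factor \<open>l ^ 3\<close>, \<open>l\<^sup>2\<close> comes from the coefficients of the residual
and \<open>l\<close> from integrating the beam derivatives over the width.\<close>

lemma plate_beam_energy:
  fixes L l d K \<kappa> \<nu> :: real and f \<psi> :: "real \<Rightarrow> real"
  assumes pos: "L > 0" "l > 0" and l1: "l \<le> 1" and \<nu>: "0 \<le> \<nu>" "\<nu> \<le> 1 / 2" and \<kappa>: "\<kappa> \<ge> 0"
    and K: "d ^ 3 * K / 12 > 0"
    and A: "absolutely_continuous_L2 0 L \<psi> \<psi>1" "absolutely_continuous_L2 0 L \<psi>1 \<psi>2"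
      "absolutely_continuous_L2 0 L \<psi>2 \<psi>3" "absolutely_continuous_L2 0 L \<psi>3 \<psi>4"
    and d2: "\<And>x. x \<in> {0..L} \<Longrightarrow> (\<psi>2 has_real_derivative \<psi>3 x) (at x within {0..L})"
    and bc: "\<psi> 0 = 0" "\<psi> L = 0" "\<psi>2 0 = 0" "\<psi>2 L = 0"
    and f: "f \<in> L2 {0<..<L}" "AE x in lebesgue_on {0<..<L}. d ^ 3 * K / 12 * (1 + \<kappa> - \<nu>\<^sup>2) * \<psi>4 x = f x"
    and sol: "plate_solution L l d K \<kappa> \<nu> (\<lambda>(x, y). f x) u"
  obtains w wxx wxy wyy where "w \<in> H2_star L l" "weak_hessian (plate L l) w wxx wxy wyy"
    "\<And>x y. w (x, y) = u (x, y) - \<psi> x + \<nu> / 2 * (y\<^sup>2 * \<psi>2 x)"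
    "(\<integral>p. (wxx p)\<^sup>2 + (wxy p)\<^sup>2 + (wyy p)\<^sup>2 \<partial>lebesgue_on (plate L l)) \<le>
      8 * ((1 + \<kappa>)\<^sup>2 + 5) * (\<integral>x. (\<psi>3 x)\<^sup>2 + (\<psi>4 x)\<^sup>2 \<partial>lebesgue_on {0<..<L}) * l ^ 3"
proof -
  let ?M = "lebesgue_on (plate L l)"
  define c0 where "c0 = d ^ 3 * K / 12"
  have c0: "c0 > 0" using K by (simp add: c0_def)
  define z where "z = (\<lambda>(x, y). \<psi> x - \<nu> / 2 * (y\<^sup>2 * \<psi>2 x))"
  define zxx where "zxx = (\<lambda>(x, y). \<psi>2 x - \<nu> / 2 * (y\<^sup>2 * \<psi>4 x))"
  define zxy where "zxy = (\<lambda>(x, y). - \<nu> * (y * \<psi>3 x))"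
  define zyy where "zyy = (\<lambda>(x, y::real). - \<nu> * \<psi>2 x)"
  have zH: "z \<in> H2_star L l" and hz: "weak_hessian (plate L l) z zxx zxy zyy"
    using corrected_beam_H2_star[OF A bc pos, of \<nu>]
    unfolding z_def zxx_def zxy_def zyy_def by blast+
  have uH: "u \<in> H2_star L l" using sol unfolding plate_solution_def by blast
  obtain uxx uxy uyy where hu: "weak_hessian (plate L l) u uxx uxy uyy"
    and eqn: "\<And>v vxx vxy vyy. v \<in> H2_star L l \<Longrightarrow> weak_hessian (plate L l) v vxx vxy vyy \<Longrightarrow>
      c0 * (\<integral>p. \<nu> * ((uxx p + uyy p) * (vxx p + vyy p))
                + (1 - \<nu>) * (uxx p * vxx p + 2 * (uxy p * vxy p) + uyy p * vyy p)
                + \<kappa> * (uxx p * vxx p) \<partial>?M) = (\<integral>p. (\<lambda>(x, y). f x) p * v p \<partial>?M)"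
    using sol unfolding plate_solution_def c0_def by blast
  define w where "w = (\<lambda>p. u p + (-1) * z p)"
  define wxx where "wxx = (\<lambda>p. uxx p + (-1) * zxx p)"
  define wxy where "wxy = (\<lambda>p. uxy p + (-1) * zxy p)"
  define wyy where "wyy = (\<lambda>p. uyy p + (-1) * zyy p)"
  have wH: "w \<in> H2_star L l" unfolding w_def by (rule H2_star_linear[OF uH zH])
  have hw: "weak_hessian (plate L l) w wxx wxy wyy"
    unfolding w_def wxx_def wxy_def wyy_def
    by (rule weak_hessian_linear[OF hu hz H2_star_D(4)[OF uH pos] H2_star_D(4)[OF zH pos]])
  have wL2: "wxx \<in> L2 (plate L l)" "wxy \<in> L2 (plate L l)" "wyy \<in> L2 (plate L l)"
    using hw by (auto simp: weak_hessian_def has_L2_weak_deriv_def)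
  have \<psi>L2: "\<psi>2 \<in> L2 {0<..<L}" "\<psi>3 \<in> L2 {0<..<L}" "\<psi>4 \<in> L2 {0<..<L}"
    using A unfolding absolutely_continuous_L2_def by blast+
  have cL2: "(\<lambda>y. c y) \<in> L2 {-l<..<l}" if "continuous_on UNIV c" for c
    using that by (intro L2_continuous_Icc) (auto intro: continuous_on_subset)
  have pL2: "(\<lambda>p. h (fst p) * c (snd p)) \<in> L2 (plate L l)" if "h \<in> L2 {0<..<L}" "continuous_on UNIV c" for h c
    using L2_product_plate[OF that(1) cL2[OF that(2)]] by (simp add: case_prod_unfold)
  have a2: "(\<lambda>p. \<psi>2 (fst p)) \<in> L2 (plate L l)"
    using pL2[OF \<psi>L2(1), of "\<lambda>y. 1"] by simp
  have b3: "(\<lambda>p. snd p * \<psi>3 (fst p)) \<in> L2 (plate L l)"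
    using pL2[OF \<psi>L2(2), of "\<lambda>y. y"] by (simp add: mult.commute)
  have b4: "(\<lambda>p. (snd p)\<^sup>2 * \<psi>4 (fst p)) \<in> L2 (plate L l)"
    using pL2[OF \<psi>L2(3), of "\<lambda>y. y\<^sup>2"] by (simp add: mult.commute continuous_intros)
  define q where "q p = \<nu> * ((wxx p + wyy p) * (wxx p + wyy p))
      + (1 - \<nu>) * (wxx p * wxx p + 2 * (wxy p * wxy p) + wyy p * wyy p) + \<kappa> * (wxx p * wxx p)" for p
  \<comment> \<open>The integrand of the form at \<open>u = w + z\<close> splits into the energy density \<open>q\<close> of \<open>w\<close>, the residual \<open>\<rho>\<close>
    and the beam term.\<close>
  define \<rho> where "\<rho> p = - ((1 + \<kappa>) * \<nu> / 2) * ((snd p)\<^sup>2 * \<psi>4 (fst p) * wxx p)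
      - 2 * (1 - \<nu>) * \<nu> * (snd p * \<psi>3 (fst p) * wxy p) - \<nu>\<^sup>2 / 2 * ((snd p)\<^sup>2 * \<psi>4 (fst p) * wyy p)" for p
  have iq: "integrable ?M q"
    unfolding q_def[abs_def]
    by (intro Bochner_Integration.integrable_add integrable_mult_right L2_prod_integrable L2_add wL2)
  have i\<rho>: "integrable ?M \<rho>"
    unfolding \<rho>_def[abs_def]
    by (intro Bochner_Integration.integrable_diff integrable_mult_right L2_prod_integrable b3 b4 wL2)
  have ia: "integrable ?M (\<lambda>p. \<psi>2 (fst p) * wxx p)" by (rule L2_prod_integrable[OF a2 wL2(1)])
  have "\<nu> * ((uxx p + uyy p) * (wxx p + wyy p))
       + (1 - \<nu>) * (uxx p * wxx p + 2 * (uxy p * wxy p) + uyy p * wyy p) + \<kappa> * (uxx p * wxx p)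
     = q p + \<rho> p + (1 + \<kappa> - \<nu>\<^sup>2) * (\<psi>2 (fst p) * wxx p)" for p
  proof -
    have u: "uxx p = wxx p + (\<psi>2 (fst p) - \<nu> / 2 * ((snd p)\<^sup>2 * \<psi>4 (fst p)))"
      "uxy p = wxy p + - \<nu> * (snd p * \<psi>3 (fst p))" "uyy p = wyy p + - \<nu> * \<psi>2 (fst p)"
      by (auto simp: wxx_def wxy_def wyy_def zxx_def zxy_def zyy_def case_prod_unfold)
    show ?thesis unfolding q_def \<rho>_def u by (simp add: field_simps power2_eq_square)
  qed
  then have "c0 * (\<integral>p. q p + \<rho> p + (1 + \<kappa> - \<nu>\<^sup>2) * (\<psi>2 (fst p) * wxx p) \<partial>?M) =
      (\<integral>p. (\<lambda>(x, y). f x) p * w p \<partial>?M)"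
    using eqn[OF wH hw] by simp
  also have "(\<integral>p. q p + \<rho> p + (1 + \<kappa> - \<nu>\<^sup>2) * (\<psi>2 (fst p) * wxx p) \<partial>?M) =
      (\<integral>p. q p \<partial>?M) + (\<integral>p. \<rho> p \<partial>?M) + (1 + \<kappa> - \<nu>\<^sup>2) * (\<integral>p. \<psi>2 (fst p) * wxx p \<partial>?M)"
    using iq i\<rho> ia by simp
  also have "(\<integral>p. \<psi>2 (fst p) * wxx p \<partial>?M) = (\<integral>p. \<psi>4 (fst p) * w p \<partial>?M)"
    using hw d2 bc unfolding weak_hessian_def by (intro bending_duality[OF pos wH _ A(4)]) auto
  finally have e1: "c0 * ((\<integral>p. q p \<partial>?M) + (\<integral>p. \<rho> p \<partial>?M)
      + (1 + \<kappa> - \<nu>\<^sup>2) * (\<integral>p. \<psi>4 (fst p) * w p \<partial>?M)) = (\<integral>p. (\<lambda>(x, y). f x) p * w p \<partial>?M)" .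
  have load: "(\<integral>p. (\<lambda>(x, y). f x) p * w p \<partial>?M) = (\<integral>p. c0 * (1 + \<kappa> - \<nu>\<^sup>2) * (\<psi>4 (fst p) * w p) \<partial>?M)"
  proof (rule integral_cong_AE)
    have wm: "w \<in> borel_measurable ?M" using L2_D(1)[OF H2_star_D(4)[OF wH pos]] .
    have "(\<lambda>p. f (fst p)) \<in> borel_measurable ?M"
      using L2_D(1)[OF pL2[OF f(1), of "\<lambda>y. 1"]] by simp
    then show "(\<lambda>p. (\<lambda>(x, y). f x) p * w p) \<in> borel_measurable ?M"
      using wm by (simp add: case_prod_unfold)
    have "(\<lambda>p. \<psi>4 (fst p)) \<in> borel_measurable ?M"
      using L2_D(1)[OF pL2[OF \<psi>L2(3), of "\<lambda>y. 1"]] by simp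
    then show "(\<lambda>p. c0 * (1 + \<kappa> - \<nu>\<^sup>2) * (\<psi>4 (fst p) * w p)) \<in> borel_measurable ?M"
      using wm by simp
    have "AE p in ?M. c0 * (1 + \<kappa> - \<nu>\<^sup>2) * \<psi>4 (fst p) = f (fst p)"
      using AE_plate_fst[OF f(2)] unfolding c0_def .
    then show "AE p in ?M. (\<lambda>(x, y). f x) p * w p = c0 * (1 + \<kappa> - \<nu>\<^sup>2) * (\<psi>4 (fst p) * w p)"
      by eventually_elim (simp add: case_prod_unfold flip: mult.assoc)
  qed
  have "c0 * ((\<integral>p. q p \<partial>?M) + (\<integral>p. \<rho> p \<partial>?M)) = 0"
    using e1 unfolding load integral_mult_right_zero by (simp add: distrib_left mult.assoc)
  then have orth: "(\<integral>p. q p \<partial>?M) + (\<integral>p. \<rho> p \<partial>?M) = 0" using c0 by simp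
  define C where "C = (1 + \<kappa>)\<^sup>2 + 5"
  define h where "h x = (\<psi>3 x)\<^sup>2 + (\<psi>4 x)\<^sup>2" for x
  have hi: "integrable (lebesgue_on {0<..<L}) h"
    unfolding h_def[abs_def] by (intro Bochner_Integration.integrable_add L2_D(2) \<psi>L2)
  note ih = plate_integral_fst[OF hi pos(2)]
  have iw: "integrable ?M (\<lambda>p. (wxx p)\<^sup>2 + (wxy p)\<^sup>2 + (wyy p)\<^sup>2)"
    by (intro Bochner_Integration.integrable_add L2_D(2) wL2)
  have "(\<integral>p. ((wxx p)\<^sup>2 + (wxy p)\<^sup>2 + (wyy p)\<^sup>2) / 4 \<partial>?M) \<le> (\<integral>p. q p + \<rho> p + C * l\<^sup>2 * h (fst p) \<partial>?M)"
  proof (rule integral_mono)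
    show "integrable ?M (\<lambda>p. ((wxx p)\<^sup>2 + (wxy p)\<^sup>2 + (wyy p)\<^sup>2) / 4)" using iw by simp
    show "integrable ?M (\<lambda>p. q p + \<rho> p + C * l\<^sup>2 * h (fst p))"
      by (intro Bochner_Integration.integrable_add integrable_mult_right iq i\<rho> ih(1))
    fix p assume "p \<in> space ?M"
    then have "\<bar>snd p\<bar> \<le> l" by (auto simp: plate_def)
    from energy_density_bound[OF \<nu> \<kappa> this l1, of "wxx p" "wxy p" "wyy p" "\<psi>4 (fst p)" "\<psi>3 (fst p)"]
    show "((wxx p)\<^sup>2 + (wxy p)\<^sup>2 + (wyy p)\<^sup>2) / 4 \<le> q p + \<rho> p + C * l\<^sup>2 * h (fst p)"
      unfolding q_def \<rho>_def C_def h_def .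
  qed
  also have "\<dots> = (\<integral>p. q p \<partial>?M) + (\<integral>p. \<rho> p \<partial>?M) + C * l\<^sup>2 * (\<integral>p. h (fst p) \<partial>?M)"
    using iq i\<rho> ih(1) by simp
  also have "\<dots> = C * l\<^sup>2 * (2 * l * (\<integral>x. h x \<partial>lebesgue_on {0<..<L}))"
    unfolding orth ih(2) by simp
  finally have "(\<integral>p. (wxx p)\<^sup>2 + (wxy p)\<^sup>2 + (wyy p)\<^sup>2 \<partial>?M) / 4 \<le>
      C * l\<^sup>2 * (2 * l * (\<integral>x. h x \<partial>lebesgue_on {0<..<L}))"
    by simp
  then have "(\<integral>p. (wxx p)\<^sup>2 + (wxy p)\<^sup>2 + (wyy p)\<^sup>2 \<partial>?M) \<le>
      8 * C * (\<integral>x. h x \<partial>lebesgue_on {0<..<L}) * l ^ 3"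
    by (simp add: power2_eq_square power3_eq_cube mult_ac)
  then show ?thesis
    using that[OF wH hw] unfolding C_def h_def by (simp add: w_def z_def)
qed

text \<open>The weight in \<open>|g| \<le> g\<^sup>2 / (2 l) + l / 2\<close> balances the two integrals: both are of order \<open>l\<^sup>2\<close>.\<close>

lemma L1_norm_plate_bound:
  assumes g: "g \<in> L2 (plate L l)" and pos: "L > 0" "l > 0"
    and b: "(\<integral>p. (g p)\<^sup>2 \<partial>lebesgue_on (plate L l)) \<le> D * l ^ 3"
  shows "(\<integral>p. \<bar>g p\<bar> \<partial>lebesgue_on (plate L l)) \<le> (D / 2 + L) * l\<^sup>2"
proof -
  let ?M = "lebesgue_on (plate L l)"
  have i1: "integrable (lebesgue_on {0<..<L}) (\<lambda>x. l)"
    using L2_D(2)[OF L2_continuous_Icc[OF continuous_on_const[of "{0..L}" "sqrt l"]]] pos by simp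
  have m1: "(\<integral>x. l \<partial>lebesgue_on {0<..<L}) = L * l"
    using pos by (simp add: measure_restrict_space)
  note i2 = plate_integral_fst[OF i1 pos(2)]
  have "(\<integral>p. \<bar>g p\<bar> \<partial>?M) \<le> (\<integral>p. (g p)\<^sup>2 / (2 * l) + l / 2 \<partial>?M)"
  proof (rule integral_mono')
    show "integrable ?M (\<lambda>p. (g p)\<^sup>2 / (2 * l) + l / 2)"
      using L2_D(2)[OF g] i2(1) by (intro Bochner_Integration.integrable_add integrable_divide)
    fix p
    have "2 * l * \<bar>g p\<bar> \<le> (g p)\<^sup>2 + l\<^sup>2"
      using sum_squares_bound[of "\<bar>g p\<bar>" l] by (simp add: mult_ac)
    then have "\<bar>g p\<bar> \<le> ((g p)\<^sup>2 + l\<^sup>2) / (2 * l)" using pos by (simp add: le_divide_eq mult_ac)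
    also have "\<dots> = (g p)\<^sup>2 / (2 * l) + l / 2" using pos by (simp add: add_divide_distrib power2_eq_square)
    finally show "\<bar>g p\<bar> \<le> (g p)\<^sup>2 / (2 * l) + l / 2" .
    show "0 \<le> (g p)\<^sup>2 / (2 * l) + l / 2" using pos by simp
  qed
  also have "\<dots> = (\<integral>p. (g p)\<^sup>2 \<partial>?M) / (2 * l) + (\<integral>p. l \<partial>?M) / 2"
    using L2_D(2)[OF g] i2(1) by (subst Bochner_Integration.integral_add) auto
  also have "\<dots> \<le> D * l ^ 3 / (2 * l) + 2 * l * (L * l) / 2"
    using b pos i2(2) m1 by (intro add_mono divide_right_mono) auto
  also have "\<dots> = (D / 2 + L) * l\<^sup>2"
    using pos by (simp add: power2_eq_square power3_eq_cube field_simps)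
  finally show ?thesis .
qed

theorem theorem4p1:
  fixes L d E1 E2 \<nu> \<nu>21 K \<kappa> E :: real
    and f \<psi> :: "real \<Rightarrow> real"
    and u :: "real \<Rightarrow> real \<times> real \<Rightarrow> real"
  assumes "L > 0" and "d > 0"
    and "E1 > E2" and "E2 > 0"
    and "0 < \<nu>" and "\<nu> < 1 / 2"
    and "\<nu>21 = \<nu> * E2 / E1"
    and "K = E2 / (1 - \<nu> * \<nu>21)"
    and "\<kappa> = (E1 - E2) / E2"
    and "E = (\<kappa> + 1 - \<nu>\<^sup>2) * K"
    and "f \<in> L2 {0<..<L}"
    and "\<And>\<l>. \<l> > 0 \<Longrightarrow> plate_solution L \<l> d K \<kappa> \<nu> (\<lambda>(x, y). f x) (u \<l>)"
    and "\<And>\<l>. \<l> > 0 \<Longrightarrow> beam_solution L (E * (d ^ 3 * \<l> / 6)) (\<lambda>x. 2 * \<l> * f x) \<psi>"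
  shows "((\<lambda>\<l>. SUP (x, y) \<in> plate L \<l>. \<bar>u \<l> (x, y) - \<psi> x\<bar>) \<longlongrightarrow> 0) (at_right 0)"
proof -
  note L = assms(1) and d = assms(2) and \<nu> = assms(5,6) and sol = assms(12)
  have \<kappa>: "\<kappa> > 0" using assms(3,4,9) by simp
  have "\<nu> * \<nu>21 < 1"
  proof -
    have "\<nu> * \<nu> \<le> 1 * 1" using \<nu> by (intro mult_mono) auto
    moreover have "E2 / E1 < 1" "0 < E2 / E1" using assms(3,4) by auto
    ultimately have "(\<nu> * \<nu>) * (E2 / E1) < 1"
      using mult_right_mono[of "\<nu> * \<nu>" 1 "E2 / E1"] by simp
    then show ?thesis by (simp add: assms(7))
  qed
  then have K: "d ^ 3 * K / 12 > 0" using d assms(4,8) by simp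
  \<comment> \<open>Both sides of the beam equation are proportional to \<open>\<l>\<close>, so the instance \<open>\<l> = 1\<close> contains all of them.\<close>
  obtain \<psi>1 \<psi>2 \<psi>3 \<psi>4 where D: "\<forall>x\<in>{0..L}. (\<psi> has_real_derivative \<psi>1 x) (at x within {0..L})"
      "\<forall>x\<in>{0..L}. (\<psi>1 has_real_derivative \<psi>2 x) (at x within {0..L})"
      "\<forall>x\<in>{0..L}. (\<psi>2 has_real_derivative \<psi>3 x) (at x within {0..L})"
      "\<psi>4 \<in> L2 {0<..<L}" "\<forall>x\<in>{0..L}. \<psi>3 x = \<psi>3 0 + (\<integral>t. \<psi>4 t \<partial>lebesgue_on {0<..<x})"
      "AE x in lebesgue_on {0<..<L}. E * (d ^ 3 * 1 / 6) * \<psi>4 x = 2 * 1 * f x"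
    and bc: "\<psi> 0 = 0" "\<psi> L = 0" "\<psi>2 0 = 0" "\<psi>2 L = 0"
    using assms(13)[of 1, OF zero_less_one] unfolding beam_solution_def by blast
  have A4: "absolutely_continuous_L2 0 L \<psi>3 \<psi>4"
    using D(4,5) unfolding absolutely_continuous_L2_def by blast
  have c: "continuous_on {0..L} \<psi>1" "continuous_on {0..L} \<psi>2"
    using D(2,3) by (blast intro: DERIV_continuous_on)+
  have A: "absolutely_continuous_L2 0 L \<psi> \<psi>1" "absolutely_continuous_L2 0 L \<psi>1 \<psi>2"
    "absolutely_continuous_L2 0 L \<psi>2 \<psi>3"
    by (rule absolutely_continuous_L2_C1; (use D(1-3) in blast | fact c absolutely_continuous_L2_continuous[OF A4]))+
  have load: "AE x in lebesgue_on {0<..<L}. d ^ 3 * K / 12 * (1 + \<kappa> - \<nu>\<^sup>2) * \<psi>4 x = f x"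
    using D(6) by eventually_elim (simp add: assms(10) algebra_simps)
  define C where "C = 8 * ((1 + \<kappa>)\<^sup>2 + 5) * (\<integral>x. (\<psi>3 x)\<^sup>2 + (\<psi>4 x)\<^sup>2 \<partial>lebesgue_on {0<..<L})"
  obtain P where P: "\<And>x. x \<in> {0..L} \<Longrightarrow> \<bar>\<psi>2 x\<bar> \<le> P" by (rule continuous_bounded_Icc[OF c(2)]) (rule that)
  \<comment> \<open>The first summand bounds \<open>w\<close> by \<open>plate_sup_bound\<close> and \<open>L1_norm_plate_bound\<close>, the second the correction
    \<open>\<nu> / 2 * y\<^sup>2 * \<psi>2 x\<close>.\<close>
  define B where "B = (C / 2 + L) * (1 + L / 2) + P"
  have bound: "\<bar>u l (x, y) - \<psi> x\<bar> \<le> B * l" if l: "0 < l" "l \<le> 1" and p: "(x, y) \<in> plate L l" for l x y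
  proof -
    let ?M = "lebesgue_on (plate L l)"
    obtain w wxx wxy wyy where w: "w \<in> H2_star L l" "weak_hessian (plate L l) w wxx wxy wyy"
      "\<And>x y. w (x, y) = u l (x, y) - \<psi> x + \<nu> / 2 * (y\<^sup>2 * \<psi>2 x)"
      "(\<integral>p. (wxx p)\<^sup>2 + (wxy p)\<^sup>2 + (wyy p)\<^sup>2 \<partial>?M) \<le> C * l ^ 3"
    proof (rule plate_beam_energy[OF L l(1,2) _ _ _ K A A4 _ bc assms(11) load sol[OF l(1)]])
      show "0 \<le> \<nu>" "\<nu> \<le> 1 / 2" "0 \<le> \<kappa>" using \<nu> \<kappa> by simp_all
      show "(\<psi>2 has_real_derivative \<psi>3 x) (at x within {0..L})" if "x \<in> {0..L}" for x
        using D(3) that by blast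
    qed (rule that[unfolded C_def])
    have hx: "has_L2_weak_deriv (plate L l) [(1, 0), (1, 0)] w wxx"
      "has_L2_weak_deriv (plate L l) [(1, 0), (0, 1)] w wxy"
      and wL2: "wxx \<in> L2 (plate L l)" "wxy \<in> L2 (plate L l)" "wyy \<in> L2 (plate L l)"
      using w(2) by (auto simp: weak_hessian_def has_L2_weak_deriv_def)
    have i: "integrable (?M) (\<lambda>p. (wxx p)\<^sup>2 + (wxy p)\<^sup>2 + (wyy p)\<^sup>2)"
      by (intro Bochner_Integration.integrable_add L2_D(2) wL2)
    have "(\<integral>p. (wxx p)\<^sup>2 \<partial>?M) \<le> C * l ^ 3"
      "(\<integral>p. (wxy p)\<^sup>2 \<partial>?M) \<le> C * l ^ 3"
      by (rule order_trans[OF integral_mono' w(4)], rule i; simp)+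
    note n = L1_norm_plate_bound[OF wL2(1) L l(1) this(1)] L1_norm_plate_bound[OF wL2(2) L l(1) this(2)]
    have "\<bar>w (x, y)\<bar> \<le> (C / 2 + L) * l\<^sup>2 + L / (2 * l) * ((C / 2 + L) * l\<^sup>2)"
      using L l by (intro order_trans[OF plate_sup_bound[OF L l(1) w(1) hx p]] add_mono mult_left_mono n) simp
    also have "\<dots> = (C / 2 + L) * l * l + (C / 2 + L) * (L / 2) * l"
      using l by (simp add: power2_eq_square field_simps)
    also have "\<dots> \<le> (C / 2 + L) * l * 1 + (C / 2 + L) * (L / 2) * l"
    proof -
      have "0 \<le> C" unfolding C_def by (intro mult_nonneg_nonneg Bochner_Integration.integral_nonneg) auto
      then show ?thesis using L l by (intro add_right_mono mult_left_mono) auto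
    qed
    finally have w': "\<bar>w (x, y)\<bar> \<le> (C / 2 + L) * (1 + L / 2) * l" by (simp add: algebra_simps)
    have x: "x \<in> {0..L}" and y: "\<bar>y\<bar> \<le> l" using p by (auto simp: plate_def)
    have "\<bar>\<nu> / 2 * (y\<^sup>2 * \<psi>2 x)\<bar> \<le> P * l"
    proof -
      have "\<bar>y\<bar> * \<bar>y\<bar> \<le> l * 1" using y l by (intro mult_mono) auto
      then have y2: "y\<^sup>2 \<le> l" by (simp add: power2_eq_square)
      have "\<nu> / 2 * (y\<^sup>2 * \<bar>\<psi>2 x\<bar>) \<le> 1 * (l * P)"
        using \<nu> y2 P x l(1) by (intro mult_mono) auto
      then show ?thesis using \<nu> by (simp add: abs_mult mult.commute)
    qed
    then show ?thesis using w' w(3)[of x y] by (simp add: B_def distrib_right)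
  qed
  \<comment> \<open>The uniform bound also makes the set bounded above; otherwise its supremum would be a default value.\<close>
  have "\<forall>\<^sub>F l in at_right 0. norm (SUP (x, y) \<in> plate L l. \<bar>u l (x, y) - \<psi> x\<bar>) \<le> B * l"
  proof -
    have "\<forall>\<^sub>F l in at_right 0. l \<in> {0<..<1::real}" by (rule eventually_at_right_real) simp
    then show ?thesis
    proof eventually_elim
      case (elim l)
      let ?S = "SUP (x, y) \<in> plate L l. \<bar>u l (x, y) - \<psi> x\<bar>"
      have mem: "(L / 2, 0) \<in> plate L l" using L elim by (simp add: plate_def)
      have le: "(case p of (x, y) \<Rightarrow> \<bar>u l (x, y) - \<psi> x\<bar>) \<le> B * l" if "p \<in> plate L l" for p
        using bound[of l "fst p" "snd p"] elim that by (simp add: case_prod_unfold)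
      have "?S \<le> B * l" using mem le by (intro cSUP_least) auto
      moreover have "bdd_above ((\<lambda>(x, y). \<bar>u l (x, y) - \<psi> x\<bar>) ` plate L l)"
        using le by (intro bdd_aboveI2)
      then have "0 \<le> ?S" by (rule cSUP_upper2[OF _ mem]) simp
      ultimately show ?case by simp
    qed
  qed
  moreover have "((\<lambda>l. B * l) \<longlongrightarrow> 0) (at_right 0)"
    by (rule tendsto_eq_intros refl tendsto_ident_at | simp)+
  ultimately show ?thesis by (rule Lim_null_comparison)
qed

end
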